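(* There exist absolute constants $c>0$ and $X_0>0$ such that, for every real $X\ge X_0$, the interval $[1,X]$ contains a block of at least $\lfloor c\log\log X\rfloor$ consecutive integers not belonging to $\mathcal R=\{p+2^n : p \text{ prime},\ n\in\mathbb N\}$. In particular, $G_{\mathcal R}(X)\gg\log\log X$, i.e. there is an absolute constant $c'>0$ such that $G_{\mathcal R}(X)\ge c'\log\log X$ for all sufficiently large real $X$.
   Context: $\mathbb N=\{1,2,3,\ldots\}$, and $\mathbb Z_{\ge0}=\{0,1,2,\ldots\}$. The set $\mathcal R$ is $\{p+2^n : p\text{ prime},\ n\in\mathbb N\}$. The length of a block of consecutive integers is the number of integers in it. For real $X\ge1$, \[ G_{\mathcal R}(X)=\max\bigl(\{0\}\cup\{H\in\mathbb N : \exists N\in\mathbb Z_{\ge0},\ N+H\le X,\ \{N+1,\ldots,N+H\}\cap\mathcal R=\varnothing\}\bigr). \] Logarithms are natural, and $\lfloor v\rfloor$ is the greatest integer not exceeding $v$. *)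

theory Defs
  imports Complex_Main "HOL-Computational_Algebra.Primes"
begin

text \<open>The exponent starts at 1, so \<open>p + 1\<close> does not count as a representation.\<close>

definition prime_plus_pow2 :: "nat set" where
  "prime_plus_pow2 = {p + 2 ^ n | p n. prime p \<and> n \<ge> 1}"

definition gap_lengths :: "nat set \<Rightarrow> real \<Rightarrow> nat set" where
  "gap_lengths A X = {H. H \<ge> 1 \<and> (\<exists>N. real (N + H) \<le> X \<and> {N + 1..N + H} \<inter> A = {})}"

definition longest_gap :: "nat set \<Rightarrow> real \<Rightarrow> nat" where
  "longest_gap A X = Max ({0} \<union> gap_lengths A X)"

text \<open>The maximum is over a finite set, hence is a genuine maximum.\<close>

lemma finite_gap_lengths: "finite (gap_lengths A X)"
proof (rule finite_subset)
  show "gap_lengths A X \<subseteq> {..nat \<lfloor>X\<rfloor>}"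
    by (auto simp: gap_lengths_def) linarith
qed simp

end

theory Submission
  imports Defs "HOL-Number_Theory.Cong" "HOL-Library.FuncSet" "HOL-Library.Disjoint_Sets"
begin

text \<open>
  Write \<open>L = 2 ^ m\<close>. If \<open>N\<close> lies in the last quarter of the integers up to \<open>2 ^ L\<close> and
  \<open>N + i = p + 2 ^ n\<close> with \<open>1 \<le> i \<le> H\<close>, then \<open>n < L\<close> and \<open>p = N - s\<close> for the shift
  \<open>s = 2 ^ n - i\<close>; moreover \<open>p\<close> exceeds \<open>2 ^ (L - 2)\<close>. Hence a gap of length \<open>H\<close> follows as soon
  as every \<open>N - s\<close> has a prime factor of at most \<open>L / 16\<close> bits. There are at most \<open>H * L\<close>
  shifts, and the point is to reach \<open>H\<close> of order \<open>m\<close>, which is \<open>ln (ln X)\<close> up to constants.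
  Sieving greedily by the primes up to a power of \<open>L\<close> leaves about \<open>H * L / m\<close> shifts, and giving each
  of them its own prime costs \<open>m\<close> bits per shift, which only produces bounded gaps.

  The survivors of the greedy sieve are treated by a random choice. Put \<open>N = n + d * t\<close>, where \<open>d\<close>
  is the product of the small primes and \<open>t\<close> is random below \<open>T = 2 ^ (L / 2)\<close>, and use the primes
  of the blocks \<open>(2 ^ 2 ^ b, 2 ^ 2 ^ (b + 1)]\<close>. A shift is \<^emph>\<open>hit\<close> if one of these primes divides
  \<open>N - s\<close>. Together with the small primes, the blocks up to \<open>i\<close> leave a proportion of about \<open>2 ^ -i\<close> of all shifts
  without a hit, and the size of \<open>N\<close> keeps \<open>i\<close> below \<open>m\<close>. So the expected number of missed shifts is not below 1,
  and the first moment says nothing. Instead one exhibits a function \<open>F\<close> of the pattern of hits which has positive mean and is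
  nonpositive whenever some shift is missed.

  For each shift take functions \<open>\<psi>\<^sub>i\<close> of its hits, one for each block index \<open>i\<close>, which have mean 0, are orthogonal,
  and add up to \<open>-1\<close> if there is no hit. The product over all shifts of \<open>1 + (\<Sum>i. \<psi>\<^sub>i)\<close> then vanishes unless every
  shift is hit, and has mean 1. Expanding it gives one term for each choice of at most one \<open>i\<close> per shift.
  As \<open>\<psi>\<^sub>i\<close> depends on primes of about \<open>2 ^ i\<close> bits, a choice of \<open>i\<close> is given the cost \<open>2 ^ (i + 7)\<close>, the logarithm of
  the range of \<open>t\<close> that it takes to control \<open>\<psi>\<^sub>i\<close>. Only the terms of total cost at most \<open>B = L / 64\<close> are kept. Call their
  sum \<open>Q\<close>.
  If a shift \<open>s\<close> is missed, the terms of \<open>Q\<close> cancel except those of cost close to \<open>B\<close>, and \<open>Q\<close> equals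
  a function \<open>tail\<^sub>s\<close> of tiny second moment. So \<open>F = Q\<^sup>2 - (\<Sum>s. tail\<^sub>s\<^sup>2)\<close> does what is wanted.

  The cost stays within the budget because \<open>\<psi>\<^sub>i\<close> is proportional to the centred number of hits in block \<open>i\<close>
  but is damped, by a truncated inclusion-exclusion sum, unless the blocks below \<open>i\<close> miss the shift. Summed over the
  survivors of the first sieve, its variance is about \<open>H * L * 2 ^ -i / M\<^sup>2\<close>, where \<open>M\<close>, of order \<open>m\<close>, is the expected number of hits of
  a shift. The factor \<open>2 ^ -i\<close> balances the cost of \<open>\<psi>\<^sub>i\<close>, and the sum over about \<open>m\<close> blocks gives a mean total cost of
  order \<open>H * L / m\<close>. Spreading the work over all blocks is what allows \<open>H\<close> to be of order \<open>m\<close>.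

  All means are computed in a model in which all hits are independent. The hit probabilities are chosen so that the
  model, conditioned on every prime hitting at most one shift, has the distribution of a uniformly random
  residue modulo each prime (\<open>single_hits_monomial\<close>). Since \<open>F\<close> is a polynomial in the hits whose coefficients sum to much
  less than \<open>T\<close>, its mean over \<open>t < T\<close> agrees with the conditional mean (\<open>transfer_to_integers\<close>). Orthogonality and
  truncation are the locale \<open>tensor_weights\<close>, the functions \<open>\<psi>\<^sub>i\<close> are constructed in the locale \<open>bin_blocks\<close>, and
  \<open>block_sieve\<close> combines the two.
\<close>

section \<open>Expectations over independent Bernoulli variables\<close>

text \<open>The expectation of \<open>f\<close> at the random subset of \<open>P\<close> which contains each \<open>a\<close> independently with probability \<open>q a\<close>,
  as an explicit finite sum. No probability space has to be built, and the induction over \<open>P\<close> is \<open>bern_exp_insert\<close>.\<close>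

definition bern_exp :: "('a \<Rightarrow> real) \<Rightarrow> 'a set \<Rightarrow> ('a set \<Rightarrow> real) \<Rightarrow> real" where
  "bern_exp q P f = (\<Sum>x\<in>Pow P. (\<Prod>a\<in>x. q a) * (\<Prod>a\<in>P - x. 1 - q a) * f x)"

lemma bern_exp_empty [simp]: "bern_exp q {} f = f {}"
  by (simp add: bern_exp_def)

lemma bern_exp_cong:
  assumes "\<And>x. x \<subseteq> P \<Longrightarrow> f x = g x"
  shows "bern_exp q P f = bern_exp q P g"
  unfolding bern_exp_def using assms by (intro sum.cong) auto

lemma bern_exp_add: "bern_exp q P (\<lambda>x. f x + g x) = bern_exp q P f + bern_exp q P g"
  by (simp add: bern_exp_def algebra_simps sum.distrib)

lemma bern_exp_cmult: "bern_exp q P (\<lambda>x. c * f x) = c * bern_exp q P f"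
  by (simp add: bern_exp_def sum_distrib_left mult_ac)

lemma bern_exp_diff: "bern_exp q P (\<lambda>x. f x - g x) = bern_exp q P f - bern_exp q P g"
  by (simp add: bern_exp_def algebra_simps sum_subtractf)

lemma bern_exp_sum: "bern_exp q P (\<lambda>x. \<Sum>i\<in>I. f i x) = (\<Sum>i\<in>I. bern_exp q P (f i))"
proof -
  have "bern_exp q P (\<lambda>x. \<Sum>i\<in>I. f i x)
      = (\<Sum>x\<in>Pow P. \<Sum>i\<in>I. (\<Prod>a\<in>x. q a) * (\<Prod>a\<in>P - x. 1 - q a) * f i x)"
    by (simp add: bern_exp_def sum_distrib_left)
  also have "\<dots> = (\<Sum>i\<in>I. bern_exp q P (f i))"
    unfolding bern_exp_def by (rule sum.swap)
  finally show ?thesis .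
qed

lemma bern_exp_mono:
  assumes "\<And>a. a \<in> P \<Longrightarrow> 0 \<le> q a \<and> q a \<le> 1" "\<And>x. x \<subseteq> P \<Longrightarrow> f x \<le> g x"
  shows "bern_exp q P f \<le> bern_exp q P g"
  unfolding bern_exp_def
proof (rule sum_mono)
  fix x assume x: "x \<in> Pow P"
  have "0 \<le> (\<Prod>a\<in>x. q a)" "0 \<le> (\<Prod>a\<in>P - x. 1 - q a)"
    using x assms(1) by (auto intro!: prod_nonneg simp: subset_iff)
  then show "(\<Prod>a\<in>x. q a) * (\<Prod>a\<in>P - x. 1 - q a) * f x
      \<le> (\<Prod>a\<in>x. q a) * (\<Prod>a\<in>P - x. 1 - q a) * g x"
    using x assms(2) by (intro mult_left_mono) auto
qed

lemma bern_exp_insert: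
  assumes "finite P" "a \<notin> P"
  shows "bern_exp q (insert a P) f
    = (1 - q a) * bern_exp q P f + q a * bern_exp q P (\<lambda>x. f (insert a x))"
proof -
  have inj: "inj_on (insert a) (Pow P)" using assms by (auto simp: inj_on_def)
  have dis: "Pow P \<inter> insert a ` Pow P = {}" using assms by auto
  have 1: "(\<Sum>x\<in>Pow P. (\<Prod>a\<in>x. q a) * (\<Prod>b\<in>insert a P - x. 1 - q b) * f x)
      = (1 - q a) * bern_exp q P f"
    unfolding bern_exp_def sum_distrib_left
  proof (rule sum.cong)
    fix x assume x: "x \<in> Pow P"
    then have "insert a P - x = insert a (P - x)" "a \<notin> P - x" "finite (P - x)"
      using assms by auto
    then show "(\<Prod>a\<in>x. q a) * (\<Prod>b\<in>insert a P - x. 1 - q b) * f x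
        = (1 - q a) * ((\<Prod>a\<in>x. q a) * (\<Prod>a\<in>P - x. 1 - q a) * f x)"
      by simp
  qed simp
  have 2: "(\<Sum>x\<in>insert a ` Pow P. (\<Prod>a\<in>x. q a) * (\<Prod>b\<in>insert a P - x. 1 - q b) * f x)
      = q a * bern_exp q P (\<lambda>x. f (insert a x))"
    unfolding bern_exp_def sum_distrib_left sum.reindex[OF inj] o_def
  proof (rule sum.cong)
    fix x assume x: "x \<in> Pow P"
    then have "insert a P - insert a x = P - x" "a \<notin> x" "finite x"
      using assms finite_subset by auto
    then show "(\<Prod>a\<in>insert a x. q a) * (\<Prod>b\<in>insert a P - insert a x. 1 - q b) * f (insert a x)
        = q a * ((\<Prod>a\<in>x. q a) * (\<Prod>a\<in>P - x. 1 - q a) * f (insert a x))"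
      by simp
  qed simp
  show ?thesis
    unfolding bern_exp_def[of q "insert a P"] Pow_insert
    using assms by (subst sum.union_disjoint) (use dis 1 2 in auto)
qed

lemma bern_exp_Un:
  assumes "finite P" "finite R" "P \<inter> R = {}"
  shows "bern_exp q (P \<union> R) f = bern_exp q P (\<lambda>x. bern_exp q R (\<lambda>y. f (x \<union> y)))"
  using assms
proof (induction P arbitrary: f rule: finite_induct)
  case (insert a P)
  then have a: "a \<notin> P \<union> R" "finite (P \<union> R)" by auto
  have "bern_exp q (insert a P \<union> R) f
      = (1 - q a) * bern_exp q (P \<union> R) f + q a * bern_exp q (P \<union> R) (\<lambda>x. f (insert a x))"
    using bern_exp_insert[OF a(2,1)] by simp
  also have "\<dots> = bern_exp q (insert a P) (\<lambda>x. bern_exp q R (\<lambda>y. f (x \<union> y)))"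
    using insert by (simp add: bern_exp_insert)
  finally show ?case .
qed simp

lemma bern_exp_const [simp]: "finite P \<Longrightarrow> bern_exp q P (\<lambda>_. c) = c"
  by (induction P rule: finite_induct) (auto simp: bern_exp_insert algebra_simps)

lemma bern_exp_indep:
  assumes "finite P" "finite R" "P \<inter> R = {}"
  shows "bern_exp q (P \<union> R) (\<lambda>x. f (x \<inter> P) * g (x \<inter> R)) = bern_exp q P f * bern_exp q R g"
proof -
  have "bern_exp q (P \<union> R) (\<lambda>x. f (x \<inter> P) * g (x \<inter> R))
      = bern_exp q P (\<lambda>x. bern_exp q R (\<lambda>y. f x * g y))"
    unfolding bern_exp_Un[OF assms]
  proof (intro bern_exp_cong)
    fix x y assume "x \<subseteq> P" "y \<subseteq> R"
    then have "(x \<union> y) \<inter> P = x" "(x \<union> y) \<inter> R = y" using assms by auto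
    then show "f ((x \<union> y) \<inter> P) * g ((x \<union> y) \<inter> R) = f x * g y" by simp
  qed
  also have "\<dots> = bern_exp q P f * bern_exp q R g"
  proof -
    have "bern_exp q P (\<lambda>x. bern_exp q R g * f x) = bern_exp q R g * bern_exp q P f"
      by (rule bern_exp_cmult)
    then show ?thesis by (simp add: bern_exp_cmult mult.commute)
  qed
  finally show ?thesis .
qed

lemma bern_exp_prod:
  assumes "finite I" "\<And>i. i \<in> I \<Longrightarrow> finite (K i)" "disjoint_family_on K I"
  shows "bern_exp q (\<Union>i\<in>I. K i) (\<lambda>x. \<Prod>i\<in>I. f i (x \<inter> K i)) = (\<Prod>i\<in>I. bern_exp q (K i) (f i))"
  using assms
proof (induction I rule: finite_induct)
  case (insert i I)
  let ?U = "\<Union>i\<in>I. K i"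
  have dis: "K i \<inter> ?U = {}"
    using insert.prems insert.hyps by (auto simp: disjoint_family_on_def)
  have "bern_exp q (K i \<union> ?U) (\<lambda>x. \<Prod>j\<in>insert i I. f j (x \<inter> K j))
      = bern_exp q (K i \<union> ?U) (\<lambda>x. f i (x \<inter> K i) * (\<lambda>z. \<Prod>j\<in>I. f j (z \<inter> K j)) (x \<inter> ?U))"
  proof (rule bern_exp_cong)
    fix x
    have "x \<inter> ?U \<inter> K j = x \<inter> K j" if "j \<in> I" for j using that by auto
    then show "(\<Prod>j\<in>insert i I. f j (x \<inter> K j))
        = f i (x \<inter> K i) * (\<lambda>z. \<Prod>j\<in>I. f j (z \<inter> K j)) (x \<inter> ?U)"
      using insert by simp
  qed
  also have "\<dots> = bern_exp q (K i) (f i) * bern_exp q ?U (\<lambda>z. \<Prod>j\<in>I. f j (z \<inter> K j))"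
    using insert.prems insert.hyps dis by (intro bern_exp_indep) auto
  also have "\<dots> = bern_exp q (K i) (f i) * (\<Prod>j\<in>I. bern_exp q (K j) (f j))"
    using insert by (simp add: disjoint_family_on_def)
  finally show ?case using insert by simp
qed simp

text \<open>Expanding the square, all cross terms vanish: by independence of the cells \<open>K s\<close> the mean of such a term is a product over
  \<open>s\<close>, and \<open>orth\<close> supplies a factor 0. The extra weights \<open>y\<close> make it possible to restrict some cells to
  an event; orthogonality is then demanded only through some cell where it survives.\<close>

lemma bern_exp_parseval:
  fixes \<psi> :: "'s \<Rightarrow> 'o \<Rightarrow> 'a set \<Rightarrow> real"
  assumes S: "finite S" "\<And>s. s \<in> S \<Longrightarrow> finite (K s)" "disjoint_family_on K S" "finite \<A>"
    and orth: "\<And>A A'. A \<in> \<A> \<Longrightarrow> A' \<in> \<A> \<Longrightarrow> A \<noteq> A' \<Longrightarrow>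
      \<exists>s\<in>S. bern_exp q (K s) (\<lambda>x. \<psi> s (A s) x * \<psi> s (A' s) x * y s x) = 0"
  shows "bern_exp q (\<Union>s\<in>S. K s)
        (\<lambda>x. (\<Sum>A\<in>\<A>. h A * (\<Prod>s\<in>S. \<psi> s (A s) (x \<inter> K s)))\<^sup>2 * (\<Prod>s\<in>S. y s (x \<inter> K s)))
    = (\<Sum>A\<in>\<A>. (h A)\<^sup>2 * (\<Prod>s\<in>S. bern_exp q (K s) (\<lambda>x. (\<psi> s (A s) x)\<^sup>2 * y s x)))"
proof -
  let ?U = "\<Union>s\<in>S. K s"
  have E: "bern_exp q ?U (\<lambda>x. \<Prod>s\<in>S. \<psi> s (A s) (x \<inter> K s) * \<psi> s (A' s) (x \<inter> K s) * y s (x \<inter> K s))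
     = (\<Prod>s\<in>S. bern_exp q (K s) (\<lambda>x. \<psi> s (A s) x * \<psi> s (A' s) x * y s x))" for A A'
    by (rule bern_exp_prod[OF S(1,2,3), where f = "\<lambda>s x. \<psi> s (A s) x * \<psi> s (A' s) x * y s x"])
  have zero: "(\<Prod>s\<in>S. bern_exp q (K s) (\<lambda>x. \<psi> s (A s) x * \<psi> s (A' s) x * y s x)) = 0"
    if "A \<in> \<A>" "A' \<in> \<A>" "A \<noteq> A'" for A A'
    using orth[OF that] S(1) by (auto simp: prod_zero_iff)
  have "bern_exp q ?U
        (\<lambda>x. (\<Sum>A\<in>\<A>. h A * (\<Prod>s\<in>S. \<psi> s (A s) (x \<inter> K s)))\<^sup>2 * (\<Prod>s\<in>S. y s (x \<inter> K s)))
     = bern_exp q ?U (\<lambda>x. \<Sum>A\<in>\<A>. \<Sum>A'\<in>\<A>. (h A * h A') *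
        (\<Prod>s\<in>S. \<psi> s (A s) (x \<inter> K s) * \<psi> s (A' s) (x \<inter> K s) * y s (x \<inter> K s)))"
    unfolding power2_eq_square sum_product prod.distrib
    unfolding sum_distrib_right
    by (intro bern_exp_cong sum.cong refl) (simp add: mult_ac)
  also have "\<dots> = (\<Sum>A\<in>\<A>. \<Sum>A'\<in>\<A>. (h A * h A') *
        (\<Prod>s\<in>S. bern_exp q (K s) (\<lambda>x. \<psi> s (A s) x * \<psi> s (A' s) x * y s x)))"
    by (simp only: bern_exp_sum bern_exp_cmult E)
  also have "\<dots> = (\<Sum>A\<in>\<A>. \<Sum>A'\<in>\<A>. if A' = A then (h A * h A') *
        (\<Prod>s\<in>S. bern_exp q (K s) (\<lambda>x. \<psi> s (A s) x * \<psi> s (A' s) x * y s x)) else 0)"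
    using zero by (intro sum.cong refl) auto
  also have "\<dots> = (\<Sum>A\<in>\<A>. (h A)\<^sup>2 * (\<Prod>s\<in>S. bern_exp q (K s) (\<lambda>x. (\<psi> s (A s) x)\<^sup>2 * y s x)))"
    using S(4) by (simp add: power2_eq_square)
  finally show ?thesis .
qed

lemma bern_exp_power_card:
  assumes "finite P"
  shows "bern_exp q P (\<lambda>x. c ^ card x) = (\<Prod>a\<in>P. 1 + (c - 1) * q a)"
  using assms
proof (induction P rule: finite_induct)
  case (insert a P)
  have "bern_exp q P (\<lambda>x. c ^ card (insert a x)) = bern_exp q P (\<lambda>x. c * c ^ card x)"
    using insert by (intro bern_exp_cong) (auto simp: card_insert_if finite_subset)
  with insert show ?case by (simp add: bern_exp_insert bern_exp_cmult algebra_simps)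
qed simp

lemma bern_exp_card:
  assumes "finite P"
  shows "bern_exp q P (\<lambda>x. real (card x)) = sum q P"
  using assms
proof (induction P rule: finite_induct)
  case (insert a P)
  have "bern_exp q P (\<lambda>x. real (card (insert a x))) = bern_exp q P (\<lambda>x. 1 + real (card x))"
    using insert by (intro bern_exp_cong) (auto simp: card_insert_if finite_subset)
  with insert show ?case by (simp add: bern_exp_insert bern_exp_add algebra_simps)
qed simp

lemma bern_exp_centred:
  assumes "finite P"
  shows "bern_exp q P (\<lambda>x. real (card x) - sum q P) = 0"
  using assms by (simp add: bern_exp_diff bern_exp_card)

text \<open>Induction over \<open>P\<close>: adding an element \<open>a\<close> shifts the centred count by \<open>- q a\<close> or \<open>1 - q a\<close>, and the resulting linear
  terms have mean 0.\<close>

lemma bern_exp_variance: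
  assumes "finite P"
  shows "bern_exp q P (\<lambda>x. (real (card x) - sum q P)\<^sup>2) = (\<Sum>a\<in>P. q a * (1 - q a))"
  using assms
proof (induction P rule: finite_induct)
  case (insert a P)
  let ?Y = "\<lambda>x. real (card x) - sum q P"
  have 1: "bern_exp q P (\<lambda>x. (real (card x) - sum q (insert a P))\<^sup>2)
     = bern_exp q P (\<lambda>x. (?Y x)\<^sup>2 + ((- 2 * q a) * ?Y x + (q a)\<^sup>2))"
    using insert by (intro bern_exp_cong) (auto simp: power2_eq_square algebra_simps)
  have 2: "bern_exp q P (\<lambda>x. (real (card (insert a x)) - sum q (insert a P))\<^sup>2)
     = bern_exp q P (\<lambda>x. (?Y x)\<^sup>2 + ((2 * (1 - q a)) * ?Y x + (1 - q a)\<^sup>2))"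
  proof (intro bern_exp_cong)
    fix x assume "x \<subseteq> P"
    then have "card (insert a x) = Suc (card x)"
      using insert by (auto simp: card_insert_if finite_subset)
    then show "(real (card (insert a x)) - sum q (insert a P))\<^sup>2
        = (?Y x)\<^sup>2 + ((2 * (1 - q a)) * ?Y x + (1 - q a)\<^sup>2)"
      using insert by (auto simp: power2_eq_square algebra_simps)
  qed
  have 3: "bern_exp q P ?Y = 0" using insert by (intro bern_exp_centred)
  show ?case
    unfolding bern_exp_insert[OF insert(1,2)] 1 2 bern_exp_add bern_exp_cmult 3
    using insert by (simp add: power2_eq_square algebra_simps)
qed simp

section \<open>Truncated inclusion-exclusion\<close>

text \<open>The full alternating sum of \<open>n choose t\<close> is the indicator of \<open>n = 0\<close>. Its truncation at \<open>r\<close> is a polynomial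
  of degree \<open>r\<close> in the hits, and differs from the indicator only for \<open>n > r\<close>.\<close>

definition brun_weight :: "nat \<Rightarrow> nat \<Rightarrow> real" where
  "brun_weight r n = (\<Sum>t\<le>r. (-1) ^ t * real (n choose t))"

lemma brun_weight_0 [simp]: "brun_weight r 0 = 1"
proof -
  have "brun_weight r 0 = (\<Sum>t\<le>r. if t = 0 then 1 else 0)"
    unfolding brun_weight_def by (intro sum.cong) auto
  then show ?thesis by simp
qed

lemma brun_weight_Suc: "brun_weight r (Suc n) = (-1) ^ r * real (n choose r)"
  by (induction r) (auto simp: brun_weight_def algebra_simps)

lemma abs_brun_weight_le: "\<bar>brun_weight r n\<bar> \<le> 2 ^ n"
proof (cases n)
  case (Suc k)
  have "real (k choose r) \<le> 2 ^ k"
    using binomial_le_pow2[of k r] by (metis of_nat_le_iff of_nat_numeral of_nat_power)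
  also have "(2::real) ^ k \<le> 2 ^ Suc k" by simp
  finally show ?thesis using Suc by (simp add: brun_weight_Suc abs_mult)
qed simp

text \<open>The truncation is exact for \<open>n \<le> r\<close>. Otherwise the trivial bound \<open>4 ^ n\<close> is at most \<open>8 ^ n / 2 ^ (r + 1)\<close>, whose
  expectation is a product and gains a power of 2 for every unit of \<open>r\<close>.\<close>

lemma brun_weight_square_le: "(brun_weight r n)\<^sup>2 \<le> 0 ^ n + 8 ^ n / 2 ^ (r + 1)"
proof -
  consider "n = 0" | "0 < n" "n \<le> r" | "n \<ge> r + 1" by linarith
  then show ?thesis
  proof cases
    case 2
    then obtain k where "n = Suc k" "k < r" by (cases n) auto
    then show ?thesis by (simp add: brun_weight_Suc binomial_eq_0)
  next
    case 3
    have "(brun_weight r n)\<^sup>2 \<le> (2 ^ n)\<^sup>2"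
      using abs_brun_weight_le[of r n] by (metis abs_ge_zero power2_abs power_mono)
    also have "(2 ^ n)\<^sup>2 = (4::real) ^ n"
      by (simp add: power2_eq_square power_mult_distrib[symmetric])
    also have "(4::real) ^ n = 8 ^ n / 2 ^ n"
      by (simp add: power_divide[symmetric])
    also have "\<dots> \<le> 8 ^ n / 2 ^ (r + 1)"
      using 3 by (intro divide_left_mono power_increasing) auto
    finally show ?thesis using 3 by (auto simp: power_0_left)
  qed auto
qed

lemma bern_exp_brun_weight_square:
  assumes "finite P" "\<And>a. a \<in> P \<Longrightarrow> 0 \<le> q a \<and> q a \<le> 1"
  shows "bern_exp q P (\<lambda>x. (brun_weight r (card x))\<^sup>2)
    \<le> (\<Prod>a\<in>P. 1 - q a) + (\<Prod>a\<in>P. 1 + 7 * q a) / 2 ^ (r + 1)"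
proof -
  have "bern_exp q P (\<lambda>x. (brun_weight r (card x))\<^sup>2)
      \<le> bern_exp q P (\<lambda>x. 0 ^ card x + (1 / 2 ^ (r + 1)) * 8 ^ card x)"
    using brun_weight_square_le[of r] assms by (intro bern_exp_mono) auto
  also have "\<dots> = bern_exp q P (\<lambda>x. 0 ^ card x) + (1 / 2 ^ (r + 1)) * bern_exp q P (\<lambda>x. 8 ^ card x)"
    by (simp only: bern_exp_add bern_exp_cmult)
  also have "\<dots> = (\<Prod>a\<in>P. 1 - q a) + (\<Prod>a\<in>P. 1 + 7 * q a) / 2 ^ (r + 1)"
    unfolding bern_exp_power_card[OF assms(1)] by simp
  finally show ?thesis .
qed

section \<open>Primes in dyadic and doubly exponential ranges\<close>

lemma exp_minus_two_le:
  fixes x :: real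
  assumes "0 \<le> x" "x \<le> 1 / 2"
  shows "exp (- 2 * x) \<le> 1 - x"
proof -
  have "x * x \<le> x * (1 / 2)" using assms by (intro mult_left_mono) auto
  then have "- 2 * x \<le> - x - 2 * x\<^sup>2" by (simp add: power2_eq_square)
  also have "\<dots> \<le> ln (1 - x)" using assms by (intro ln_one_minus_pos_lower_bound) auto
  finally have "exp (- 2 * x) \<le> exp (ln (1 - x))" by simp
  then show ?thesis using assms by simp
qed

lemma prod_one_minus_ge_exp:
  assumes "finite P" "\<And>p. p \<in> P \<Longrightarrow> 0 \<le> f p \<and> f p \<le> (1/2::real)"
  shows "exp (- 2 * sum f P) \<le> (\<Prod>p\<in>P. 1 - f p)"
proof -
  have "exp (- 2 * sum f P) = (\<Prod>p\<in>P. exp (- 2 * f p))"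
    using assms(1) by (simp add: exp_sum sum_distrib_left)
  also have "\<dots> \<le> (\<Prod>p\<in>P. 1 - f p)"
    using assms(2) exp_minus_two_le by (intro prod_mono) auto
  finally show ?thesis .
qed

lemma prod_primes_dvd:
  fixes n :: nat
  assumes "finite P" "\<And>p. p \<in> P \<Longrightarrow> prime p \<and> p dvd n"
  shows "\<Prod>P dvd n"
  using assms
proof (induction P rule: finite_induct)
  case (insert p P)
  have "coprime p (\<Prod>P)"
  proof (rule prod_coprime_right)
    fix i assume "i \<in> P"
    then show "coprime p i" using insert by (intro primes_coprime) auto
  qed
  then show ?case using insert by (auto intro: divides_mult)
qed simp

lemma card_prime_divisors_le:
  fixes n :: nat
  assumes "n > 0" "finite P" "\<And>p. p \<in> P \<Longrightarrow> prime p \<and> p dvd n"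
  shows "2 ^ card P \<le> n"
proof -
  have "(2::nat) ^ card P = (\<Prod>p\<in>P. 2)" by simp
  also have "\<dots> \<le> \<Prod>P" using assms(3) prime_ge_2_nat by (intro prod_mono) auto
  also have "\<dots> \<le> n" using prod_primes_dvd[OF assms(2,3)] assms(1) by (simp add: dvd_imp_le)
  finally show ?thesis .
qed

lemma sum_inverse_squares_le:
  assumes "finite P" "\<And>p::nat. p \<in> P \<Longrightarrow> y < p" "y > 0"
  shows "(\<Sum>p\<in>P. 1 / (real p)\<^sup>2) \<le> 1 / real y"
proof -
  have tel: "(\<Sum>p\<in>{y<..y+n}. 1 / (real p)\<^sup>2) \<le> 1 / real y - 1 / real (y + n)" for n
  proof (induction n)
    case (Suc n)
    have "{y<..y + Suc n} = insert (y + Suc n) {y<..y + n}" by auto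
    then have "(\<Sum>p\<in>{y<..y+Suc n}. 1 / (real p)\<^sup>2)
        \<le> 1 / (real (y + Suc n))\<^sup>2 + (1 / real y - 1 / real (y + n))" using Suc by simp
    also have "1 / (real (y + Suc n))\<^sup>2 \<le> 1 / (real (y + n) * real (y + Suc n))"
      using assms(3) by (intro divide_left_mono) (auto simp: power2_eq_square)
    also have "1 / (real (y + n) * real (y + Suc n)) = 1 / real (y + n) - 1 / real (y + Suc n)"
      using assms(3) by (simp add: divide_simps)
    finally show ?case by simp
  qed simp
  have "(\<Sum>p\<in>P. 1 / (real p)\<^sup>2) \<le> (\<Sum>p\<in>{y<..y+Max (insert 0 P)}. 1 / (real p)\<^sup>2)"
  proof (rule sum_mono2)
    have "p \<le> Max (insert 0 P)" if "p \<in> P" for p using assms(1) that by (intro Max_ge) auto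
    then show "P \<subseteq> {y<..y+Max (insert 0 P)}" using assms(2) by (fastforce intro: trans_le_add2)
  qed auto
  also have "\<dots> \<le> 1 / real y - 1 / real (y + Max (insert 0 P))" by (rule tel)
  also have "\<dots> \<le> 1 / real y" by simp
  finally show ?thesis .
qed

definition primes_upto :: "nat \<Rightarrow> nat set" where
  "primes_upto n = {p. prime p \<and> p \<le> n}"

definition primes_between :: "nat \<Rightarrow> nat \<Rightarrow> nat set" where
  "primes_between a b = {p. prime p \<and> a < p \<and> p \<le> b}"

lemma finite_primes_upto [simp]: "finite (primes_upto n)"
  by (rule finite_subset[of _ "{..n}"]) (auto simp: primes_upto_def)

lemma finite_primes_between [simp]: "finite (primes_between a b)"
  by (rule finite_subset[of _ "{..b}"]) (auto simp: primes_between_def)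

text \<open>The Euler product inequality without infinite series: for \<open>F P\<close> the harmonic sum over the \<open>k \<le> n\<close> composed of primes in \<open>P\<close>,
  sorting out the multiples of a new prime \<open>p\<close> gives \<open>F (insert p P) \<le> F P + F (insert p P) / p\<close>.\<close>

lemma smooth_harmonic_le:
  assumes "finite P" "\<And>p. p \<in> P \<Longrightarrow> prime (p::nat)"
  shows "(\<Sum>k | 1 \<le> k \<and> k \<le> n \<and> prime_factors k \<subseteq> P. 1 / real k) * (\<Prod>p\<in>P. 1 - 1 / real p) \<le> 1"
  using assms
proof (induction P rule: finite_induct)
  case empty
  have "k = 1" if "1 \<le> k" "prime_factors k \<subseteq> {}" for k :: nat
  proof (rule ccontr)
    assume "k \<noteq> 1"
    then obtain p where "prime p" "p dvd k" using prime_factor_nat by blast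
    then show False using that by (auto simp: prime_factors_dvd)
  qed
  then have "{k. 1 \<le> k \<and> k \<le> n \<and> prime_factors k \<subseteq> {}} \<subseteq> {1}" by blast
  then have "(\<Sum>k | 1 \<le> k \<and> k \<le> n \<and> prime_factors k \<subseteq> {}. 1 / real k) \<le> (\<Sum>k\<in>{1}. 1 / real k)"
    by (intro sum_mono2) auto
  then show ?case by simp
next
  case (insert p P)
  define F where "F = (\<lambda>P. \<Sum>k | 1 \<le> k \<and> k \<le> n \<and> prime_factors k \<subseteq> P. 1 / real k)"
  let ?A = "{k. 1 \<le> k \<and> k \<le> n \<and> prime_factors k \<subseteq> insert p P}"
  let ?B = "{k. 1 \<le> k \<and> k \<le> n \<and> prime_factors k \<subseteq> P}"
  have p: "prime p" "p \<ge> 2" using insert prime_ge_2_nat by auto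
  have fin: "finite ?A" "finite ?B" by auto
  have sub: "?A \<subseteq> ?B \<union> (\<lambda>k. p * k) ` ?A"
  proof
    fix k assume k: "k \<in> ?A"
    show "k \<in> ?B \<union> (\<lambda>k. p * k) ` ?A"
    proof (cases "p dvd k")
      case True
      then obtain j where j: "k = p * j" by blast
      have "j \<noteq> 0" using k j by auto
      moreover have "j \<le> k" using j p by simp
      moreover have "prime_factors j \<subseteq> prime_factors k"
        using k j by (intro dvd_prime_factors) auto
      ultimately have "j \<in> ?A" using k by auto
      then show ?thesis using j by auto
    next
      case False
      then have "p \<notin> prime_factors k" by (auto dest: in_prime_factors_imp_dvd)
      then show ?thesis using k by auto
    qed
  qed
  have "F (insert p P) \<le> (\<Sum>k\<in>?B \<union> (\<lambda>k. p * k) ` ?A. 1 / real k)"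
    unfolding F_def using sub fin by (intro sum_mono2) auto
  also have "\<dots> \<le> F P + (\<Sum>k\<in>(\<lambda>k. p * k) ` ?A. 1 / real k)"
    unfolding F_def using fin by (subst sum_Un) (auto intro!: sum_nonneg)
  also have "(\<Sum>k\<in>(\<lambda>k. p * k) ` ?A. 1 / real k) = (1 / real p) * F (insert p P)"
    unfolding F_def using p
    by (subst sum.reindex) (auto simp: inj_on_def sum_distrib_left)
  finally have "F (insert p P) * (1 - 1 / real p) \<le> F P" by (simp add: algebra_simps)
  moreover have "0 \<le> (\<Prod>p\<in>P. 1 - 1 / real p)"
    using insert.prems by (intro prod_nonneg) (auto dest!: prime_gt_0_nat simp: divide_simps)
  ultimately have "F (insert p P) * (1 - 1 / real p) * (\<Prod>p\<in>P. 1 - 1 / real p)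
      \<le> F P * (\<Prod>p\<in>P. 1 - 1 / real p)" by (intro mult_right_mono)
  also have "\<dots> \<le> 1" using insert unfolding F_def by auto
  finally show ?case using insert.hyps unfolding F_def by (simp add: mult_ac)
qed

lemma ln_le_harmonic: "ln (real (n + 1)) \<le> (\<Sum>k=1..n. 1 / real k)"
proof (induction n)
  case (Suc n)
  have "real (Suc n + 1) = real (n + 1) * (1 + 1 / real (n + 1))"
    by (simp add: divide_simps)
  then have "ln (real (Suc n + 1)) = ln (real (n + 1) * (1 + 1 / real (n + 1)))"
    by (simp only:)
  also have "\<dots> = ln (real (n + 1)) + ln (1 + 1 / real (n + 1))"
    by (rule ln_mult_pos) (auto intro!: add_pos_pos)
  also have "ln (1 + 1 / real (n + 1)) \<le> 1 / real (n + 1)"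
    by (rule ln_add_one_self_le_self) auto
  finally show ?case using Suc by simp
qed simp

text \<open>Every \<open>k \<le> n\<close> is composed of primes up to \<open>n\<close>, so the preceding inequality applies to the full harmonic sum.\<close>

lemma mertens_product_le:
  assumes "n > 0"
  shows "(\<Prod>p\<in>primes_upto n. 1 - 1 / real p) \<le> 1 / ln (real (n + 1))"
proof -
  have eq: "{k. 1 \<le> k \<and> k \<le> n \<and> prime_factors k \<subseteq> primes_upto n} = {1..n}"
  proof (intro equalityI subsetI)
    fix k assume k: "k \<in> {1..n}"
    have "p \<in> primes_upto n" if "p \<in> prime_factors k" for p
    proof -
      have "prime p" "p dvd k" using that by auto
      then show ?thesis using k dvd_imp_le[of p k] by (auto simp: primes_upto_def)
    qed
    then show "k \<in> {k. 1 \<le> k \<and> k \<le> n \<and> prime_factors k \<subseteq> primes_upto n}" using k by auto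
  qed auto
  have "(\<Sum>k=1..n. 1 / real k) * (\<Prod>p\<in>primes_upto n. 1 - 1 / real p) \<le> 1"
    unfolding eq[symmetric] by (rule smooth_harmonic_le) (simp, simp add: primes_upto_def)
  moreover have "0 \<le> (\<Prod>p\<in>primes_upto n. 1 - 1 / real p)"
    by (intro prod_nonneg) (auto simp: primes_upto_def divide_simps dest!: prime_gt_0_nat)
  ultimately have "ln (real (n + 1)) * (\<Prod>p\<in>primes_upto n. 1 - 1 / real p) \<le> 1"
    using ln_le_harmonic[of n] by (meson mult_right_mono order_trans)
  moreover have "ln (real (n + 1)) > 0" using assms by simp
  ultimately show ?thesis by (simp add: field_simps)
qed

lemma four_power_power: "(4::nat) ^ 2 ^ k = 2 ^ 2 ^ (k + 1)"
  using power_mult[of "2::nat" 2 "2 ^ k"] by simp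

text \<open>Chebyshev's argument: these primes all divide the central binomial coefficient.\<close>

lemma prod_primes_between_le: "\<Prod>(primes_between n (2 * n)) \<le> 4 ^ n"
proof -
  have "\<Prod>(primes_between n (2 * n)) dvd (2 * n choose n)"
  proof (rule prod_primes_dvd)
    fix p assume p: "p \<in> primes_between n (2 * n)"
    then have pp: "prime p" by (simp add: primes_between_def)
    have "fact n * fact (2 * n - n) * (2 * n choose n) = fact (2 * n)"
      by (rule binomial_fact_lemma) auto
    moreover have "p dvd fact (2 * n)"
      using p by (simp add: primes_between_def prime_dvd_fact_iff)
    moreover have "\<not> p dvd fact n" "\<not> p dvd fact (2 * n - n)"
      using p by (auto simp: primes_between_def prime_dvd_fact_iff)
    ultimately show "prime p \<and> p dvd (2 * n choose n)"
      using pp by (metis prime_dvd_mult_iff)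
  qed simp
  then have "\<Prod>(primes_between n (2 * n)) \<le> (2 * n choose n)"
    by (rule dvd_imp_le) simp
  also have "\<dots> \<le> 2 ^ (2 * n)" by (rule binomial_le_pow2)
  also have "\<dots> = 4 ^ n" by (simp add: power_mult)
  finally show ?thesis .
qed

lemma card_primes_dyadic_le: "k * card (primes_between (2 ^ k) (2 ^ (k + 1))) \<le> 2 ^ (k + 1)"
proof -
  let ?P = "primes_between (2 ^ k) (2 ^ (k + 1))"
  have "(2::nat) ^ (k * card ?P) = (\<Prod>p\<in>?P. 2 ^ k)" by (simp add: power_mult)
  also have "\<dots> \<le> \<Prod>?P" by (intro prod_mono) (auto simp: primes_between_def)
  also have "\<dots> \<le> 4 ^ (2 ^ k)" using prod_primes_between_le[of "2 ^ k"] by simp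
  also have "(4::nat) ^ (2 ^ k) = 2 ^ (2 ^ (k + 1))"
    by (rule four_power_power)
  finally show ?thesis by (simp add: power_increasing_iff)
qed

text \<open>Induction over doublings, with Chebyshev's bound at each step. In this form the bound squares exactly when \<open>e\<close> grows by 1.\<close>

lemma primorial_le: "4 * \<Prod>(primes_upto (2 ^ e)) \<le> 2 ^ (2 ^ (e + 1))"
proof (induction e)
  case 0
  have "primes_upto 1 = {}" by (auto simp: primes_upto_def dest!: prime_ge_2_nat)
  then show ?case by simp
next
  case (Suc e)
  have eq: "primes_upto (2 ^ Suc e) = primes_upto (2 ^ e) \<union> primes_between (2 ^ e) (2 * 2 ^ e)"
    by (auto simp: primes_upto_def primes_between_def)
  have dis: "primes_upto (2 ^ e) \<inter> primes_between (2 ^ e) (2 * 2 ^ e) = {}"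
    by (auto simp: primes_upto_def primes_between_def)
  have "4 * \<Prod>(primes_upto (2 ^ Suc e))
      = (4 * \<Prod>(primes_upto (2 ^ e))) * \<Prod>(primes_between (2 ^ e) (2 * 2 ^ e))"
    unfolding eq by (subst prod.union_disjoint) (use dis in auto)
  also have "\<dots> \<le> 2 ^ (2 ^ (e + 1)) * 4 ^ (2 ^ e)"
    by (intro mult_mono Suc prod_primes_between_le) auto
  also have "(4::nat) ^ (2 ^ e) = 2 ^ (2 ^ (e + 1))"
    by (rule four_power_power)
  also have "(2::nat) ^ (2 ^ (e + 1)) * 2 ^ (2 ^ (e + 1)) = 2 ^ (2 ^ (Suc e + 1))"
    unfolding power_add[symmetric] by simp
  finally show ?case .
qed

lemma sum_UN_le:
  fixes f :: "'b \<Rightarrow> real"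
  assumes "finite I" "\<And>i. i \<in> I \<Longrightarrow> finite (A i)" "\<And>x. 0 \<le> f x"
  shows "sum f (\<Union>i\<in>I. A i) \<le> (\<Sum>i\<in>I. sum f (A i))"
  using assms(1,2)
proof (induction I rule: finite_induct)
  case (insert i I)
  have "sum f (A i \<union> (\<Union>i\<in>I. A i)) \<le> sum f (A i) + sum f (\<Union>i\<in>I. A i)"
    using insert assms(3) by (subst sum_Un) (auto intro!: sum_nonneg)
  with insert show ?case by simp
qed simp

text \<open>Blocks on the scale of \<open>log (log p)\<close>. Each carries a bounded amount of \<open>\<Sum>1 / p\<close>, and its product of \<open>1 - 1 / p\<close>
  is \<open>1 / 2\<close> up to a bounded factor.\<close>

definition prime_block :: "nat \<Rightarrow> nat set" where
  "prime_block b = primes_between (2 ^ 2 ^ b) (2 ^ 2 ^ (b + 1))"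

text \<open>Block \<open>b\<close> consists of \<open>2 ^ b\<close> dyadic ranges with exponents \<open>k \<ge> 2 ^ b\<close>. By Chebyshev's bound
  a range contributes at most \<open>2 / k \<le> 2 / 2 ^ b\<close>.\<close>

lemma prime_block_mass_le: "(\<Sum>p\<in>prime_block b. 1 / real p) \<le> 2"
proof -
  let ?D = "\<lambda>k. primes_between (2 ^ k) (2 ^ (k + 1))"
  have sub: "prime_block b \<subseteq> (\<Union>k\<in>{2 ^ b..<2 ^ (b + 1)}. ?D k)"
  proof
    fix p assume p: "p \<in> prime_block b"
    define k where "k = (LEAST k. p \<le> 2 ^ (k + 1))"
    have ex: "p \<le> 2 ^ (2 ^ (b + 1) - 1 + 1)" using p by (simp add: prime_block_def primes_between_def)
    have k1: "p \<le> 2 ^ (k + 1)" unfolding k_def by (rule LeastI, rule ex)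
    have k2: "k \<le> 2 ^ (b + 1) - 1" unfolding k_def by (rule Least_le, rule ex)
    have b1: "2 ^ 2 ^ b < p" using p by (simp add: prime_block_def primes_between_def)
    then have "(2::nat) ^ 2 ^ b < 2 ^ (k + 1)" using k1 by linarith
    then have "2 ^ b < k + 1" by (rule power_less_imp_less_exp[rotated]) simp
    then have k3: "2 ^ b \<le> k" by simp
    have "(0::nat) < 2 ^ b" by simp
    then have k0: "k > 0" using k3 by linarith
    have "\<not> p \<le> 2 ^ k"
    proof
      assume "p \<le> 2 ^ k"
      moreover have "k = (k - 1) + 1" using k0 by simp
      ultimately have "p \<le> 2 ^ ((k - 1) + 1)" by simp
      then have "k \<le> k - 1" unfolding k_def by (rule Least_le)
      then show False using k0 by simp
    qed
    then have "p \<in> ?D k" using k1 p by (simp add: prime_block_def primes_between_def)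
    moreover have "k < 2 ^ (b + 1)" using k2 by (metis One_nat_def Suc_pred less_Suc_eq_le pos2 zero_less_power)
    ultimately show "p \<in> (\<Union>k\<in>{2 ^ b..<2 ^ (b + 1)}. ?D k)" using k3 by auto
  qed
  have each: "(\<Sum>p\<in>?D k. 1 / real p) \<le> 2 / 2 ^ b" if k: "k \<ge> 2 ^ b" for k
  proof -
    have k0: "k > 0" using k by (metis gr0I not_less_iff_gr_or_eq le_zero_eq power_not_zero zero_neq_numeral)
    have "(\<Sum>p\<in>?D k. 1 / real p) \<le> (\<Sum>p\<in>?D k. 1 / 2 ^ k)"
    proof (intro sum_mono divide_left_mono)
      fix p assume "p \<in> ?D k"
      then have "2 ^ k < p" by (simp add: primes_between_def)
      then show "2 ^ k \<le> real p" by (metis less_imp_le of_nat_le_iff of_nat_numeral of_nat_power)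
      then show "0 < real p * 2 ^ k" by (smt (verit) zero_less_power mult_pos_pos)
    qed auto
    also have "\<dots> = real (card (?D k)) / 2 ^ k" by simp
    also have "real (card (?D k)) \<le> 2 ^ (k + 1) / real k"
    proof -
      have "real (k * card (?D k)) \<le> real (2 ^ (k + 1))"
        using card_primes_dyadic_le[of k] by (simp only: of_nat_le_iff)
      then show ?thesis using k0 by (simp add: field_simps)
    qed
    also have "2 ^ (k + 1) / real k / 2 ^ k = 2 / real k" by simp
    also have "\<dots> \<le> 2 / 2 ^ b"
    proof -
      have "real (2 ^ b) \<le> real k" using k by (simp only: of_nat_le_iff)
      then show ?thesis by (intro divide_left_mono) (use k0 in auto)
    qed
    finally show ?thesis by (simp add: divide_right_mono)
  qed
  have "(\<Sum>p\<in>prime_block b. 1 / real p) \<le> (\<Sum>p\<in>(\<Union>k\<in>{2 ^ b..<2 ^ (b + 1)}. ?D k). 1 / real p)"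
    using sub by (intro sum_mono2) auto
  also have "\<dots> \<le> (\<Sum>k\<in>{2 ^ b..<2 ^ (b + 1)}. \<Sum>p\<in>?D k. 1 / real p)"
    by (rule sum_UN_le) auto
  also have "\<dots> \<le> (\<Sum>k\<in>{(2::nat) ^ b..<2 ^ (b + 1)}. 2 / 2 ^ b)"
    using each by (intro sum_mono) auto
  also have "\<dots> = 2" by simp
  finally show ?thesis .
qed

section \<open>Sieving by residue classes\<close>

lemma coprime_prime_prod:
  assumes "finite P" "\<And>x. x \<in> P \<Longrightarrow> prime (x::nat)" "prime p" "p \<notin> P"
  shows "coprime (int p) (int (\<Prod>P))"
proof -
  have "coprime p (\<Prod>P)"
  proof (rule prod_coprime_right)
    fix i assume "i \<in> P"
    then show "coprime p i" using assms by (intro primes_coprime) auto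
  qed
  then show ?thesis by (simp only: coprime_int_iff)
qed

text \<open>For each new prime the most popular residue class among the survivors contains at least \<open>1 / p\<close> of them, and the Chinese
  remainder theorem moves \<open>n\<close> into this class without changing anything at the earlier primes.\<close>

lemma greedy_sieve:
  fixes S :: "int set" and P :: "nat set"
  assumes "finite P" "\<And>p. p \<in> P \<Longrightarrow> prime p" "finite S"
  shows "\<exists>n. real (card {s\<in>S. \<forall>p\<in>P. \<not> int p dvd n - s})
    \<le> real (card S) * (\<Prod>p\<in>P. 1 - 1 / real p)"
  using assms(1,2)
proof (induction P rule: finite_induct)
  case (insert p P)
  then obtain n0 where n0: "real (card {s\<in>S. \<forall>p\<in>P. \<not> int p dvd n0 - s})
    \<le> real (card S) * (\<Prod>p\<in>P. 1 - 1 / real p)" by auto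
  define R where "R = {s\<in>S. \<forall>p\<in>P. \<not> int p dvd n0 - s}"
  have finR: "finite R" using assms(3) by (simp add: R_def)
  have p: "prime p" "p > 0" using insert prime_gt_0_nat by auto
  define f where "f = (\<lambda>r. {s\<in>R. s mod int p = r})"
  have "card R = (\<Sum>r\<in>{0..<int p}. card (f r))"
  proof -
    have "R = (\<Union>r\<in>{0..<int p}. f r)" using p by (auto simp: f_def)
    also have "card \<dots> = (\<Sum>r\<in>{0..<int p}. card (f r))"
      by (rule card_UN_disjoint) (use finR in \<open>auto simp: f_def\<close>)
    finally show ?thesis .
  qed
  then have sum: "(\<Sum>r\<in>{0..<int p}. real (card (f r))) = real (card R)" by simp
  obtain r where r: "r \<in> {0..<int p}" "real (card R) / real p \<le> real (card (f r))"
  proof (rule ccontr)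
    assume "\<not> thesis"
    then have "\<forall>r\<in>{0..<int p}. real (card (f r)) < real (card R) / real p"
      using that by force
    then have "(\<Sum>r\<in>{0..<int p}. real (card (f r))) < (\<Sum>r\<in>{0..<int p}. real (card R) / real p)"
      using p by (intro sum_strict_mono) auto
    then show False using sum p by simp
  qed
  have "coprime (int p) (int (\<Prod>P))"
    using insert by (intro coprime_prime_prod) auto
  then obtain n where n: "[n = r] (mod int p)" "[n = n0] (mod int (\<Prod>P))"
    using binary_chinese_remainder_int by blast
  have same: "int x dvd n - s \<longleftrightarrow> int x dvd n0 - s" if "x \<in> P" for x s
  proof -
    have "int x dvd int (\<Prod>P)" 
      using dvd_prodI[OF insert(1) that, of "\<lambda>x. x"] by (simp only: int_dvd_int_iff)
    then have "int x dvd n - n0" using n(2) by (meson cong_iff_dvd_diff dvd_trans)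
    moreover have "n - s = (n - n0) + (n0 - s)" by simp
    ultimately show ?thesis by (metis dvd_add_right_iff)
  qed
  have hit: "int p dvd n - s" if "s \<in> f r" for s
  proof -
    have "[s = r] (mod int p)" using that r by (auto simp: f_def cong_def)
    then show ?thesis using n(1) by (meson cong_iff_dvd_diff cong_sym cong_trans)
  qed
  have "{s\<in>S. \<forall>x\<in>insert p P. \<not> int x dvd n - s} \<subseteq> R - f r"
    using same hit by (auto simp: R_def)
  then have "card {s\<in>S. \<forall>x\<in>insert p P. \<not> int x dvd n - s} \<le> card (R - f r)"
    using finR by (intro card_mono) auto
  also have "\<dots> = card R - card (f r)"
    using finR by (intro card_Diff_subset) (auto simp: f_def)
  finally have "real (card {s\<in>S. \<forall>x\<in>insert p P. \<not> int x dvd n - s})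
      \<le> real (card R) - real (card (f r))"
    using card_mono[OF finR, of "f r"] by (auto simp: f_def of_nat_diff)
  also have "\<dots> \<le> real (card R) * (1 - 1 / real p)"
    using r(2) by (simp add: algebra_simps)
  also have "\<dots> \<le> (real (card S) * (\<Prod>p\<in>P. 1 - 1 / real p)) * (1 - 1 / real p)"
    using n0 p unfolding R_def by (intro mult_right_mono) auto
  finally show ?case using insert by (intro exI[of _ n]) (simp add: mult_ac)
qed simp

text \<open>Since \<open>M\<close> is invertible modulo each \<open>p\<close>, each condition fixes \<open>t\<close> modulo \<open>p\<close>; by the Chinese remainder theorem
  together they fix \<open>t\<close> modulo the product.\<close>

lemma simultaneous_residue:
  fixes P :: "nat set" and M n :: int and u :: "nat \<Rightarrow> int"
  assumes "finite P" "\<And>p. p \<in> P \<Longrightarrow> prime p" "\<And>p. p \<in> P \<Longrightarrow> coprime M (int p)"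
  shows "\<exists>r. \<forall>t. (\<forall>p\<in>P. int p dvd n + M * t - u p) \<longleftrightarrow> int (\<Prod>P) dvd t - r"
  using assms
proof (induction P rule: finite_induct)
  case (insert p P)
  then obtain r where r: "\<And>t. (\<forall>p\<in>P. int p dvd n + M * t - u p) \<longleftrightarrow> int (\<Prod>P) dvd t - r" by auto
  have cop: "coprime M (int p)" using insert by auto
  obtain w where w: "[M * w = 1] (mod int p)" using cong_solve_coprime_int[OF cop] by blast
  define v where "v = w * (u p - n)"
  have v: "int p dvd n + M * t - u p \<longleftrightarrow> int p dvd t - v" for t
  proof -
    have "[M * v = u p - n] (mod int p)"
      unfolding v_def using cong_mult[OF w cong_refl[of "u p - n"]] by (simp add: mult_ac)
    then have d: "int p dvd M * v - (u p - n)" by (simp add: cong_iff_dvd_diff)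
    have "n + M * t - u p = M * (t - v) + (M * v - (u p - n))" by (simp add: algebra_simps)
    then have "int p dvd n + M * t - u p \<longleftrightarrow> int p dvd M * (t - v)"
      using d by (metis dvd_add_left_iff)
    also have "\<dots> \<longleftrightarrow> int p dvd t - v"
      using cop by (simp add: coprime_dvd_mult_right_iff coprime_commute)
    finally show ?thesis .
  qed
  have cp: "coprime (int p) (int (\<Prod>P))" using insert by (intro coprime_prime_prod) auto
  then obtain x where x: "[x = v] (mod int p)" "[x = r] (mod int (\<Prod>P))"
    using binary_chinese_remainder_int by blast
  have "(\<forall>q\<in>insert p P. int q dvd n + M * t - u q) \<longleftrightarrow> int (\<Prod>(insert p P)) dvd t - x" for t
  proof -
    have "(\<forall>q\<in>insert p P. int q dvd n + M * t - u q) \<longleftrightarrow> int p dvd t - v \<and> int (\<Prod>P) dvd t - r"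
      using r v by auto
    also have "int p dvd t - v \<longleftrightarrow> int p dvd t - x"
      using x(1) by (metis cong_iff_dvd_diff cong_sym cong_trans)
    also have "int (\<Prod>P) dvd t - r \<longleftrightarrow> int (\<Prod>P) dvd t - x"
      using x(2) by (metis cong_iff_dvd_diff cong_sym cong_trans)
    also have "int p dvd t - x \<and> int (\<Prod>P) dvd t - x \<longleftrightarrow> int p * int (\<Prod>P) dvd t - x"
      using cp by (meson divides_mult dvd_mult_left dvd_mult_right)
    finally show ?thesis using insert(1,2) by simp
  qed
  then show ?case by blast
qed simp

lemma card_residue_class:
  fixes d :: nat and r :: int
  assumes "d > 0"
  shows "\<bar>real (card {t\<in>{..<T::nat}. int d dvd int t - r}) - real T / real d\<bar> \<le> 1"
proof -
  define c where "c = nat (r mod int d)"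
  have c: "c < d" "int c = r mod int d" using assms by (auto simp: c_def nat_less_iff)
  have iff: "int d dvd int t - r \<longleftrightarrow> t mod d = c" for t
  proof -
    have "int d dvd int t - r \<longleftrightarrow> int t mod int d = r mod int d" by (simp add: mod_eq_dvd_iff)
    also have "\<dots> \<longleftrightarrow> int (t mod d) = int c" using c(2) by (simp add: zmod_int)
    finally show ?thesis by simp
  qed
  define k where "k = (T + d - 1 - c) div d"
  have "{t\<in>{..<T}. int d dvd int t - r} = (\<lambda>j. c + d * j) ` {..<k}"
  proof (intro equalityI subsetI)
    fix t assume "t \<in> {t\<in>{..<T}. int d dvd int t - r}"
    then have t: "t < T" "t mod d = c" using iff by auto
    have t2: "t = c + d * (t div d)" using t(2) by (metis mod_mult_div_eq)
    have "(t div d + 1) * d \<le> T + d - 1 - c"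
      using t2 t(1) by (simp add: algebra_simps)
    then have "t div d + 1 \<le> k" unfolding k_def using assms by (simp add: less_eq_div_iff_mult_less_eq)
    then show "t \<in> (\<lambda>j. c + d * j) ` {..<k}" using t2 by (intro image_eqI[of _ _ "t div d"]) auto
  next
    fix t assume "t \<in> (\<lambda>j. c + d * j) ` {..<k}"
    then obtain j where "j < k" and t: "t = c + d * j" by blast
    then have j: "j + 1 \<le> k" "t = c + d * j" by auto
    have "(j + 1) * d \<le> T + d - 1 - c"
      using j(1) unfolding k_def using assms by (simp add: less_eq_div_iff_mult_less_eq)
    then have "t < T" using j(2) c(1) assms by (simp add: algebra_simps)
    moreover have "t mod d = c" using j(2) c(1) by simp
    ultimately show "t \<in> {t\<in>{..<T}. int d dvd int t - r}" using iff by auto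
  qed
  then have card: "card {t\<in>{..<T}. int d dvd int t - r} = k"
    using assms by (simp add: card_image inj_on_def)
  have "d * k \<le> T + d - 1 - c" unfolding k_def by simp
  then have "d * k \<le> T + d" by linarith
  then have 1: "real d * real k \<le> real T + real d" by (metis of_nat_add of_nat_le_iff of_nat_mult)
  have "T + d - 1 - c < d * k + d"
    unfolding k_def using assms by (metis mult.commute add.commute dividend_less_div_times)
  then have "T \<le> d * k + d" using c(1) by linarith
  then have 2: "real T \<le> real d * real k + real d" by (metis of_nat_add of_nat_le_iff of_nat_mult)
  show ?thesis unfolding card using 1 2 assms by (simp add: abs_le_iff field_simps)
qed

lemma card_simultaneous_residue:
  fixes P :: "nat set" and M n :: int and u :: "nat \<Rightarrow> int"
  assumes "finite P" "\<And>p. p \<in> P \<Longrightarrow> prime p" "\<And>p. p \<in> P \<Longrightarrow> coprime M (int p)"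
  shows "\<bar>real (card {t\<in>{..<T::nat}. \<forall>p\<in>P. int p dvd n + M * int t - u p})
      - real T * (\<Prod>p\<in>P. 1 / real p)\<bar> \<le> 1"
proof -
  obtain r where r: "\<And>t. (\<forall>p\<in>P. int p dvd n + M * t - u p) \<longleftrightarrow> int (\<Prod>P) dvd t - r"
    using simultaneous_residue[OF assms, of n u] by blast
  have "\<Prod>P > 0" using assms(2) prime_gt_0_nat by (intro prod_pos) auto
  moreover have "(\<Prod>p\<in>P. 1 / real p) = 1 / real (\<Prod>P)"
    by (simp add: prod_dividef)
  ultimately show ?thesis using card_residue_class[of "\<Prod>P" T r] unfolding r by simp
qed

section \<open>From independent hits to integers\<close>

text \<open>\<open>coeff_bound U F W\<close> says that \<open>F\<close> is a polynomial in the indicator variables of the elements of \<open>U\<close> that can be written with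
  coefficients of absolute sum at most \<open>W\<close>. The monomials are the indicators of \<open>D \<subseteq> x\<close>. An inductive predicate is
  used because a bound for some representation is all that is needed, and it turns \<open>transfer_to_integers\<close> into a plain induction.\<close>

inductive coeff_bound :: "'a set \<Rightarrow> ('a set \<Rightarrow> real) \<Rightarrow> real \<Rightarrow> bool" for U where
  monomial: "finite D \<Longrightarrow> D \<subseteq> U \<Longrightarrow> coeff_bound U (\<lambda>x. c * of_bool (D \<subseteq> x)) \<bar>c\<bar>"
| add: "coeff_bound U F V \<Longrightarrow> coeff_bound U G W \<Longrightarrow> coeff_bound U (\<lambda>x. F x + G x) (V + W)"
| weaken: "coeff_bound U F V \<Longrightarrow> V \<le> W \<Longrightarrow> coeff_bound U F W"

lemma coeff_bound_nonneg: "coeff_bound U F W \<Longrightarrow> 0 \<le> W"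
  by (induction rule: coeff_bound.induct) auto

lemma coeff_bound_const: "coeff_bound U (\<lambda>_. c) \<bar>c\<bar>"
  using coeff_bound.monomial[of "{}" U c] by simp

text \<open>The indicator variables are idempotent, so the product of two monomials is the monomial of the union.\<close>

lemma coeff_bound_mult_monomial:
  assumes "coeff_bound U F W" "finite D" "D \<subseteq> U"
  shows "coeff_bound U (\<lambda>x. F x * (c * of_bool (D \<subseteq> x))) (W * \<bar>c\<bar>)"
  using assms(1)
proof (induction rule: coeff_bound.induct)
  case (monomial D' c')
  have "coeff_bound U (\<lambda>x. (c' * c) * of_bool (D' \<union> D \<subseteq> x)) \<bar>c' * c\<bar>"
    using monomial assms by (intro coeff_bound.monomial) auto
  moreover have "(\<lambda>x. (c' * c) * of_bool (D' \<union> D \<subseteq> x))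
      = (\<lambda>x. c' * of_bool (D' \<subseteq> x) * (c * of_bool (D \<subseteq> x)))"
    by (auto simp: fun_eq_iff)
  ultimately show ?case by (simp add: abs_mult)
next
  case (add F V G W)
  then show ?case
    using coeff_bound.add[OF add.IH] by (simp add: algebra_simps)
next
  case (weaken F V W)
  then show ?case by (meson abs_ge_zero coeff_bound.weaken mult_right_mono)
qed

lemma coeff_bound_mult:
  assumes "coeff_bound U F V" "coeff_bound U G W"
  shows "coeff_bound U (\<lambda>x. F x * G x) (V * W)"
  using assms(2)
proof (induction rule: coeff_bound.induct)
  case (monomial D c)
  then show ?case using coeff_bound_mult_monomial[OF assms(1)] by blast
next
  case (add F V G W)
  then show ?case
    using coeff_bound.add[OF add.IH] by (simp add: algebra_simps)
next
  case (weaken F V' W)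
  then show ?case
    using coeff_bound_nonneg[OF assms(1)] by (meson coeff_bound.weaken mult_left_mono)
qed

lemma coeff_bound_cmult:
  "coeff_bound U F W \<Longrightarrow> coeff_bound U (\<lambda>x. c * F x) (\<bar>c\<bar> * W)"
  by (rule coeff_bound_mult[OF coeff_bound_const])

lemma coeff_bound_sum:
  assumes "finite I" "\<And>i. i \<in> I \<Longrightarrow> coeff_bound U (F i) (W i)"
  shows "coeff_bound U (\<lambda>x. \<Sum>i\<in>I. F i x) (\<Sum>i\<in>I. W i)"
  using assms
proof (induction I rule: finite_induct)
  case empty
  then show ?case using coeff_bound_const[of U 0] by simp
next
  case (insert i I)
  then show ?case by (simp add: coeff_bound.add)
qed

lemma coeff_bound_prod:
  assumes "finite I" "\<And>i. i \<in> I \<Longrightarrow> coeff_bound U (F i) (W i)"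
  shows "coeff_bound U (\<lambda>x. \<Prod>i\<in>I. F i x) (\<Prod>i\<in>I. W i)"
  using assms
proof (induction I rule: finite_induct)
  case empty
  then show ?case using coeff_bound_const[of U 1] by simp
next
  case (insert i I)
  then show ?case by (simp add: coeff_bound_mult)
qed

lemma coeff_bound_diff:
  assumes "coeff_bound U F V" "coeff_bound U G W"
  shows "coeff_bound U (\<lambda>x. F x - G x) (V + W)"
  using coeff_bound.add[OF assms(1) coeff_bound_cmult[OF assms(2), of "-1"]] by simp

text \<open>A binomial coefficient of the number of hits counts the \<open>t\<close>-element sets of hits, hence is a sum of monomials.\<close>

lemma coeff_bound_choose_card:
  assumes "finite K" "K \<subseteq> U"
  shows "coeff_bound U (\<lambda>x. real (card (x \<inter> K) choose t)) (real (card K choose t))"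
proof -
  let ?I = "{D. D \<subseteq> K \<and> card D = t}"
  have fin: "finite ?I" using assms by simp
  have "coeff_bound U (\<lambda>x. \<Sum>D\<in>?I. 1 * of_bool (D \<subseteq> x)) (\<Sum>D\<in>?I. \<bar>1\<bar>)"
    using assms fin by (intro coeff_bound_sum coeff_bound.monomial) (auto intro: finite_subset)
  moreover have "(\<Sum>D\<in>?I. 1 * of_bool (D \<subseteq> x)) = real (card (x \<inter> K) choose t)" for x
  proof -
    have "(\<Sum>D\<in>?I. 1 * of_bool (D \<subseteq> x)) = real (card {D\<in>?I. D \<subseteq> x})"
      using fin by (simp add: sum.If_cases of_bool_def Int_def)
    also have "{D\<in>?I. D \<subseteq> x} = {D. D \<subseteq> x \<inter> K \<and> card D = t}" by auto
    also have "card \<dots> = card (x \<inter> K) choose t" using assms by (intro n_subsets) auto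
    finally show ?thesis .
  qed
  moreover have "(\<Sum>D\<in>?I. \<bar>1::real\<bar>) = real (card K choose t)"
    using n_subsets[OF assms(1), of t] by simp
  ultimately show ?thesis by simp
qed

lemma choose_le_power_mult: "n choose t \<le> n ^ t * (r choose t)" if "t \<le> r"
proof -
  have "n choose t \<le> n ^ t * 1"
    using binomial_le_pow[of t n] by (cases "t \<le> n") (auto simp: binomial_eq_0)
  also have "\<dots> \<le> n ^ t * (r choose t)"
    using that by (intro mult_left_mono) (auto simp: Suc_leI)
  finally show ?thesis .
qed

lemma coeff_bound_brun_weight:
  assumes "finite K" "K \<subseteq> U"
  shows "coeff_bound U (\<lambda>x. brun_weight r (card (x \<inter> K))) ((1 + real (card K)) ^ r)"
proof -
  have "coeff_bound U (\<lambda>x. \<Sum>t\<le>r. (-1) ^ t * real (card (x \<inter> K) choose t))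
      (\<Sum>t\<le>r. \<bar>(-1) ^ t\<bar> * real (card K choose t))"
    using assms by (intro coeff_bound_sum coeff_bound_cmult coeff_bound_choose_card) auto
  moreover have "(\<Sum>t\<le>r. \<bar>(-1) ^ t\<bar> * real (card K choose t)) \<le> (1 + real (card K)) ^ r"
  proof -
    have "(1 + real (card K)) ^ r = (\<Sum>t\<le>r. real (r choose t) * 1 ^ t * real (card K) ^ (r - t))"
      by (subst binomial_ring) simp
    also have "\<dots> = (\<Sum>t\<le>r. real (r choose t) * real (card K) ^ t)"
      by (rule sum.reindex_bij_witness[of _ "\<lambda>t. r - t" "\<lambda>t. r - t"])
         (auto simp: binomial_symmetric[symmetric])
    finally have eq: "(1 + real (card K)) ^ r = (\<Sum>t\<le>r. real (r choose t) * real (card K) ^ t)" .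
    have "real (card K choose t) \<le> real (r choose t) * real (card K) ^ t" if "t \<le> r" for t
    proof -
      have "card K choose t \<le> (r choose t) * card K ^ t"
        using choose_le_power_mult[OF that, of "card K"] by (simp add: mult.commute)
      then show ?thesis by (metis of_nat_le_iff of_nat_mult of_nat_power)
    qed
    then show ?thesis unfolding eq by (intro sum_mono) (auto simp: power_abs)
  qed
  ultimately show ?thesis unfolding brun_weight_def by (rule coeff_bound.weaken)
qed

lemma bern_exp_at_most_one:
  assumes "finite K" "\<And>a. a \<in> K \<Longrightarrow> q a = c"
  shows "bern_exp q K (\<lambda>z. of_bool (card z \<le> 1) * g z)
    = (1 - c) ^ card K * g {} + (\<Sum>a\<in>K. c * (1 - c) ^ (card K - 1) * g {a})"
proof -
  let ?w = "\<lambda>z. (\<Prod>a\<in>z. q a) * (\<Prod>a\<in>K - z. 1 - q a)"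
  have "bern_exp q K (\<lambda>z. of_bool (card z \<le> 1) * g z)
      = (\<Sum>z\<in>insert {} ((\<lambda>a. {a}) ` K). ?w z * (of_bool (card z \<le> 1) * g z))"
    unfolding bern_exp_def
  proof (rule sum.mono_neutral_right)
    show "\<forall>z\<in>Pow K - insert {} ((\<lambda>a. {a}) ` K). ?w z * (of_bool (card z \<le> 1) * g z) = 0"
    proof
      fix z assume z: "z \<in> Pow K - insert {} ((\<lambda>a. {a}) ` K)"
      then have "finite z" using assms finite_subset by auto
      moreover have "card z \<noteq> 1" using z by (auto simp: card_1_singleton_iff)
      moreover have "card z \<noteq> 0" using z \<open>finite z\<close> by auto
      ultimately have "\<not> card z \<le> 1" by linarith
      then show "?w z * (of_bool (card z \<le> 1) * g z) = 0" by simp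
    qed
  qed (use assms in auto)
  also have "\<dots> = ?w {} * g {} + (\<Sum>a\<in>K. ?w {a} * g {a})"
    using assms by (subst sum.insert) (auto simp: sum.reindex)
  also have "?w {} = (1 - c) ^ card K" using assms by simp
  also have "(\<Sum>a\<in>K. ?w {a} * g {a}) = (\<Sum>a\<in>K. c * (1 - c) ^ (card K - 1) * g {a})"
  proof (intro sum.cong refl)
    fix a assume a: "a \<in> K"
    have "(\<Prod>b\<in>K - {a}. 1 - q b) = (\<Prod>b\<in>K - {a}. 1 - c)" using assms by (intro prod.cong) auto
    then show "?w {a} * g {a} = c * (1 - c) ^ (card K - 1) * g {a}"
      using a assms by (simp add: card_Diff_singleton)
  qed
  finally show ?thesis .
qed

text \<open>A hit is recorded as the pair of the prime and the shift, so that the hits of one prime form the cell \<open>{p} \<times> S\<close> and the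
  hits of one shift the cell \<open>P \<times> {s}\<close>.\<close>

definition hits :: "nat set \<Rightarrow> int set \<Rightarrow> int \<Rightarrow> (nat \<times> int) set" where
  "hits P S n = {(p, s). p \<in> P \<and> s \<in> S \<and> int p dvd n - s}"

text \<open>With \<open>J = card S\<close>, the odds \<open>q / (1 - q)\<close> for this \<open>q\<close> are \<open>1 / (p - J)\<close>. So, conditioned on at most one hit, \<open>p\<close>
  hits any given shift with probability \<open>(1 / (p - J)) / (1 + J / (p - J)) = 1 / p\<close>, as a random residue does.\<close>

definition hit_prob :: "int set \<Rightarrow> nat \<times> int \<Rightarrow> real" where
  "hit_prob S a = 1 / (real (fst a) - real (card S) + 1)"

definition single_hits :: "nat set \<Rightarrow> int set \<Rightarrow> (nat \<times> int) set \<Rightarrow> bool" where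
  "single_hits P S x \<longleftrightarrow> (\<forall>p\<in>P. card (x \<inter> {p} \<times> S) \<le> 1)"

definition single_prob :: "nat set \<Rightarrow> int set \<Rightarrow> real" where
  "single_prob P S = bern_exp (hit_prob S) (P \<times> S) (\<lambda>x. of_bool (single_hits P S x))"

text \<open>Conditioned on \<open>single_hits\<close>, the probability that all pairs in \<open>D\<close> are hits is the one for uniformly random residues.
  Both sides factor over the primes; for a single prime only the outcomes with at most one hit contribute, and the choice of
  \<open>hit_prob\<close> gives the factor \<open>1 / p\<close>.\<close>

lemma single_hits_monomial:
  assumes fin: "finite P" "finite S" "S \<noteq> {}" and large: "\<And>p. p \<in> P \<Longrightarrow> p > card S"
    and D: "D \<subseteq> P \<times> S"
  shows "bern_exp (hit_prob S) (P \<times> S) (\<lambda>x. of_bool (single_hits P S x) * of_bool (D \<subseteq> x))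
    = single_prob P S * (if single_hits P S D then \<Prod>p\<in>fst ` D. 1 / real p else 0)"
proof -
  define J where "J = card S"
  have J: "J \<ge> 1" using fin by (simp add: J_def Suc_leI card_gt_0_iff)
  define c where "c = (\<lambda>p. 1 / (real p - real J + 1))"
  define w where "w = (\<lambda>p. (1 - c p) ^ J + real J * (c p * (1 - c p) ^ (J - 1)))"
  let ?K = "\<lambda>p. {p} \<times> S"
  have U: "P \<times> S = (\<Union>p\<in>P. ?K p)" by auto
  have fam: "disjoint_family_on ?K P" by (auto simp: disjoint_family_on_def)
  have finD: "finite D" using fin D finite_subset by blast
  have factor: "bern_exp (hit_prob S) (?K p) (\<lambda>z. of_bool (card z \<le> 1) * of_bool (E \<inter> ?K p \<subseteq> z))
     = w p * (if card (E \<inter> ?K p) = 0 then 1 else if card (E \<inter> ?K p) = 1 then 1 / real p else 0)"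
    if p: "p \<in> P" and E: "E \<subseteq> P \<times> S" for p E
  proof -
    have cardK: "card (?K p) = J" by (simp add: J_def card_cartesian_product)
    have finE: "finite (E \<inter> ?K p)" using fin by auto
    have "bern_exp (hit_prob S) (?K p) (\<lambda>z. of_bool (card z \<le> 1) * of_bool (E \<inter> ?K p \<subseteq> z))
        = (1 - c p) ^ J * of_bool (E \<inter> ?K p \<subseteq> {})
          + (\<Sum>a\<in>?K p. c p * (1 - c p) ^ (J - 1) * of_bool (E \<inter> ?K p \<subseteq> {a}))"
      using fin bern_exp_at_most_one[of "?K p" "hit_prob S" "c p" "\<lambda>z. of_bool (E \<inter> ?K p \<subseteq> z)"]
      unfolding cardK by (auto simp: hit_prob_def c_def J_def)
    also have "\<dots> = w p * (if card (E \<inter> ?K p) = 0 then 1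
        else if card (E \<inter> ?K p) = 1 then 1 / real p else 0)"
    proof -
      consider "E \<inter> ?K p = {}" | a where "E \<inter> ?K p = {a}" | "card (E \<inter> ?K p) \<noteq> 0" "card (E \<inter> ?K p) \<noteq> 1"
        using finE by (metis card_0_eq card_1_singletonE)
      then show ?thesis
      proof cases
        case 1
        then show ?thesis unfolding 1 using cardK by (simp add: w_def)
      next
        case (2 a)
        have a: "a \<in> ?K p" using 2 by auto
        have "(\<Sum>b\<in>?K p. c p * (1 - c p) ^ (J - 1) * of_bool ({a} \<subseteq> {b}))
            = (\<Sum>b\<in>?K p. if b = a then c p * (1 - c p) ^ (J - 1) else 0)"
          by (intro sum.cong) auto
        also have "\<dots> = c p * (1 - c p) ^ (J - 1)" using a fin by (subst sum.delta) auto
        finally have s: "(\<Sum>b\<in>?K p. c p * (1 - c p) ^ (J - 1) * of_bool ({a} \<subseteq> {b}))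
          = c p * (1 - c p) ^ (J - 1)" .
        have pJ: "real p > real J" using large[OF p] by (simp add: J_def)
        have "(1 - c p) ^ J = (1 - c p) * (1 - c p) ^ (J - 1)"
          using J by (metis Suc_diff_1 One_nat_def less_le_trans power_Suc zero_less_one)
        then have "w p = (1 - c p) ^ (J - 1) * (1 - c p + real J * c p)"
          by (simp add: w_def algebra_simps)
        also have "1 - c p + real J * c p = real p * c p"
        proof -
          have "c p * (real p - real J + 1) = 1" using pJ by (simp add: c_def)
          then show ?thesis by (simp add: algebra_simps)
        qed
        finally have "w p / real p = c p * (1 - c p) ^ (J - 1)"
          using pJ by (simp add: field_simps)
        then show ?thesis unfolding 2 s by simp
      next
        case 3
        have "\<not> E \<inter> ?K p \<subseteq> {}" using 3 by auto
        moreover have "\<not> E \<inter> ?K p \<subseteq> {a}" for a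
          using 3 by (metis card.empty card.insert card.infinite finite.emptyI insert_absorb
              is_singletonI is_singleton_altdef subset_singleton_iff)
        ultimately show ?thesis using 3 by simp
      qed
    qed
    finally show ?thesis .
  qed
  have split: "of_bool (single_hits P S x) * of_bool (E \<subseteq> x)
     = (\<Prod>p\<in>P. (\<lambda>z. of_bool (card z \<le> 1) * of_bool (E \<inter> ?K p \<subseteq> z)) (x \<inter> ?K p) :: real)"
    if E: "E \<subseteq> P \<times> S" for x E
  proof -
    have "E \<subseteq> x \<longleftrightarrow> (\<forall>p\<in>P. E \<inter> ?K p \<subseteq> x \<inter> ?K p)" using E by blast
    then have "single_hits P S x \<and> E \<subseteq> x
      \<longleftrightarrow> (\<forall>p\<in>P. card (x \<inter> ?K p) \<le> 1 \<and> E \<inter> ?K p \<subseteq> x \<inter> ?K p)"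
      unfolding single_hits_def by blast
    moreover have "(\<Prod>p\<in>P. of_bool (B p)) = (of_bool (\<forall>p\<in>P. B p) :: real)" for B
      using fin(1) by (induction P rule: finite_induct) auto
    ultimately show ?thesis by (simp flip: of_bool_conj)
  qed
  have main: "bern_exp (hit_prob S) (P \<times> S) (\<lambda>x. of_bool (single_hits P S x) * of_bool (E \<subseteq> x))
     = (\<Prod>p\<in>P. w p * (if card (E \<inter> ?K p) = 0 then 1 else if card (E \<inter> ?K p) = 1 then 1 / real p else 0))"
    if E: "E \<subseteq> P \<times> S" for E
    unfolding split[OF E] unfolding U using fin fam factor[OF _ E]
    by (subst bern_exp_prod[where f = "\<lambda>p z. of_bool (card z \<le> 1) * of_bool (E \<inter> ?K p \<subseteq> z)"])
       (auto intro!: prod.cong)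
  have kappa: "single_prob P S = (\<Prod>p\<in>P. w p)"
    using main[of "{}"] by (simp add: single_prob_def)
  have "(\<Prod>p\<in>P. if card (D \<inter> ?K p) = 0 then 1 else if card (D \<inter> ?K p) = 1 then 1 / real p else 0)
      = (if single_hits P S D then \<Prod>p\<in>fst ` D. 1 / real p else 0)"
  proof (cases "single_hits P S D")
    case True
    have "(\<Prod>p\<in>P. if card (D \<inter> ?K p) = 0 then 1 else if card (D \<inter> ?K p) = 1 then 1 / real p else 0)
        = (\<Prod>p\<in>P. if p \<in> fst ` D then 1 / real p else 1)"
    proof (intro prod.cong refl)
      fix p assume p: "p \<in> P"
      have "finite (D \<inter> ?K p)" using finD by simp
      moreover have "p \<in> fst ` D \<longleftrightarrow> D \<inter> ?K p \<noteq> {}" using D by force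
      moreover have "card (D \<inter> ?K p) \<le> 1" using True p by (simp add: single_hits_def)
      ultimately show "(if card (D \<inter> ?K p) = 0 then 1 else if card (D \<inter> ?K p) = 1 then 1 / real p else 0)
        = (if p \<in> fst ` D then 1 / real p else 1)" by (auto simp: le_Suc_eq)
    qed
    also have "\<dots> = (\<Prod>p\<in>fst ` D. 1 / real p)"
    proof -
      have "fst ` D \<subseteq> P" using D by auto
      then show ?thesis using fin(1)
        by (subst prod.inter_restrict[symmetric]) (auto simp: Int_absorb1)
    qed
    finally show ?thesis using True by simp
  next
    case False
    then obtain p where "p \<in> P" "\<not> card (D \<inter> ?K p) \<le> 1" by (auto simp: single_hits_def)
    then show ?thesis using False fin(1) by (auto intro!: prod_zero bexI[of _ p])
  qed
  then show ?thesis using main[OF D] kappa by (simp add: prod.distrib)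
qed

text \<open>If \<open>D\<close> prescribes one shift for each of its primes, the \<open>t\<close> with these hits form a residue class. If \<open>D\<close>
  prescribes two shifts for one prime there is no such \<open>t\<close>, as \<open>p\<close> does not divide their difference.\<close>

lemma hits_count:
  fixes M n :: int
  assumes fin: "finite P" "finite S" and prime: "\<And>p. p \<in> P \<Longrightarrow> prime p"
    and cop: "\<And>p. p \<in> P \<Longrightarrow> coprime M (int p)"
    and distinct: "\<And>p s s'. p \<in> P \<Longrightarrow> s \<in> S \<Longrightarrow> s' \<in> S \<Longrightarrow> s \<noteq> s' \<Longrightarrow> \<not> int p dvd s - s'"
    and D: "D \<subseteq> P \<times> S"
  shows "\<bar>(\<Sum>t<T. of_bool (D \<subseteq> hits P S (n + M * int t)))
     - real T * (if single_hits P S D then \<Prod>p\<in>fst ` D. 1 / real p else 0)\<bar> \<le> 1"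
proof -
  have finD: "finite D" using fin D finite_subset by blast
  have count: "(\<Sum>t<T. of_bool (D \<subseteq> hits P S (n + M * int t)))
      = real (card {t\<in>{..<T}. D \<subseteq> hits P S (n + M * int t)})"
    by (simp add: sum.If_cases of_bool_def Int_def)
  show ?thesis
  proof (cases "single_hits P S D")
    case True
    have uniq: "s = s'" if "(p, s) \<in> D" "(p, s') \<in> D" for p s s'
    proof (rule ccontr)
      assume "s \<noteq> s'"
      have "{(p, s), (p, s')} \<subseteq> D \<inter> {p} \<times> S" using that D by auto
      then have "card {(p, s), (p, s')} \<le> card (D \<inter> {p} \<times> S)" using finD by (intro card_mono) auto
      also have "\<dots> \<le> 1" using True that D by (auto simp: single_hits_def)
      finally show False using \<open>s \<noteq> s'\<close> by simp
    qed
    define u where "u = (\<lambda>p. THE s. (p, s) \<in> D)"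
    have u: "u p = s" if "(p, s) \<in> D" for p s
      unfolding u_def using that uniq by (intro the_equality) auto
    have "D \<subseteq> hits P S m \<longleftrightarrow> (\<forall>p\<in>fst ` D. int p dvd m - u p)" for m
      using D u by (force simp: hits_def)
    then have "{t\<in>{..<T}. D \<subseteq> hits P S (n + M * int t)}
        = {t\<in>{..<T}. \<forall>p\<in>fst ` D. int p dvd n + M * int t - u p}" by simp
    moreover have "\<bar>real (card {t\<in>{..<T}. \<forall>p\<in>fst ` D. int p dvd n + M * int t - u p})
        - real T * (\<Prod>p\<in>fst ` D. 1 / real p)\<bar> \<le> 1"
      using finD D prime cop by (intro card_simultaneous_residue) auto
    ultimately show ?thesis unfolding count using True by simp
  next
    case False
    then obtain p where p: "p \<in> P" "\<not> card (D \<inter> {p} \<times> S) \<le> 1" by (auto simp: single_hits_def)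
    then obtain a b where ab: "a \<in> D \<inter> {p} \<times> S" "b \<in> D \<inter> {p} \<times> S" "a \<noteq> b"
      by (metis card_le_Suc0_iff_eq finD finite_Int One_nat_def)
    have "\<not> D \<subseteq> hits P S m" for m
    proof
      assume "D \<subseteq> hits P S m"
      then have "int p dvd m - snd a" "int p dvd m - snd b" using ab by (auto simp: hits_def)
      then have "int p dvd (m - snd b) - (m - snd a)" by (rule dvd_diff[rotated])
      then have "int p dvd snd a - snd b" by simp
      moreover have "snd a \<noteq> snd b" "snd a \<in> S" "snd b \<in> S" using ab by auto
      ultimately show False using distinct p(1) by blast
    qed
    then show ?thesis using False by simp
  qed
qed

text \<open>The compared difference is linear in \<open>F\<close>, and for a monomial with coefficient 1 the preceding two lemmas bound it by 1.\<close>

lemma transfer_to_integers: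
  fixes M n :: int
  assumes fin: "finite P" "finite S" "S \<noteq> {}" and prime: "\<And>p. p \<in> P \<Longrightarrow> prime p"
    and large: "\<And>p. p \<in> P \<Longrightarrow> p > card S"
    and cop: "\<And>p. p \<in> P \<Longrightarrow> coprime M (int p)"
    and distinct: "\<And>p s s'. p \<in> P \<Longrightarrow> s \<in> S \<Longrightarrow> s' \<in> S \<Longrightarrow> s \<noteq> s' \<Longrightarrow> \<not> int p dvd s - s'"
    and F: "coeff_bound (P \<times> S) F W"
  shows "\<bar>single_prob P S * (\<Sum>t<T. F (hits P S (n + M * int t)))
     - real T * bern_exp (hit_prob S) (P \<times> S) (\<lambda>x. of_bool (single_hits P S x) * F x)\<bar> \<le> W"
proof -
  let ?U = "P \<times> S" and ?q = "hit_prob S"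
  have q: "0 \<le> ?q a \<and> ?q a \<le> 1" if "a \<in> ?U" for a
  proof -
    have "real (card S) < real (fst a)" using large[of "fst a"] that by auto
    then show ?thesis by (simp add: hit_prob_def)
  qed
  have k0: "0 \<le> single_prob P S"
    unfolding single_prob_def using bern_exp_mono[of ?U ?q "\<lambda>_. 0"] q fin by auto
  have "single_prob P S \<le> bern_exp ?q ?U (\<lambda>_. 1)"
    unfolding single_prob_def using q by (intro bern_exp_mono) auto
  then have k1: "single_prob P S \<le> 1" using fin by simp
  define L where "L = (\<lambda>F. single_prob P S * (\<Sum>t<T. F (hits P S (n + M * int t)))
     - real T * bern_exp ?q ?U (\<lambda>x. of_bool (single_hits P S x) * F x))"
  have L_add: "L (\<lambda>x. F x + G x) = L F + L G" for F G
    by (simp add: L_def sum.distrib ring_distribs bern_exp_add)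
  have L_cmult: "L (\<lambda>x. c * F x) = c * L F" for c F
    by (simp add: L_def sum_distrib_left[symmetric] bern_exp_cmult[symmetric] mult_ac)
       (simp add: bern_exp_cmult algebra_simps)
  from F have "\<bar>L F\<bar> \<le> W"
  proof (induction rule: coeff_bound.induct)
    case (monomial D c)
    define pD where "pD = (if single_hits P S D then \<Prod>p\<in>fst ` D. 1 / real p else 0)"
    have eq: "bern_exp ?q ?U (\<lambda>x. of_bool (single_hits P S x) * of_bool (D \<subseteq> x))
        = single_prob P S * pD"
      unfolding pD_def by (rule single_hits_monomial[OF fin large monomial(2)])
    have "L (\<lambda>x. of_bool (D \<subseteq> x)) = single_prob P S *
        ((\<Sum>t<T. of_bool (D \<subseteq> hits P S (n + M * int t))) - real T * pD)"
      by (simp only: L_def eq) (simp add: algebra_simps)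
    moreover have "\<bar>(\<Sum>t<T. of_bool (D \<subseteq> hits P S (n + M * int t))) - real T * pD\<bar> \<le> 1"
      unfolding pD_def by (rule hits_count[OF fin(1,2) prime cop distinct monomial(2)])
    ultimately have "\<bar>L (\<lambda>x. of_bool (D \<subseteq> x))\<bar> \<le> 1 * 1"
      using k0 k1 unfolding abs_mult by (simp only: abs_mult) (intro mult_mono; simp)
    then have "\<bar>c\<bar> * \<bar>L (\<lambda>x. of_bool (D \<subseteq> x))\<bar> \<le> \<bar>c\<bar> * 1" by (intro mult_left_mono) auto
    then show ?case unfolding L_cmult abs_mult by simp
  next
    case (add F V G W)
    then show ?case unfolding L_add by linarith
  qed auto
  then show ?thesis by (simp add: L_def)
qed

section \<open>Truncated products of orthogonal weights\<close>

lemma exp_minus_one_le: "exp x - 1 \<le> 2 * x" if "0 \<le> x" "x \<le> 1" for x :: real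
proof -
  have "exp x \<le> 1 + x + x\<^sup>2" using that by (rule exp_bound)
  moreover have "x * x \<le> x * 1" using that by (intro mult_left_mono) auto
  ultimately show ?thesis by (simp add: power2_eq_square)
qed

lemma square_sum_le: "(\<Sum>i\<in>I. f i)\<^sup>2 \<le> real (card I) * (\<Sum>i\<in>I. (f i)\<^sup>2)" for f :: "'i \<Rightarrow> real"
proof -
  have "0 \<le> (\<Sum>i\<in>I. \<Sum>j\<in>I. (f i - f j)\<^sup>2)" by (intro sum_nonneg) auto
  also have "\<dots> = (\<Sum>i\<in>I. \<Sum>j\<in>I. (f i)\<^sup>2 + (f j)\<^sup>2 - 2 * (f i * f j))"
    by (intro sum.cong refl) (simp add: power2_eq_square algebra_simps)
  also have "\<dots> = 2 * (real (card I) * (\<Sum>i\<in>I. (f i)\<^sup>2)) - 2 * (\<Sum>i\<in>I. \<Sum>j\<in>I. f i * f j)"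
    by (simp add: sum.distrib sum_subtractf sum_distrib_left)
  also have "(\<Sum>i\<in>I. \<Sum>j\<in>I. f i * f j) = (\<Sum>i\<in>I. f i)\<^sup>2"
    by (simp add: power2_eq_square sum_product)
  finally show ?thesis by simp
qed

text \<open>Independent cells \<open>K s\<close>, each with the same family of weights \<open>\<psi> s i\<close> that are centred and orthogonal, and take the values
  \<open>- e i\<close>, of sum \<open>-1\<close>, when the cell is empty. The number \<open>c i\<close> is the cost of using \<open>\<psi> s i\<close>.\<close>

locale tensor_weights =
  fixes S :: "'s set" and K :: "'s \<Rightarrow> 'a set" and q :: "'a \<Rightarrow> real"
    and I :: "'i set" and \<psi> :: "'s \<Rightarrow> 'i \<Rightarrow> 'a set \<Rightarrow> real"
    and e :: "'i \<Rightarrow> real" and c :: "'i \<Rightarrow> real"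
  assumes fin: "finite S" "finite I" "\<And>s. s \<in> S \<Longrightarrow> finite (K s)"
    and disj: "disjoint_family_on K S"
    and prob: "\<And>s a. s \<in> S \<Longrightarrow> a \<in> K s \<Longrightarrow> 0 \<le> q a \<and> q a \<le> 1"
    and mean: "\<And>s i. s \<in> S \<Longrightarrow> i \<in> I \<Longrightarrow> bern_exp q (K s) (\<psi> s i) = 0"
    and orth: "\<And>s i l. s \<in> S \<Longrightarrow> i \<in> I \<Longrightarrow> l \<in> I \<Longrightarrow> i \<noteq> l \<Longrightarrow>
      bern_exp q (K s) (\<lambda>x. \<psi> s i x * \<psi> s l x) = 0"
    and atom: "\<And>s i. s \<in> S \<Longrightarrow> i \<in> I \<Longrightarrow> \<psi> s i {} = - e i"
    and e_nonneg: "\<And>i. i \<in> I \<Longrightarrow> 0 \<le> e i" and e_sum: "sum e I = 1"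
    and c_nonneg: "\<And>i. i \<in> I \<Longrightarrow> 0 \<le> c i"
begin

definition U where "U = (\<Union>s\<in>S. K s)"

text \<open>The choice \<open>None\<close> stands for the constant 1. With it, the functions for one cell form an orthogonal system, and so do their
  products \<open>term_of A\<close> over all cells for the different patterns \<open>A\<close>.\<close>

definition \<Psi> :: "'s \<Rightarrow> 'i option \<Rightarrow> 'a set \<Rightarrow> real" where
  "\<Psi> s a x = (case a of None \<Rightarrow> 1 | Some i \<Rightarrow> \<psi> s i x)"

definition choices :: "'i option set" where "choices = insert None (Some ` I)"

definition patterns :: "('s \<Rightarrow> 'i option) set" where "patterns = (\<Pi>\<^sub>E s\<in>S. choices)"

definition cost1 :: "'i option \<Rightarrow> real" where "cost1 a = (case a of None \<Rightarrow> 0 | Some i \<Rightarrow> c i)"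

definition cost :: "('s \<Rightarrow> 'i option) \<Rightarrow> real" where "cost A = (\<Sum>s\<in>S. cost1 (A s))"

text \<open>The variances \<open>w\<close> define a probability on patterns, with weight \<open>(\<Prod>s\<in>S. w s (A s)) / Z\<close>, under which the choices at
  different cells are independent. In these terms the second moment of \<open>Q B\<close> is \<open>Z\<close> times the probability of \<open>cost \<le> B\<close>.\<close>

definition w :: "'s \<Rightarrow> 'i option \<Rightarrow> real" where "w s a = bern_exp q (K s) (\<lambda>x. (\<Psi> s a x)\<^sup>2)"

definition term_of :: "('s \<Rightarrow> 'i option) \<Rightarrow> 'a set \<Rightarrow> real" where
  "term_of A x = (\<Prod>s\<in>S. \<Psi> s (A s) (x \<inter> K s))"

definition Q :: "real \<Rightarrow> 'a set \<Rightarrow> real" where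
  "Q B x = (\<Sum>A\<in>patterns. of_bool (cost A \<le> B) * term_of A x)"

text \<open>The coefficient that remains when the terms of \<open>Q\<close> differing only at an empty cell are collected: the choice \<open>None\<close>
  contributes with weight 1 and the choice \<open>i\<close> with weight \<open>- e i\<close>, provided that it fits into the budget.\<close>

definition \<tau> :: "real \<Rightarrow> ('s \<Rightarrow> 'i option) \<Rightarrow> real" where
  "\<tau> B A = of_bool (cost A \<le> B) - (\<Sum>i\<in>I. e i * of_bool (cost A + c i \<le> B))"

definition tail :: "real \<Rightarrow> 's \<Rightarrow> 'a set \<Rightarrow> real" where
  "tail B j x = (\<Sum>A\<in>{A\<in>patterns. A j = None}. \<tau> B A * term_of A x)"

definition Z :: real where "Z = (\<Prod>s\<in>S. \<Sum>a\<in>choices. w s a)"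

lemma finite_choices [simp]: "finite choices"
  using fin by (simp add: choices_def)

lemma finite_patterns [simp]: "finite patterns"
  unfolding patterns_def using fin by (intro finite_PiE) auto

lemma finite_U [simp]: "finite U"
  using fin by (auto simp: U_def)

lemma w_nonneg: "s \<in> S \<Longrightarrow> 0 \<le> w s a"
  unfolding w_def using bern_exp_mono[of "K s" q "\<lambda>_. 0"] fin prob by simp

lemma w_None [simp]: "s \<in> S \<Longrightarrow> w s None = 1"
  using fin by (simp add: w_def \<Psi>_def)

lemma w_Some: "w s (Some i) = bern_exp q (K s) (\<lambda>x. (\<psi> s i x)\<^sup>2)"
  by (simp add: w_def \<Psi>_def)

lemma sum_choices: "(\<Sum>a\<in>choices. f a) = f None + (\<Sum>i\<in>I. f (Some i))"
  unfolding choices_def using fin by (subst sum.insert) (auto simp: sum.reindex)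

lemma sum_w_ge_1: "s \<in> S \<Longrightarrow> 1 \<le> (\<Sum>a\<in>choices. w s a)"
  unfolding sum_choices using w_nonneg by (auto intro!: sum_nonneg)

lemma Z_ge_1: "1 \<le> Z"
  unfolding Z_def using sum_w_ge_1 by (intro prod_ge_1) auto

lemma orth_choices:
  assumes "s \<in> S" "a \<in> choices" "b \<in> choices" "a \<noteq> b"
  shows "bern_exp q (K s) (\<lambda>x. \<Psi> s a x * \<Psi> s b x) = 0"
  using assms orth[OF assms(1)] mean[OF assms(1)] unfolding choices_def \<Psi>_def
  by (cases a; cases b) auto

lemma patterns_differ:
  assumes "A \<in> patterns" "A' \<in> patterns" "A \<noteq> A'"
  shows "\<exists>s\<in>S. A s \<noteq> A' s"
  using assms unfolding patterns_def by (meson PiE_ext)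

lemma pattern_choices: "A \<in> patterns \<Longrightarrow> s \<in> S \<Longrightarrow> A s \<in> choices"
  by (auto simp: patterns_def)

lemma second_moment:
  assumes "\<A> \<subseteq> patterns"
  shows "bern_exp q U (\<lambda>x. (\<Sum>A\<in>\<A>. h A * term_of A x)\<^sup>2) = (\<Sum>A\<in>\<A>. (h A)\<^sup>2 * (\<Prod>s\<in>S. w s (A s)))"
proof -
  have "finite \<A>" using finite_subset[OF assms] by simp
  moreover have "\<exists>s\<in>S. bern_exp q (K s) (\<lambda>x. \<Psi> s (A s) x * \<Psi> s (A' s) x * 1) = 0"
    if A: "A \<in> \<A>" "A' \<in> \<A>" "A \<noteq> A'" for A A'
  proof -
    obtain s where "s \<in> S" "A s \<noteq> A' s" using patterns_differ A assms by blast
    then show ?thesis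
      using orth_choices[of s "A s" "A' s"] A assms pattern_choices by auto
  qed
  ultimately show ?thesis
    using bern_exp_parseval[OF fin(1) fin(3) disj, of \<A> q \<Psi> "\<lambda>_ _. 1" h]
    by (simp add: U_def term_of_def w_def)
qed

lemma sum_patterns_prod: "(\<Sum>A\<in>patterns. \<Prod>s\<in>S. f s (A s)) = (\<Prod>s\<in>S. \<Sum>a\<in>choices. f s a)"
  for f :: "'s \<Rightarrow> 'i option \<Rightarrow> real"
  unfolding patterns_def using fin by (subst prod_sum_PiE) auto

text \<open>Chernoff's bound for the total cost, a sum of independent variables under the probability on patterns. As
  \<open>\<sigma> * c i \<le> 1\<close>, the exponential moment is controlled by the mean cost.\<close>

lemma large_cost_bound:
  assumes \<sigma>: "0 \<le> \<sigma>" "\<And>i. i \<in> I \<Longrightarrow> \<sigma> * c i \<le> 1"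
  shows "(\<Sum>A\<in>patterns. of_bool (cost A > B) * (\<Prod>s\<in>S. w s (A s)))
    \<le> Z * exp (2 * \<sigma> * (\<Sum>s\<in>S. \<Sum>i\<in>I. w s (Some i) * c i) - \<sigma> * B)"
proof -
  define v where "v = (\<lambda>s. \<Sum>a\<in>choices. w s a)"
  define d where "d = (\<lambda>s. \<Sum>i\<in>I. w s (Some i) * c i)"
  have "(\<Sum>A\<in>patterns. of_bool (cost A > B) * (\<Prod>s\<in>S. w s (A s)))
      \<le> (\<Sum>A\<in>patterns. exp (\<sigma> * (cost A - B)) * (\<Prod>s\<in>S. w s (A s)))"
    using \<sigma>(1) by (intro sum_mono mult_right_mono prod_nonneg) (auto simp: w_nonneg)
  also have "\<dots> = (\<Sum>A\<in>patterns. exp (- \<sigma> * B) * (\<Prod>s\<in>S. exp (\<sigma> * cost1 (A s)) * w s (A s)))"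
    using fin(1) by (intro sum.cong refl)
      (simp add: cost_def prod.distrib exp_sum[symmetric] sum_distrib_left algebra_simps
        exp_diff exp_minus divide_inverse)
  also have "\<dots> = exp (- \<sigma> * B) * (\<Prod>s\<in>S. \<Sum>a\<in>choices. exp (\<sigma> * cost1 a) * w s a)"
    unfolding sum_distrib_left[symmetric] by (subst sum_patterns_prod) simp
  also have "(\<Prod>s\<in>S. \<Sum>a\<in>choices. exp (\<sigma> * cost1 a) * w s a) \<le> (\<Prod>s\<in>S. v s * exp (2 * \<sigma> * d s))"
  proof (intro prod_mono conjI)
    fix s assume s: "s \<in> S"
    show "0 \<le> (\<Sum>a\<in>choices. exp (\<sigma> * cost1 a) * w s a)"
      using s by (intro sum_nonneg) (auto simp: w_nonneg)
    have "(\<Sum>a\<in>choices. exp (\<sigma> * cost1 a) * w s a)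
        = v s + (\<Sum>i\<in>I. (exp (\<sigma> * c i) - 1) * w s (Some i))"
      by (simp add: v_def sum_choices cost1_def algebra_simps sum_subtractf)
    also have "\<dots> \<le> v s + (\<Sum>i\<in>I. (2 * (\<sigma> * c i)) * w s (Some i))"
      using s \<sigma> c_nonneg by (intro add_left_mono sum_mono mult_right_mono exp_minus_one_le) (auto simp: w_nonneg)
    also have "\<dots> = v s + 2 * \<sigma> * d s" by (simp add: d_def sum_distrib_left mult_ac)
    also have "\<dots> \<le> v s * (1 + 2 * \<sigma> * d s)"
    proof -
      have "0 \<le> d s" unfolding d_def using s c_nonneg by (intro sum_nonneg mult_nonneg_nonneg) (auto simp: w_nonneg)
      then have "1 * (2 * \<sigma> * d s) \<le> v s * (2 * \<sigma> * d s)"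
        using sum_w_ge_1[OF s] \<sigma>(1) unfolding v_def by (intro mult_right_mono) auto
      then show ?thesis by (simp add: algebra_simps)
    qed
    also have "\<dots> \<le> v s * exp (2 * \<sigma> * d s)"
      using sum_w_ge_1[OF s] unfolding v_def by (intro mult_left_mono exp_ge_add_one_self) auto
    finally show "(\<Sum>a\<in>choices. exp (\<sigma> * cost1 a) * w s a) \<le> v s * exp (2 * \<sigma> * d s)" .
  qed
  also have "(\<Prod>s\<in>S. v s * exp (2 * \<sigma> * d s)) = Z * exp (2 * \<sigma> * (\<Sum>s\<in>S. d s))"
    using fin(1) by (simp add: Z_def v_def prod.distrib exp_sum[symmetric] sum_distrib_left)
  finally show ?thesis unfolding d_def
    by (simp add: exp_diff exp_minus field_simps)
qed

lemma Q_second_moment: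
  "bern_exp q U (\<lambda>x. (Q B x)\<^sup>2) = Z - (\<Sum>A\<in>patterns. of_bool (cost A > B) * (\<Prod>s\<in>S. w s (A s)))"
proof -
  have "bern_exp q U (\<lambda>x. (Q B x)\<^sup>2) = (\<Sum>A\<in>patterns. (of_bool (cost A \<le> B))\<^sup>2 * (\<Prod>s\<in>S. w s (A s)))"
    unfolding Q_def by (rule second_moment) simp
  also have "\<dots> = (\<Sum>A\<in>patterns. (\<Prod>s\<in>S. w s (A s)) - of_bool (cost A > B) * (\<Prod>s\<in>S. w s (A s)))"
    by (intro sum.cong) auto
  also have "\<dots> = Z - (\<Sum>A\<in>patterns. of_bool (cost A > B) * (\<Prod>s\<in>S. w s (A s)))"
    by (simp add: sum_subtractf sum_patterns_prod Z_def)
  finally show ?thesis .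
qed

text \<open>The weights \<open>e\<close> add up to 1. So if every choice at the empty cell fits into the budget the contributions cancel, and
  only patterns within \<open>m\<close>, a bound for a single cost, of the budget \<open>B\<close> remain.\<close>

lemma \<tau>_bounds:
  assumes "A \<in> patterns" "\<And>i. i \<in> I \<Longrightarrow> c i \<le> m"
  shows "0 \<le> \<tau> B A" "\<tau> B A \<le> of_bool (cost A \<le> B)" "\<tau> B A \<le> of_bool (cost A > B - m)"
proof -
  have le: "(\<Sum>i\<in>I. e i * of_bool (cost A + c i \<le> B)) \<le> of_bool (cost A \<le> B)"
  proof -
    have "(\<Sum>i\<in>I. e i * of_bool (cost A + c i \<le> B)) \<le> (\<Sum>i\<in>I. e i * of_bool (cost A \<le> B))"
      using e_nonneg c_nonneg by (intro sum_mono mult_left_mono) (fastforce simp: of_bool_def)+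
    also have "\<dots> = of_bool (cost A \<le> B)" using e_sum by (simp add: sum_distrib_right[symmetric])
    finally show ?thesis .
  qed
  show "0 \<le> \<tau> B A" using le by (simp add: \<tau>_def)
  have ge: "0 \<le> (\<Sum>i\<in>I. e i * of_bool (cost A + c i \<le> B))"
    using e_nonneg by (intro sum_nonneg) auto
  then show 2: "\<tau> B A \<le> of_bool (cost A \<le> B)" by (simp add: \<tau>_def)
  show "\<tau> B A \<le> of_bool (cost A > B - m)"
  proof (cases "cost A > B - m")
    case True
    then show ?thesis using 2 by (auto simp: of_bool_def split: if_splits)
  next
    case False
    have "(\<Sum>i\<in>I. e i * of_bool (cost A + c i \<le> B)) = (\<Sum>i\<in>I. e i)"
      using False assms(2) by (intro sum.cong) (fastforce simp: of_bool_def)+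
    then show ?thesis using False e_sum by (simp add: \<tau>_def)
  qed
qed

lemma tail_second_moment_le:
  assumes "\<And>i. i \<in> I \<Longrightarrow> c i \<le> m"
  shows "bern_exp q U (\<lambda>x. (tail B j x)\<^sup>2)
    \<le> (\<Sum>A\<in>patterns. of_bool (cost A > B - m) * (\<Prod>s\<in>S. w s (A s)))"
proof -
  have "bern_exp q U (\<lambda>x. (tail B j x)\<^sup>2)
      = (\<Sum>A\<in>{A\<in>patterns. A j = None}. (\<tau> B A)\<^sup>2 * (\<Prod>s\<in>S. w s (A s)))"
    unfolding tail_def by (rule second_moment) auto
  also have "\<dots> \<le> (\<Sum>A\<in>{A\<in>patterns. A j = None}. of_bool (cost A > B - m) * (\<Prod>s\<in>S. w s (A s)))"
  proof (intro sum_mono mult_right_mono prod_nonneg)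
    fix A assume "A \<in> {A\<in>patterns. A j = None}"
    then have "(\<tau> B A)\<^sup>2 \<le> (of_bool (cost A > B - m))\<^sup>2"
      using \<tau>_bounds[OF _ assms, of A B] by (intro power_mono) auto
    then show "(\<tau> B A)\<^sup>2 \<le> of_bool (cost A > B - m)" by (auto split: if_splits)
  qed (auto simp: w_nonneg)
  also have "\<dots> \<le> (\<Sum>A\<in>patterns. of_bool (cost A > B - m) * (\<Prod>s\<in>S. w s (A s)))"
    by (intro sum_mono2) (auto intro!: mult_nonneg_nonneg prod_nonneg simp: w_nonneg)
  finally show ?thesis .
qed

lemma sum_patterns_split:
  assumes j: "j \<in> S"
  shows "(\<Sum>A\<in>patterns. f A) = (\<Sum>A\<in>{A\<in>patterns. A j = None}. \<Sum>a\<in>choices. f (A(j := a)))"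
proof -
  have upd: "A(j := a) \<in> patterns" if "A \<in> patterns" "a \<in> choices" for A a
    using that j by (auto simp: patterns_def PiE_def extensional_def)
  have "(\<Sum>A\<in>{A\<in>patterns. A j = None}. \<Sum>a\<in>choices. f (A(j := a)))
      = (\<Sum>(A, a)\<in>{A\<in>patterns. A j = None} \<times> choices. f (A(j := a)))"
    by (rule sum.cartesian_product)
  also have "\<dots> = (\<Sum>A\<in>patterns. f A)"
    by (rule sum.reindex_bij_witness[where i = "\<lambda>A. (A(j := None), A j)" and j = "\<lambda>(A, a). A(j := a)"])
       (use upd j pattern_choices in \<open>auto simp: choices_def\<close>)
  finally show ?thesis by simp
qed

text \<open>The patterns are grouped by their restriction to \<open>S - {j}\<close>. At an empty cell the factor for the choice \<open>i\<close> is the constant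
  \<open>- e i\<close>, so a group contributes a multiple of the term with \<open>None\<close> at \<open>j\<close>.\<close>

lemma Q_eq_tail:
  assumes j: "j \<in> S" and x: "x \<inter> K j = {}"
  shows "Q B x = tail B j x"
proof -
  have upd: "term_of (A(j := a)) x = \<Psi> j a {} * term_of A x" if "A j = None" for A a
  proof -
    have "term_of (A(j := a)) x = \<Psi> j a {} * (\<Prod>s\<in>S - {j}. \<Psi> s (A s) (x \<inter> K s))"
      unfolding term_of_def using j x fin(1) by (subst prod.remove[of S j]) auto
    moreover have "term_of A x = \<Psi> j None {} * (\<Prod>s\<in>S - {j}. \<Psi> s (A s) (x \<inter> K s))"
      unfolding term_of_def using j x fin(1) that by (subst prod.remove[of S j]) auto
    ultimately show ?thesis by (simp add: \<Psi>_def)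
  qed
  have cost: "cost (A(j := a)) = cost A + cost1 a" if "A j = None" for A a
  proof -
    have "cost (A(j := a)) = cost1 a + (\<Sum>s\<in>S - {j}. cost1 (A s))"
      unfolding cost_def using j fin(1) by (subst sum.remove[of S j]) auto
    moreover have "cost A = cost1 None + (\<Sum>s\<in>S - {j}. cost1 (A s))"
      unfolding cost_def using j fin(1) that by (subst sum.remove[of S j]) auto
    ultimately show ?thesis by (simp add: cost1_def)
  qed
  have "Q B x = (\<Sum>A\<in>{A\<in>patterns. A j = None}. \<Sum>a\<in>choices.
      of_bool (cost (A(j := a)) \<le> B) * term_of (A(j := a)) x)"
    unfolding Q_def by (rule sum_patterns_split[OF j])
  also have "\<dots> = tail B j x"
    unfolding tail_def
  proof (intro sum.cong refl)
    fix A assume "A \<in> {A\<in>patterns. A j = None}"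
    then have A: "A j = None" by simp
    have "(\<Sum>a\<in>choices. of_bool (cost (A(j := a)) \<le> B) * term_of (A(j := a)) x)
        = (of_bool (cost A \<le> B) + (\<Sum>i\<in>I. of_bool (cost A + c i \<le> B) * (- e i))) * term_of A x"
      unfolding sum_choices upd[where A = A, OF A] cost[where A = A, OF A]
      using j atom by (simp add: \<Psi>_def cost1_def algebra_simps sum_distrib_left sum_distrib_right)
    then show "(\<Sum>a\<in>choices. of_bool (cost (A(j := a)) \<le> B) * term_of (A(j := a)) x)
        = \<tau> B A * term_of A x"
      by (simp add: \<tau>_def sum_negf mult.commute)
  qed
  finally show ?thesis .
qed

text \<open>With weights at \<open>j\<close> and \<open>j'\<close>, orthogonality is lost at these two cells. Therefore \<open>Q\<close> is split into
  \<open>(card choices)\<^sup>2\<close> parts \<open>R a\<close> according to the choices there; each part is treated by Parseval's identity, and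
  Cauchy's inequality for the sum of the parts costs a further factor. The powers of \<open>card choices\<close> are harmless, as the weights
  will be the indicators of two hits by the same large prime.\<close>

lemma weighted_second_moment_le:
  assumes j: "j \<in> S" "j' \<in> S" "j \<noteq> j'" and y: "\<And>s x. 0 \<le> y s x"
    and g: "\<And>s a. s \<in> {j, j'} \<Longrightarrow> a \<in> choices \<Longrightarrow> bern_exp q (K s) (\<lambda>x. (\<Psi> s a x)\<^sup>2 * y s x) \<le> g"
  shows "bern_exp q U (\<lambda>x. (Q B x)\<^sup>2 * (y j (x \<inter> K j) * y j' (x \<inter> K j')))
    \<le> real (card choices) ^ 6 * g\<^sup>2 * Z"
proof -
  define O2 where "O2 = choices \<times> choices"
  define \<A> where "\<A> = (\<lambda>a. {A\<in>patterns. A j = fst a \<and> A j' = snd a})"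
  define h where "h = (\<lambda>A. of_bool (cost A \<le> B) :: real)"
  define R where "R = (\<lambda>a x. \<Sum>A\<in>\<A> a. h A * term_of A x)"
  define z where "z = (\<lambda>s x. if s \<in> {j, j'} then y s x else 1)"
  have g0: "0 \<le> g"
  proof -
    have "0 \<le> bern_exp q (K j) (\<lambda>x. (\<Psi> j None x)\<^sup>2 * y j x)"
      using bern_exp_mono[of "K j" q "\<lambda>_. 0"] prob j y fin by simp
    then show ?thesis using g[of j None] by (auto simp: choices_def)
  qed
  have finO: "finite O2" by (simp add: O2_def)
  have cardO: "real (card O2) = real (card choices) ^ 2"
    by (simp add: O2_def card_cartesian_product power2_eq_square)
  have sub: "\<A> a \<subseteq> patterns" "finite (\<A> a)" for a by (auto simp: \<A>_def)
  have Q_eq: "Q B x = (\<Sum>a\<in>O2. R a x)" for x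
  proof -
    have "patterns = (\<Union>a\<in>O2. \<A> a)"
      using pattern_choices j by (auto simp: \<A>_def O2_def)
    then have "Q B x = (\<Sum>A\<in>(\<Union>a\<in>O2. \<A> a). h A * term_of A x)"
      by (simp add: Q_def h_def)
    also have "\<dots> = (\<Sum>a\<in>O2. R a x)"
      unfolding R_def by (intro sum.UNION_disjoint finO) (auto simp: \<A>_def)
    finally show ?thesis .
  qed
  have prod_z: "(\<Prod>s\<in>S. z s (x \<inter> K s)) = y j (x \<inter> K j) * y j' (x \<inter> K j')" for x
  proof -
    have "(\<Prod>s\<in>S. z s (x \<inter> K s)) = (\<Prod>s\<in>{j, j'}. z s (x \<inter> K s))"
      using j fin(1) by (intro prod.mono_neutral_right) (auto simp: z_def)
    then show ?thesis using j by (simp add: z_def)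
  qed
  have block: "bern_exp q U (\<lambda>x. (R a x)\<^sup>2 * (\<Prod>s\<in>S. z s (x \<inter> K s)))
      \<le> g\<^sup>2 * real (card choices) ^ 2 * Z" if a: "a \<in> O2" for a
  proof -
    let ?G = "\<lambda>A s. bern_exp q (K s) (\<lambda>x. (\<Psi> s (A s) x)\<^sup>2 * z s x)"
    have "bern_exp q U (\<lambda>x. (R a x)\<^sup>2 * (\<Prod>s\<in>S. z s (x \<inter> K s))) = (\<Sum>A\<in>\<A> a. (h A)\<^sup>2 * (\<Prod>s\<in>S. ?G A s))"
      unfolding U_def R_def term_of_def
    proof (rule bern_exp_parseval[OF fin(1) fin(3) disj sub(2)])
      fix A A' assume A: "A \<in> \<A> a" "A' \<in> \<A> a" "A \<noteq> A'"
      then obtain s where s: "s \<in> S" "A s \<noteq> A' s" using patterns_differ sub by blast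
      then have "s \<notin> {j, j'}" using A by (auto simp: \<A>_def)
      then have "z s = (\<lambda>_. 1)" by (auto simp: z_def)
      then show "\<exists>s\<in>S. bern_exp q (K s) (\<lambda>x. \<Psi> s (A s) x * \<Psi> s (A' s) x * z s x) = 0"
        using s A sub(1)[of a] orth_choices[of s "A s" "A' s"] pattern_choices[of A s] pattern_choices[of A' s]
        by (intro bexI[of _ s]) auto
    qed auto
    also have "\<dots> \<le> (\<Sum>A\<in>\<A> a. \<Prod>s\<in>S. if s \<in> {j, j'} then g else w s (A s))"
    proof (rule sum_mono)
      fix A assume A: "A \<in> \<A> a"
      have "(\<Prod>s\<in>S. ?G A s) \<le> (\<Prod>s\<in>S. if s \<in> {j, j'} then g else w s (A s))"
      proof (intro prod_mono conjI)
        fix s assume s: "s \<in> S"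
        show "0 \<le> ?G A s"
          using bern_exp_mono[of "K s" q "\<lambda>_. 0"] prob s y fin by (simp add: z_def)
        show "?G A s \<le> (if s \<in> {j, j'} then g else w s (A s))"
          using g[of s "A s"] A sub(1)[of a] pattern_choices[of A s] s by (auto simp: z_def w_def)
      qed
      moreover have "(h A)\<^sup>2 \<le> 1" by (simp add: h_def)
      moreover have "0 \<le> (\<Prod>s\<in>S. if s \<in> {j, j'} then g else w s (A s))"
        using g0 by (intro prod_nonneg) (auto simp: w_nonneg)
      ultimately have "(h A)\<^sup>2 * (\<Prod>s\<in>S. ?G A s) \<le> (h A)\<^sup>2 * (\<Prod>s\<in>S. if s \<in> {j, j'} then g else w s (A s))"
        "(h A)\<^sup>2 * (\<Prod>s\<in>S. if s \<in> {j, j'} then g else w s (A s)) \<le> 1 * (\<Prod>s\<in>S. if s \<in> {j, j'} then g else w s (A s))"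
        by (intro mult_left_mono mult_right_mono; simp)+
      then show "(h A)\<^sup>2 * (\<Prod>s\<in>S. ?G A s) \<le> (\<Prod>s\<in>S. if s \<in> {j, j'} then g else w s (A s))" by simp
    qed
    also have "\<dots> \<le> (\<Sum>A\<in>patterns. \<Prod>s\<in>S. if s \<in> {j, j'} then g else w s (A s))"
      using sub g0 by (intro sum_mono2) (auto intro!: prod_nonneg simp: w_nonneg)
    also have "\<dots> = (\<Prod>s\<in>S. \<Sum>a\<in>choices. if s \<in> {j, j'} then g else w s a)"
      by (rule sum_patterns_prod)
    also have "\<dots> \<le> (\<Prod>s\<in>S. (if s \<in> {j, j'} then g * real (card choices) else 1) * (\<Sum>a\<in>choices. w s a))"
    proof (intro prod_mono conjI)
      fix s assume s: "s \<in> S"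
      show "0 \<le> (\<Sum>a\<in>choices. if s \<in> {j, j'} then g else w s a)"
        using s g0 by (intro sum_nonneg) (auto simp: w_nonneg)
      have "g * real (card choices) * 1 \<le> g * real (card choices) * (\<Sum>a\<in>choices. w s a)"
        using sum_w_ge_1[OF s] g0 by (intro mult_left_mono) auto
      then show "(\<Sum>a\<in>choices. if s \<in> {j, j'} then g else w s a)
        \<le> (if s \<in> {j, j'} then g * real (card choices) else 1) * (\<Sum>a\<in>choices. w s a)"
        by (simp add: mult.commute)
    qed
    also have "\<dots> = (\<Prod>s\<in>S. if s \<in> {j, j'} then g * real (card choices) else 1) * Z"
      by (simp add: prod.distrib Z_def)
    also have "(\<Prod>s\<in>S. if s \<in> {j, j'} then g * real (card choices) else 1)
        = (\<Prod>s\<in>{j, j'}. g * real (card choices))"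
      using j fin(1) by (subst prod.inter_restrict[symmetric]) (auto intro!: prod.cong)
    also have "\<dots> = g\<^sup>2 * real (card choices) ^ 2"
      using j by (simp add: power2_eq_square)
    finally show ?thesis .
  qed
  have "bern_exp q U (\<lambda>x. (Q B x)\<^sup>2 * (y j (x \<inter> K j) * y j' (x \<inter> K j')))
      \<le> bern_exp q U (\<lambda>x. \<Sum>a\<in>O2. real (card O2) * ((R a x)\<^sup>2 * (\<Prod>s\<in>S. z s (x \<inter> K s))))"
  proof (rule bern_exp_mono)
    fix x
    have "(Q B x)\<^sup>2 \<le> real (card O2) * (\<Sum>a\<in>O2. (R a x)\<^sup>2)"
      unfolding Q_eq by (rule square_sum_le)
    then have "(Q B x)\<^sup>2 * (y j (x \<inter> K j) * y j' (x \<inter> K j'))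
        \<le> (real (card O2) * (\<Sum>a\<in>O2. (R a x)\<^sup>2)) * (y j (x \<inter> K j) * y j' (x \<inter> K j'))"
      using y by (intro mult_right_mono) auto
    then show "(Q B x)\<^sup>2 * (y j (x \<inter> K j) * y j' (x \<inter> K j'))
        \<le> (\<Sum>a\<in>O2. real (card O2) * ((R a x)\<^sup>2 * (\<Prod>s\<in>S. z s (x \<inter> K s))))"
      unfolding prod_z by (simp add: sum_distrib_left sum_distrib_right mult_ac)
  qed (use prob in \<open>auto simp: U_def\<close>)
  also have "\<dots> = (\<Sum>a\<in>O2. real (card O2) * bern_exp q U (\<lambda>x. (R a x)\<^sup>2 * (\<Prod>s\<in>S. z s (x \<inter> K s))))"
    by (simp only: bern_exp_sum bern_exp_cmult)
  also have "\<dots> \<le> (\<Sum>a\<in>O2. real (card O2) * (g\<^sup>2 * real (card choices) ^ 2 * Z))"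
    using block by (intro sum_mono mult_left_mono) auto
  also have "\<dots> = real (card choices) ^ 6 * g\<^sup>2 * Z"
    using cardO by (simp add: power2_eq_square eval_nat_numeral)
  finally show ?thesis .
qed

text \<open>A term has coefficient sum at most \<open>exp (cost A)\<close>, so at most \<open>exp (2 * B - cost A)\<close> if its cost is within the budget. The
  sum of \<open>exp (- cost A)\<close> over all patterns factors over the cells and is bounded by \<open>small\<close>.\<close>

lemma coeff_bound_terms:
  assumes W: "\<And>s i. s \<in> S \<Longrightarrow> i \<in> I \<Longrightarrow> coeff_bound U (\<lambda>x. \<psi> s i (x \<inter> K s)) (exp (c i))"
    and small: "real (card S) * (\<Sum>i\<in>I. exp (- c i)) \<le> 1"
    and h: "\<And>A. A \<in> \<A> \<Longrightarrow> \<bar>h A\<bar> \<le> of_bool (cost A \<le> B)" and sub: "\<A> \<subseteq> patterns"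
  shows "coeff_bound U (\<lambda>x. \<Sum>A\<in>\<A>. h A * term_of A x) (exp (2 * B + 1))"
proof -
  have W': "coeff_bound U (\<lambda>x. \<Psi> s a (x \<inter> K s)) (exp (cost1 a))" if "s \<in> S" "a \<in> choices" for s a
    using that W coeff_bound_const[of U 1] by (auto simp: choices_def \<Psi>_def cost1_def)
  have "coeff_bound U (\<lambda>x. \<Sum>A\<in>\<A>. h A * term_of A x) (\<Sum>A\<in>\<A>. \<bar>h A\<bar> * (\<Prod>s\<in>S. exp (cost1 (A s))))"
    unfolding term_of_def using fin(1) sub W' pattern_choices finite_subset[OF sub finite_patterns]
    by (intro coeff_bound_sum coeff_bound_cmult coeff_bound_prod) auto
  moreover have "(\<Sum>A\<in>\<A>. \<bar>h A\<bar> * (\<Prod>s\<in>S. exp (cost1 (A s)))) \<le> exp (2 * B + 1)"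
  proof -
    have "(\<Sum>A\<in>\<A>. \<bar>h A\<bar> * (\<Prod>s\<in>S. exp (cost1 (A s)))) \<le> (\<Sum>A\<in>\<A>. exp (2 * B) * (\<Prod>s\<in>S. exp (- cost1 (A s))))"
    proof (rule sum_mono)
      fix A assume A: "A \<in> \<A>"
      have "\<bar>h A\<bar> * exp (cost A) \<le> of_bool (cost A \<le> B) * exp (cost A)"
        using h[OF A] by (intro mult_right_mono) auto
      also have "\<dots> \<le> exp (2 * B + (\<Sum>s\<in>S. - cost1 (A s)))"
        by (auto simp: sum_negf cost_def of_bool_def)
      finally show "\<bar>h A\<bar> * (\<Prod>s\<in>S. exp (cost1 (A s))) \<le> exp (2 * B) * (\<Prod>s\<in>S. exp (- cost1 (A s)))"
        using fin(1) unfolding cost_def exp_add by (simp only: exp_sum)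
    qed
    also have "\<dots> \<le> (\<Sum>A\<in>patterns. exp (2 * B) * (\<Prod>s\<in>S. exp (- cost1 (A s))))"
      using sub by (intro sum_mono2) (auto intro!: mult_nonneg_nonneg prod_nonneg)
    also have "\<dots> = exp (2 * B) * (\<Prod>s\<in>S. \<Sum>a\<in>choices. exp (- cost1 a))"
      unfolding sum_distrib_left[symmetric] by (subst sum_patterns_prod) simp
    also have "(\<Prod>s\<in>S. \<Sum>a\<in>choices. exp (- cost1 a)) = (1 + (\<Sum>i\<in>I. exp (- c i))) ^ card S"
      by (simp add: sum_choices cost1_def)
    also have "\<dots> \<le> exp (\<Sum>i\<in>I. exp (- c i)) ^ card S"
      by (intro power_mono exp_ge_add_one_self) (auto intro!: add_nonneg_nonneg sum_nonneg)
    also have "\<dots> = exp (real (card S) * (\<Sum>i\<in>I. exp (- c i)))" by (simp add: exp_of_nat_mult)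
    also have "\<dots> \<le> exp 1" using small by simp
    finally show ?thesis by (simp add: exp_add)
  qed
  ultimately show ?thesis by (rule coeff_bound.weaken)
qed

end

section \<open>Weights for the blocks of a single shift\<close>

text \<open>The weight of scale \<open>i\<close> is the centred number of hits in block \<open>i\<close>, multiplied by approximate indicators that the
  blocks \<open>b < i\<close> contain no hit. The truncation depth grows with \<open>i - b\<close>, so that the errors sum to a bounded factor
  while the depth at block \<open>b\<close>, weighted by the size \<open>2 ^ b\<close> of its primes in bits, still sums to \<open>O (2 ^ i)\<close>.\<close>

definition layer :: "('a \<Rightarrow> real) \<Rightarrow> (nat \<Rightarrow> 'a set) \<Rightarrow> real \<Rightarrow> nat \<Rightarrow> nat \<Rightarrow> nat \<Rightarrow> real" where
  "layer q C M i b n = (if b < i then brun_weight (i - b + 58) n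
     else if b = i then (real n - sum q (C i)) / M else 1)"

definition scale_weight :: "('a \<Rightarrow> real) \<Rightarrow> (nat \<Rightarrow> 'a set) \<Rightarrow> nat set \<Rightarrow> real \<Rightarrow> nat \<Rightarrow> 'a set \<Rightarrow> real" where
  "scale_weight q C I M i x = (\<Prod>b\<in>I. layer q C M i b (card (x \<inter> C b)))"

locale bin_blocks =
  fixes q :: "'a \<Rightarrow> real" and C :: "nat \<Rightarrow> 'a set" and I :: "nat set" and M :: real
  assumes finI: "finite I" and finC: "\<And>b. b \<in> I \<Longrightarrow> finite (C b)"
    and disC: "disjoint_family_on C I"
    and q0: "\<And>b a. b \<in> I \<Longrightarrow> a \<in> C b \<Longrightarrow> 0 \<le> q a \<and> q a \<le> 1 / 2"
    and mass: "\<And>b. b \<in> I \<Longrightarrow> sum q (C b) \<le> 4"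
    and M1: "M \<ge> 1"
begin

definition bin where "bin = (\<Union>b\<in>I. C b)"

lemma finite_bin [simp]: "finite bin"
  using finI finC by (simp add: bin_def)

lemma q_bin: "a \<in> bin \<Longrightarrow> 0 \<le> q a \<and> q a \<le> 1"
  using q0 by (fastforce simp: bin_def)

lemma exp_prod: "bern_exp q bin (\<lambda>x. \<Prod>b\<in>I. f b (card (x \<inter> C b)))
    = (\<Prod>b\<in>I. bern_exp q (C b) (\<lambda>x. f b (card x)))"
  unfolding bin_def using finI finC disC
  by (intro bern_exp_prod[where f = "\<lambda>b x. f b (card x)"])

lemma layer_mean: "i \<in> I \<Longrightarrow> bern_exp q (C i) (\<lambda>x. layer q C M i i (card x)) = 0"
  using bern_exp_cmult[of q "C i" "1 / M" "\<lambda>x. real (card x) - sum q (C i)"]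
    bern_exp_centred[OF finC] by (simp add: layer_def)

lemma scale_weight_mean: "i \<in> I \<Longrightarrow> bern_exp q bin (scale_weight q C I M i) = 0"
  unfolding scale_weight_def exp_prod using finI layer_mean by (auto intro!: prod_zero)

text \<open>For \<open>l < i\<close> the weight of scale \<open>l\<close> does not involve block \<open>i\<close>, in which the weight of scale \<open>i\<close> is centred.\<close>

lemma scale_weight_orth:
  assumes "i \<in> I" "l \<in> I" "i \<noteq> l"
  shows "bern_exp q bin (\<lambda>x. scale_weight q C I M i x * scale_weight q C I M l x) = 0"
proof -
  have *: "bern_exp q bin (\<lambda>x. scale_weight q C I M i x * scale_weight q C I M l x) = 0"
    if "i \<in> I" "l < i" for i l
  proof -
    have "bern_exp q (C i) (\<lambda>x. layer q C M i i (card x) * layer q C M l i (card x)) = 0"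
      using layer_mean[OF that(1)] that(2) by (simp add: layer_def[of q C M l])
    then show ?thesis
      unfolding scale_weight_def prod.distrib[symmetric] exp_prod[where f = "\<lambda>b n. layer q C M i b n * layer q C M l b n"]
      using finI that by (auto intro!: prod_zero)
  qed
  show ?thesis
  proof (cases "l < i")
    case True
    then show ?thesis using * assms by simp
  next
    case False
    then have "i < l" using assms by simp
    then show ?thesis using *[OF assms(2)] by (simp add: mult.commute)
  qed
qed

lemma scale_weight_empty: "i \<in> I \<Longrightarrow> scale_weight q C I M i {} = - (sum q (C i) / M)"
proof -
  assume i: "i \<in> I"
  have "scale_weight q C I M i {} = (\<Prod>b\<in>I. if b = i then - (sum q (C i) / M) else 1)"
    unfolding scale_weight_def by (intro prod.cong) (auto simp: layer_def)
  then show ?thesis using i finI by simp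
qed

lemma sum_half_powers: "(\<Sum>b\<in>{b\<in>I. b < i}. (1 / 2 :: real) ^ (i - b + 1)) \<le> 1 / 2"
proof -
  have "(\<Sum>b\<in>{b\<in>I. b < i}. (1 / 2 :: real) ^ (i - b + 1)) \<le> (\<Sum>b<i. (1 / 2) ^ (i - b + 1))"
    by (intro sum_mono2) auto
  also have "\<dots> = 1 / 2 - (1 / 2) ^ (i + 1)"
  proof (induction i)
    case (Suc i)
    have "(\<Sum>b<Suc i. (1 / 2 :: real) ^ (Suc i - b + 1)) = (\<Sum>b<i. (1 / 2) * (1 / 2) ^ (i - b + 1)) + 1 / 4"
      by (simp add: Suc_diff_le)
    also have "\<dots> = 1 / 2 * (1 / 2 - (1 / 2) ^ (i + 1)) + 1 / 4"
      using Suc by (simp only: sum_distrib_left[symmetric])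
    finally show ?case by simp
  qed simp
  also have "\<dots> \<le> (1 / 2 :: real)" by simp
  finally show ?thesis .
qed

text \<open>The main term is the probability of no hit in the block, which is bounded below since the block has bounded mass. The
  constant 58 makes the truncation error small relative to it: the ratio is at most
  \<open>exp (28 + 8) / 2 ^ (k + 59)\<close>, and \<open>exp 36 \<le> 3 ^ 36 \<le> 2 ^ 58\<close>.\<close>

lemma brun_layer_bound:
  assumes b: "b \<in> I"
  shows "bern_exp q (C b) (\<lambda>x. (brun_weight (k + 58) (card x))\<^sup>2)
    \<le> (\<Prod>a\<in>C b. 1 - q a) * (1 + (1 / 2) ^ (k + 1))"
proof -
  have q: "\<And>a. a \<in> C b \<Longrightarrow> 0 \<le> q a \<and> q a \<le> 1 / 2" using q0 b by auto
  then have q': "\<And>a. a \<in> C b \<Longrightarrow> 0 \<le> q a \<and> q a \<le> 1" by fastforce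
  have low: "exp (-8) \<le> (\<Prod>a\<in>C b. 1 - q a)"
  proof -
    have "exp (-8) \<le> exp (- 2 * sum q (C b))" using mass[OF b] by simp
    also have "\<dots> \<le> (\<Prod>a\<in>C b. 1 - q a)"
      using q finC[OF b] by (intro prod_one_minus_ge_exp) auto
    finally show ?thesis .
  qed
  have up: "(\<Prod>a\<in>C b. 1 + 7 * q a) \<le> exp 28"
  proof -
    have "(\<Prod>a\<in>C b. 1 + 7 * q a) \<le> (\<Prod>a\<in>C b. exp (7 * q a))"
      using q by (intro prod_mono conjI) (auto intro: exp_ge_add_one_self)
    also have "\<dots> = exp (7 * sum q (C b))" using finC[OF b] by (simp add: exp_sum sum_distrib_left)
    also have "\<dots> \<le> exp 28" using mass[OF b] by simp
    finally show ?thesis .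
  qed
  have "exp 36 = exp (1::real) ^ 36" by (simp flip: exp_of_nat_mult)
  also have "\<dots> \<le> 3 ^ 36" using exp_le by (intro power_mono) auto
  also have "\<dots> \<le> (2::real) ^ 58" by simp
  finally have e36: "exp 36 \<le> (2::real) ^ 58" .
  have "(\<Prod>a\<in>C b. 1 + 7 * q a) / 2 ^ (k + 58 + 1) \<le> exp (-8) * exp 36 / 2 ^ (k + 58 + 1)"
    using up by (intro divide_right_mono) (simp_all flip: exp_add)
  also have "\<dots> \<le> (\<Prod>a\<in>C b. 1 - q a) * 2 ^ 58 / 2 ^ (k + 58 + 1)"
    using low e36 by (intro divide_right_mono mult_mono) (auto intro: order_trans[OF exp_ge_zero])
  also have "\<dots> = (\<Prod>a\<in>C b. 1 - q a) * (1 / 2) ^ (k + 1)"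
    by (simp add: power_add power_divide)
  finally have excess: "(\<Prod>a\<in>C b. 1 + 7 * q a) / 2 ^ (k + 58 + 1)
      \<le> (\<Prod>a\<in>C b. 1 - q a) * (1 / 2) ^ (k + 1)" .
  have "bern_exp q (C b) (\<lambda>x. (brun_weight (k + 58) (card x))\<^sup>2)
      \<le> (\<Prod>a\<in>C b. 1 - q a) + (\<Prod>a\<in>C b. 1 + 7 * q a) / 2 ^ (k + 58 + 1)"
    by (rule bern_exp_brun_weight_square[OF finC[OF b] q'])
  with excess show ?thesis unfolding distrib_left mult_1_right by linarith
qed

text \<open>The variance of a centred count is at most its mean, and each lower block contributes its probability of no hit up to the
  factor \<open>1 + 2 ^ - (i - b + 1)\<close>; the product of these factors is at most 2.\<close>

lemma scale_weight_square_le: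
  assumes i: "i \<in> I"
  shows "bern_exp q bin (\<lambda>x. (scale_weight q C I M i x)\<^sup>2)
    \<le> 2 * (sum q (C i) / M\<^sup>2) * (\<Prod>b\<in>{b\<in>I. b < i}. \<Prod>a\<in>C b. 1 - q a)"
proof -
  let ?f = "\<lambda>b. if b < i then (\<Prod>a\<in>C b. 1 - q a) * (1 + (1 / 2) ^ (i - b + 1))
      else if b = i then sum q (C i) / M\<^sup>2 else 1"
  let ?L = "{b\<in>I. b < i}"
  have m0: "0 \<le> sum q (C i)" using q0 i by (intro sum_nonneg) auto
  have "bern_exp q bin (\<lambda>x. (scale_weight q C I M i x)\<^sup>2)
      = (\<Prod>b\<in>I. bern_exp q (C b) (\<lambda>x. (layer q C M i b (card x))\<^sup>2))"
    unfolding scale_weight_def prod_power_distrib exp_prod[where f = "\<lambda>b n. (layer q C M i b n)\<^sup>2"] ..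
  also have "\<dots> \<le> (\<Prod>b\<in>I. ?f b)"
  proof (intro prod_mono conjI)
    fix b assume b: "b \<in> I"
    have q': "\<And>a. a \<in> C b \<Longrightarrow> 0 \<le> q a \<and> q a \<le> 1" using q_bin b by (auto simp: bin_def)
    show "0 \<le> bern_exp q (C b) (\<lambda>x. (layer q C M i b (card x))\<^sup>2)"
      using bern_exp_mono[of "C b" q "\<lambda>_. 0"] q' finC[OF b] by simp
    consider "b < i" | "b = i" | "b > i" by linarith
    then show "bern_exp q (C b) (\<lambda>x. (layer q C M i b (card x))\<^sup>2) \<le> ?f b"
    proof cases
      case 1
      then show ?thesis using brun_layer_bound[OF b, of "i - b"] by (simp add: layer_def)
    next
      case 2
      have "bern_exp q (C b) (\<lambda>x. (layer q C M i b (card x))\<^sup>2)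
          = bern_exp q (C i) (\<lambda>x. (1 / M\<^sup>2) * (real (card x) - sum q (C i))\<^sup>2)"
        using 2 by (simp add: layer_def power_divide)
      also have "\<dots> = (1 / M\<^sup>2) * (\<Sum>a\<in>C i. q a * (1 - q a))"
        using finC[OF i] by (simp only: bern_exp_cmult bern_exp_variance)
      also have "\<dots> \<le> (1 / M\<^sup>2) * (\<Sum>a\<in>C i. q a * 1)"
        using q' 2 by (intro mult_left_mono sum_mono) auto
      finally show ?thesis using 2 by simp
    next
      case 3
      then show ?thesis using finC[OF b] by (simp add: layer_def)
    qed
  qed
  also have "\<dots> = (sum q (C i) / M\<^sup>2) * (\<Prod>b\<in>?L. (\<Prod>a\<in>C b. 1 - q a) * (1 + (1 / 2) ^ (i - b + 1)))"
  proof -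
    have "(\<Prod>b\<in>I. ?f b) = (\<Prod>b\<in>insert i ?L. ?f b)"
      using i finI by (intro prod.mono_neutral_right) auto
    also have "\<dots> = ?f i * (\<Prod>b\<in>?L. ?f b)" using finI by (subst prod.insert) auto
    also have "(\<Prod>b\<in>?L. ?f b) = (\<Prod>b\<in>?L. (\<Prod>a\<in>C b. 1 - q a) * (1 + (1 / 2) ^ (i - b + 1)))"
      by (intro prod.cong) auto
    finally show ?thesis by simp
  qed
  also have "(\<Prod>b\<in>?L. (\<Prod>a\<in>C b. 1 - q a) * (1 + (1 / 2) ^ (i - b + 1)))
     = (\<Prod>b\<in>?L. \<Prod>a\<in>C b. 1 - q a) * (\<Prod>b\<in>?L. 1 + (1 / 2) ^ (i - b + 1))"
    by (rule prod.distrib)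
  also have "(sum q (C i) / M\<^sup>2) * ((\<Prod>b\<in>?L. \<Prod>a\<in>C b. 1 - q a) * (\<Prod>b\<in>?L. 1 + (1 / 2) ^ (i - b + 1)))
     \<le> (sum q (C i) / M\<^sup>2) * ((\<Prod>b\<in>?L. \<Prod>a\<in>C b. 1 - q a) * 2)"
  proof (intro mult_left_mono)
    have "(\<Prod>b\<in>?L. 1 + (1 / 2 :: real) ^ (i - b + 1)) \<le> (\<Prod>b\<in>?L. exp ((1 / 2) ^ (i - b + 1)))"
      by (intro prod_mono conjI exp_ge_add_one_self) (auto intro!: add_nonneg_nonneg)
    also have "\<dots> = exp (\<Sum>b\<in>?L. (1 / 2) ^ (i - b + 1))" using finI by (simp add: exp_sum)
    also have "\<dots> \<le> exp (1 / 2)" using sum_half_powers by simp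
    also have "\<dots> \<le> (2::real)"
    proof -
      have "exp (1 / 2 :: real) \<le> 1 + 1 / 2 + (1 / 2)\<^sup>2" by (rule exp_bound) auto
      then show ?thesis by (simp add: power2_eq_square)
    qed
    finally show "(\<Prod>b\<in>?L. 1 + (1 / 2 :: real) ^ (i - b + 1)) \<le> 2" .
    show "0 \<le> (\<Prod>b\<in>?L. \<Prod>a\<in>C b. 1 - q a)"
    proof (intro prod_nonneg)
      fix b a assume "b \<in> ?L" "a \<in> C b"
      then have "q a \<le> 1 / 2" using q0 by auto
      then show "0 \<le> 1 - q a" by simp
    qed
  qed (use m0 in auto)
  finally show ?thesis by (simp add: mult_ac)
qed

lemma abs_scale_weight_le:
  assumes i: "i \<in> I" and x: "finite x"
  shows "\<bar>scale_weight q C I M i x\<bar> \<le> 4 * 2 ^ card x"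
proof -
  have m0: "0 \<le> sum q (C i)" using q0 i by (intro sum_nonneg) auto
  have "\<bar>scale_weight q C I M i x\<bar> = (\<Prod>b\<in>I. \<bar>layer q C M i b (card (x \<inter> C b))\<bar>)"
    by (simp add: scale_weight_def abs_prod)
  also have "\<dots> \<le> (\<Prod>b\<in>I. (if b = i then 4 else 1) * 2 ^ card (x \<inter> C b))"
  proof (intro prod_mono conjI)
    fix b assume b: "b \<in> I"
    let ?n = "card (x \<inter> C b)"
    consider "b < i" | "b = i" | "b > i" by linarith
    then show "\<bar>layer q C M i b ?n\<bar> \<le> (if b = i then 4 else 1) * 2 ^ ?n"
    proof cases
      case 1
      then show ?thesis using abs_brun_weight_le by (simp add: layer_def)
    next
      case 2
      have "real ?n \<le> 2 ^ ?n" using of_nat_less_two_power[of ?n] by (simp add: less_imp_le)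
      moreover have "(1::real) \<le> 2 ^ ?n" by simp
      ultimately have "\<bar>real ?n - sum q (C i)\<bar> \<le> 4 * 2 ^ ?n"
        using m0 mass[OF i] by linarith
      moreover have "\<bar>real ?n - sum q (C i)\<bar> / M \<le> \<bar>real ?n - sum q (C i)\<bar> / 1"
        using M1 by (intro divide_left_mono) auto
      ultimately show ?thesis using 2 M1 by (simp add: layer_def)
    qed (simp add: layer_def)
  qed simp
  also have "\<dots> = 4 * 2 ^ (\<Sum>b\<in>I. card (x \<inter> C b))"
    using i finI by (simp add: prod.distrib power_sum)
  also have "(\<Sum>b\<in>I. card (x \<inter> C b)) = card (\<Union>b\<in>I. x \<inter> C b)"
    using finI x disC by (intro card_UN_disjoint[symmetric]) (auto simp: disjoint_family_on_def)
  also have "(4::real) * 2 ^ card (\<Union>b\<in>I. x \<inter> C b) \<le> 4 * 2 ^ card x"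
    using x by (intro mult_left_mono power_increasing card_mono) auto
  finally show ?thesis .
qed

text \<open>A crude bound for the part of the second moment on which \<open>a\<close> is a hit. It loses an exponential in the number of
  blocks but keeps the factor \<open>q a\<close>, so that a double hit of a prime \<open>p\<close> has weight of order \<open>1 / p\<^sup>2\<close>.\<close>

lemma weighted_scale_weight_le:
  assumes a: "a \<in> bin" and f: "\<And>x. x \<subseteq> bin \<Longrightarrow> \<bar>f x\<bar> \<le> 4 * 2 ^ card x"
  shows "bern_exp q bin (\<lambda>x. (f x)\<^sup>2 * of_bool (a \<in> x)) \<le> q a * (64 * exp (12 * real (card I)))"
proof -
  let ?R = "bin - {a}"
  have bin: "bin = insert a ?R" using a by auto
  have "bern_exp q bin (\<lambda>x. (f x)\<^sup>2 * of_bool (a \<in> x)) \<le> bern_exp q bin (\<lambda>x. 16 * (4 ^ card x * of_bool (a \<in> x)))"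
  proof (rule bern_exp_mono[OF q_bin])
    fix x assume x: "x \<subseteq> bin"
    have "(f x)\<^sup>2 \<le> (4 * 2 ^ card x)\<^sup>2" using f[OF x] by (metis abs_ge_zero power2_abs power_mono)
    also have "\<dots> = 16 * 4 ^ card x"
      by (simp add: power2_eq_square power_mult_distrib[symmetric])
    finally show "(f x)\<^sup>2 * of_bool (a \<in> x) \<le> 16 * (4 ^ card x * of_bool (a \<in> x))"
      by (auto simp: of_bool_def)
  qed
  also have "\<dots> = 16 * bern_exp q (insert a ?R) (\<lambda>x. 4 ^ card x * of_bool (a \<in> x))"
    using bin by (simp add: bern_exp_cmult)
  also have "bern_exp q (insert a ?R) (\<lambda>x. 4 ^ card x * of_bool (a \<in> x))
      = q a * bern_exp q ?R (\<lambda>x. 4 * 4 ^ card x)"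
  proof -
    have "bern_exp q ?R (\<lambda>x. 4 ^ card x * of_bool (a \<in> x)) = bern_exp q ?R (\<lambda>x. 0)"
      by (rule bern_exp_cong) auto
    moreover have "bern_exp q ?R (\<lambda>x. 4 ^ card (insert a x) * of_bool (a \<in> insert a x))
        = bern_exp q ?R (\<lambda>x. 4 * 4 ^ card x)"
    proof (rule bern_exp_cong)
      fix x assume "x \<subseteq> ?R"
      moreover from this have "finite x" using finite_subset by fastforce
      ultimately have "card (insert a x) = Suc (card x)" by (subst card_insert_disjoint) auto
      then show "4 ^ card (insert a x) * of_bool (a \<in> insert a x) = (4 * 4 ^ card x :: real)" by simp
    qed
    ultimately show ?thesis by (subst bern_exp_insert) auto
  qed
  also have "bern_exp q ?R (\<lambda>x. 4 * 4 ^ card x) = 4 * (\<Prod>a\<in>?R. 1 + 3 * q a)"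
    by (simp add: bern_exp_cmult bern_exp_power_card)
  also have "(\<Prod>a\<in>?R. 1 + 3 * q a) \<le> exp (12 * real (card I))"
  proof -
    have "(\<Prod>a\<in>?R. 1 + 3 * q a) \<le> (\<Prod>a\<in>?R. exp (3 * q a))"
      using q_bin by (intro prod_mono conjI exp_ge_add_one_self) auto
    also have "\<dots> = exp (3 * sum q ?R)" by (simp add: exp_sum sum_distrib_left)
    also have "sum q ?R \<le> sum q bin" using q_bin by (intro sum_mono2) auto
    also have "sum q bin = (\<Sum>b\<in>I. sum q (C b))"
      unfolding bin_def using finI finC disC
      by (intro sum.UNION_disjoint) (auto simp: disjoint_family_on_def)
    also have "\<dots> \<le> (\<Sum>b\<in>I. 4)" using mass by (intro sum_mono)
    finally show ?thesis by simp
  qed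
  finally show ?thesis using q_bin[OF a] by (simp add: mult_left_mono)
qed

text \<open>Block \<open>b\<close> has fewer than \<open>2 ^ 2 ^ (b + 1)\<close> variables, so its factor, of degree \<open>i - b + 58\<close>, has a coefficient
  sum of at most \<open>exp ((i - b + 58) * 2 ^ (b + 1))\<close>. Adding the exponents over \<open>b < i\<close>, and \<open>2 ^ (i + 1)\<close> for
  \<open>b = i\<close>, gives less than \<open>61 * 2 ^ (i + 1)\<close>, and \<open>64 * 2 ^ (i + 1) = 2 ^ (i + 7)\<close>.\<close>

lemma coeff_bound_scale_weight:
  assumes i: "i \<in> I" and U: "bin \<subseteq> U" and M4: "M \<ge> 4"
    and size: "\<And>b. b \<in> I \<Longrightarrow> card (C b) + 1 \<le> 2 ^ 2 ^ (b + 1)"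
  shows "coeff_bound U (scale_weight q C I M i) (exp (2 ^ (i + 7)))"
proof -
  let ?N = "\<lambda>b. exp (2 ^ (b + 1)) :: real"
  let ?W = "\<lambda>b. if b < i then ?N b ^ (i - b + 58) else if b = i then ?N i else 1"
  have N: "1 + real (card (C b)) \<le> ?N b" if "b \<in> I" for b
  proof -
    have "real (card (C b) + 1) \<le> real (2 ^ 2 ^ (b + 1))" using size[OF that] by (simp only: of_nat_le_iff)
    also have "\<dots> = (2::real) ^ 2 ^ (b + 1)" by simp
    also have "\<dots> \<le> exp 1 ^ 2 ^ (b + 1)" using exp_ge_add_one_self[of "1::real"] by (intro power_mono) auto
    also have "\<dots> = ?N b" by (simp flip: exp_of_nat_mult)
    finally show ?thesis by simp
  qed
  have CU: "C b \<subseteq> U" if "b \<in> I" for b using that U by (auto simp: bin_def)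
  have layer: "coeff_bound U (\<lambda>x. layer q C M i b (card (x \<inter> C b))) (?W b)" if b: "b \<in> I" for b
  proof -
    consider "b < i" | "b = i" | "b > i" by linarith
    then show ?thesis
    proof cases
      case 1
      have "coeff_bound U (\<lambda>x. brun_weight (i - b + 58) (card (x \<inter> C b))) ((1 + real (card (C b))) ^ (i - b + 58))"
        using finC CU b by (intro coeff_bound_brun_weight)
      moreover have "(1 + real (card (C b))) ^ (i - b + 58) \<le> ?N b ^ (i - b + 58)"
        using N[OF b] by (intro power_mono) auto
      ultimately have "coeff_bound U (\<lambda>x. brun_weight (i - b + 58) (card (x \<inter> C b))) (?N b ^ (i - b + 58))"
        by (rule coeff_bound.weaken)
      then show ?thesis using 1 by (simp add: layer_def)
    next
      case 2
      have m0: "0 \<le> sum q (C i)" using q0 i by (intro sum_nonneg) auto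
      have "coeff_bound U (\<lambda>x. real (card (x \<inter> C i) choose 1)) (real (card (C i) choose 1))"
        using finC CU i by (intro coeff_bound_choose_card)
      then have "coeff_bound U (\<lambda>x. real (card (x \<inter> C i)) - sum q (C i)) (real (card (C i)) + \<bar>sum q (C i)\<bar>)"
        by (intro coeff_bound_diff coeff_bound_const) simp
      then have "coeff_bound U (\<lambda>x. (1 / M) * (real (card (x \<inter> C i)) - sum q (C i)))
          (\<bar>1 / M\<bar> * (real (card (C i)) + \<bar>sum q (C i)\<bar>))" by (rule coeff_bound_cmult)
      moreover have "\<bar>1 / M\<bar> * (real (card (C i)) + \<bar>sum q (C i)\<bar>) \<le> ?N i"
      proof -
        have "real (card (C i)) + \<bar>sum q (C i)\<bar> \<le> M * (1 + real (card (C i)))"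
        proof -
          have "1 * real (card (C i)) \<le> M * real (card (C i))" using M1 by (intro mult_right_mono) auto
          then show ?thesis using m0 mass[OF i] M4 by (simp add: algebra_simps)
        qed
        then have "\<bar>1 / M\<bar> * (real (card (C i)) + \<bar>sum q (C i)\<bar>) \<le> 1 + real (card (C i))"
          using M1 by (simp add: field_simps)
        then show ?thesis using N[OF i] by linarith
      qed
      ultimately have "coeff_bound U (\<lambda>x. (1 / M) * (real (card (x \<inter> C i)) - sum q (C i))) (?N i)"
        by (rule coeff_bound.weaken)
      then show ?thesis using 2 by (simp add: layer_def)
    next
      case 3
      then show ?thesis using coeff_bound_const[of U 1] by (simp add: layer_def)
    qed
  qed
  have "coeff_bound U (\<lambda>x. \<Prod>b\<in>I. layer q C M i b (card (x \<inter> C b))) (\<Prod>b\<in>I. ?W b)"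
    using finI layer by (intro coeff_bound_prod)
  moreover have "(\<Prod>b\<in>I. ?W b) \<le> exp (2 ^ (i + 7))"
  proof -
    have W_eq: "?W b = exp (if b < i then real (i - b + 58) * 2 ^ (b + 1) else if b = i then 2 ^ (i + 1) else 0)" for b
      by (simp add: exp_of_nat_mult[symmetric])
    have "(\<Prod>b\<in>I. ?W b) = exp (\<Sum>b\<in>I. if b < i then real (i - b + 58) * 2 ^ (b + 1) else if b = i then 2 ^ (i + 1) else 0)"
      unfolding W_eq using finI by (simp add: exp_sum)
    also have "\<dots> \<le> exp (\<Sum>b\<in>I \<union> {..i}. if b < i then real (i - b + 58) * 2 ^ (b + 1) else if b = i then 2 ^ (i + 1) else 0)"
      unfolding exp_le_cancel_iff using finI by (intro sum_mono2) auto
    also have "(\<Sum>b\<in>I \<union> {..i}. if b < i then real (i - b + 58) * 2 ^ (b + 1) else if b = i then 2 ^ (i + 1) else 0)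
        = (\<Sum>b\<le>i. if b < i then real (i - b + 58) * 2 ^ (b + 1) else if b = i then 2 ^ (i + 1) else 0)"
      using finI by (intro sum.mono_neutral_right) auto
    also have "\<dots> = (\<Sum>b<i. real (i - b + 58) * 2 ^ (b + 1)) + 2 ^ (i + 1)"
      by (simp add: lessThan_Suc_atMost[symmetric])
    also have "(\<Sum>b<i. real (i - b + 58) * 2 ^ (b + 1)) = 60 * 2 ^ (i + 1) - 2 * real i - 120"
    proof (induction i)
      case (Suc i)
      have geo: "(\<Sum>b<i. (2::real) ^ (b + 1)) = 2 ^ (i + 1) - 2"
        by (induction i) auto
      have "(\<Sum>b<Suc i. real (Suc i - b + 58) * 2 ^ (b + 1))
          = (\<Sum>b<i. real (i - b + 58) * 2 ^ (b + 1) + 2 ^ (b + 1)) + 59 * 2 ^ (i + 1)"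
        by (simp add: Suc_diff_le algebra_simps)
      then show ?case using Suc geo by (simp add: sum.distrib)
    qed simp
    finally have "(\<Prod>b\<in>I. ?W b) \<le> exp (60 * 2 ^ (i + 1) - 2 * real i - 120 + 2 ^ (i + 1))" .
    also have "\<dots> \<le> exp (2 ^ (i + 7))"
    proof -
      have "(0::real) \<le> 6 * 2 ^ i" by simp
      then have "- (2 * real i) - 120 \<le> 6 * 2 ^ i" by linarith
      then show ?thesis by (simp add: power_add)
    qed
    finally show ?thesis .
  qed
  ultimately show ?thesis unfolding scale_weight_def[abs_def] by (rule coeff_bound.weaken)
qed

end

section \<open>Hitting all shifts at once\<close>

text \<open>Here \<open>m\<close> bounds the cost of a single choice and \<open>B\<close> is the budget. Assumption \<open>survivors\<close> says that the expected
  number of shifts missed by the blocks below \<open>i\<close> is at most \<open>\<Lambda> / 2 ^ i\<close>, which balances the cost of scale \<open>i\<close>; with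
  \<open>budget\<close> this makes the mean cost of a random pattern at most \<open>B / 20\<close>. Then \<open>tail_small\<close> lets Chernoff's bound
  beat the number of shifts, \<open>double_small\<close> disposes of primes with two hits, and \<open>long\<close> says that the range of \<open>t\<close> is longer
  than the coefficient sum of the test function \<open>F\<close>.\<close>

lemma block_sieve:
  fixes S :: "int set" and Pb :: "nat \<Rightarrow> nat set" and I :: "nat set" and n d :: int
    and B \<Lambda> m J :: real and T :: nat and r :: "nat \<Rightarrow> real"
  assumes J_def: "J = real (card S)" and r_def: "r = (\<lambda>p. 1 / (real p - J + 1))"
    and S: "finite S" "S \<noteq> {}" and I: "finite I" "\<And>b. b \<in> I \<Longrightarrow> finite (Pb b)" "disjoint_family_on Pb I"
    and prime: "\<And>b p. b \<in> I \<Longrightarrow> p \<in> Pb b \<Longrightarrow> prime p"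
    and large: "\<And>b p. b \<in> I \<Longrightarrow> p \<in> Pb b \<Longrightarrow> 2 * card S < p"
    and cop: "\<And>b p. b \<in> I \<Longrightarrow> p \<in> Pb b \<Longrightarrow> coprime d (int p)"
    and distinct: "\<And>b p s s'. b \<in> I \<Longrightarrow> p \<in> Pb b \<Longrightarrow> s \<in> S \<Longrightarrow> s' \<in> S \<Longrightarrow> s \<noteq> s' \<Longrightarrow> \<not> int p dvd s - s'"
    and size: "\<And>b. b \<in> I \<Longrightarrow> card (Pb b) + 1 \<le> 2 ^ 2 ^ (b + 1)"
    and mass: "\<And>b. b \<in> I \<Longrightarrow> sum r (Pb b) \<le> 4"
    and total: "4 \<le> (\<Sum>b\<in>I. sum r (Pb b))"
    and cost_le: "\<And>i. i \<in> I \<Longrightarrow> 2 ^ (i + 7) \<le> m"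
    and survivors: "\<And>i. i \<in> I \<Longrightarrow> J * (\<Prod>b\<in>{b\<in>I. b < i}. \<Prod>p\<in>Pb b. 1 - r p) * 2 ^ i \<le> \<Lambda>"
    and budget: "5120 * \<Lambda> \<le> B * (\<Sum>b\<in>I. sum r (Pb b))"
    and tail_small: "(1 + J) * exp (1 - 9 / 10 * (B / m)) \<le> 1 / 4"
    and double_small: "real (card I + 1) ^ 6 * (64 * exp (12 * real (card I)))\<^sup>2 * J\<^sup>2
      * (\<Sum>p\<in>(\<Union>b\<in>I. Pb b). (r p)\<^sup>2) \<le> 1 / 8"
    and cost_ge: "J * (\<Sum>i\<in>I. exp (- (2 ^ (i + 7)))) \<le> 1"
    and long: "(1 + J) * exp (4 * B + 2) < real T / 2"
  shows "\<exists>t<T. \<forall>s\<in>S. \<exists>p\<in>(\<Union>b\<in>I. Pb b). int p dvd n + d * int t - s"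
proof -
  define P where "P = (\<Union>b\<in>I. Pb b)"
  define q where "q = hit_prob S"
  define C where "C = (\<lambda>(s::int) b. Pb b \<times> {s})"
  define K where "K = (\<lambda>s::int. P \<times> {s})"
  define M where "M = (\<Sum>b\<in>I. sum r (Pb b))"
  define \<psi> where "\<psi> = (\<lambda>s i. scale_weight q (C s) I M i)"
  define e where "e = (\<lambda>i. sum r (Pb i) / M)"
  define c where "c = (\<lambda>i::nat. 2 ^ (i + 7) :: real)"
  have J1: "J \<ge> 1" using S by (simp add: J_def Suc_leI card_gt_0_iff)
  have finP: "finite P" using I by (auto simp: P_def)
  have M4: "M \<ge> 4" using total by (simp add: M_def)
  have r: "0 \<le> r p \<and> r p \<le> 1 / 2" if "p \<in> P" for p
  proof -
    have "2 * card S < p" using that large by (auto simp: P_def)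
    then have "2 * J < real p" unfolding J_def by (metis of_nat_less_iff of_nat_mult of_nat_numeral)
    then have "real p - J + 1 \<ge> 2" using J1 by linarith
    then show ?thesis by (simp add: r_def field_simps)
  qed
  have r_sum: "0 \<le> sum r (Pb b)" if "b \<in> I" for b
  proof (rule sum_nonneg)
    fix p assume "p \<in> Pb b"
    then have "p \<in> P" using that by (auto simp: P_def)
    then show "0 \<le> r p" using r by blast
  qed
  have q_r: "q a = r (fst a)" for a by (simp add: q_def hit_prob_def r_def J_def)
  have sumC: "sum q (C s b) = sum r (Pb b)" for s b
  proof -
    have "C s b = (\<lambda>p. (p, s)) ` Pb b" by (auto simp: C_def)
    then show ?thesis by (simp add: sum.reindex inj_on_def q_r)
  qed
  have prodC: "(\<Prod>a\<in>C s b. 1 - q a) = (\<Prod>p\<in>Pb b. 1 - r p)" for s b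
  proof -
    have "C s b = (\<lambda>p. (p, s)) ` Pb b" by (auto simp: C_def)
    then show ?thesis by (simp add: prod.reindex inj_on_def q_r)
  qed
  have binK: "(\<Union>b\<in>I. C s b) = K s" for s by (auto simp: C_def K_def P_def)
  have blocks: "bin_blocks q (C s) I M" for s
  proof
    show "disjoint_family_on (C s) I" using I(3) by (auto simp: disjoint_family_on_def C_def)
    show "0 \<le> q a \<and> q a \<le> 1 / 2" if "b \<in> I" "a \<in> C s b" for b a
    proof -
      have "fst a \<in> P" using that by (auto simp: C_def P_def)
      then show ?thesis using r by (simp add: q_r)
    qed
    show "sum q (C s b) \<le> 4" if "b \<in> I" for b using mass[OF that] by (simp add: sumC)
    show "finite (C s b)" if "b \<in> I" for b using I(2)[OF that] by (simp add: C_def)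
  qed (use I M4 in auto)
  have bin: "bin_blocks.bin (C s) I = K s" for s
    using bin_blocks.bin_def[OF blocks] binK by simp
  interpret tensor_weights S K q I \<psi> e c
  proof
    show "finite (K s)" for s using finP by (simp add: K_def)
    show "disjoint_family_on K S" by (auto simp: disjoint_family_on_def K_def)
    show "0 \<le> q a \<and> q a \<le> 1" if "a \<in> K s" for a s
      using r[of "fst a"] that by (auto simp: q_r K_def)
    show "bern_exp q (K s) (\<psi> s i) = 0" if "i \<in> I" for s i
      using bin_blocks.scale_weight_mean[OF blocks that] by (simp add: bin \<psi>_def)
    show "bern_exp q (K s) (\<lambda>x. \<psi> s i x * \<psi> s l x) = 0" if "i \<in> I" "l \<in> I" "i \<noteq> l" for s i l
      using bin_blocks.scale_weight_orth[OF blocks that] by (simp add: bin \<psi>_def)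
    show "\<psi> s i {} = - e i" if "i \<in> I" for s i
      using bin_blocks.scale_weight_empty[OF blocks that] by (simp add: e_def \<psi>_def sumC)
    show "0 \<le> e i" if "i \<in> I" for i
      using r_sum[OF that] M4 by (simp add: e_def)
    show "sum e I = 1" using M4 by (simp add: e_def M_def[symmetric] flip: sum_divide_distrib)
  qed (use S I in \<open>auto simp: c_def\<close>)
  have U: "U = P \<times> S" unfolding U_def unfolding K_def by auto
  have card_choices: "card choices = card I + 1"
    unfolding choices_def using I by (subst card_insert_disjoint) (auto simp: card_image)
  define D where "D = (\<Sum>s\<in>S. \<Sum>i\<in>I. w s (Some i) * c i)"
  \<comment> \<open>By \<open>scale_weight_square_le\<close> and \<open>survivors\<close> the mean cost is at most \<open>256 * \<Lambda> / M\<close>, where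
    \<open>256 = 2 * 2 ^ 7\<close>; this is the source of the factor \<open>5120 = 256 * 20\<close> in \<open>budget\<close>.\<close>
  have D: "D \<le> B / 20"
  proof -
    let ?\<Pi> = "\<lambda>i. \<Prod>b\<in>{b\<in>I. b < i}. \<Prod>p\<in>Pb b. 1 - r p"
    have "D \<le> (\<Sum>s\<in>S. \<Sum>i\<in>I. 2 * (sum r (Pb i) / M\<^sup>2) * ?\<Pi> i * c i)"
      unfolding D_def
    proof (intro sum_mono mult_right_mono)
      fix s i assume "s \<in> S" "i \<in> I"
      then show "w s (Some i) \<le> 2 * (sum r (Pb i) / M\<^sup>2) * ?\<Pi> i"
        unfolding w_Some using bin_blocks.scale_weight_square_le[OF blocks, of i s]
        by (simp add: bin \<psi>_def sumC prodC)
    qed (simp add: c_def)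
    also have "\<dots> = (\<Sum>i\<in>I. 256 * (sum r (Pb i) / M\<^sup>2) * (J * ?\<Pi> i * 2 ^ i))"
      by (simp only: sum_constant sum_distrib_left, intro sum.cong refl) (simp add: J_def c_def power_add)
    also have "\<dots> \<le> (\<Sum>i\<in>I. 256 * (sum r (Pb i) / M\<^sup>2) * \<Lambda>)"
      using survivors r_sum by (intro sum_mono mult_left_mono) auto
    also have "\<dots> = (\<Sum>i\<in>I. sum r (Pb i) * (256 * \<Lambda> / M\<^sup>2))" by (intro sum.cong) auto
    also have "\<dots> = M * (256 * \<Lambda> / M\<^sup>2)"
      unfolding sum_distrib_right[symmetric] M_def[symmetric] ..
    also have "\<dots> = 256 * \<Lambda> / M" using M4 by (simp add: power2_eq_square)
    also have "\<dots> \<le> B / 20" using budget M4 by (simp add: M_def[symmetric] field_simps)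
    finally show ?thesis .
  qed
  have I_ne: "I \<noteq> {}" using total by auto
  have m0: "m > 0"
  proof -
    obtain i where "i \<in> I" using I_ne by blast
    moreover have "(0::real) < 2 ^ (i + 7)" by simp
    ultimately show ?thesis using cost_le[of i] by linarith
  qed
  define \<epsilon> where "\<epsilon> = exp (1 - 9 / 10 * (B / m))"
  \<comment> \<open>Chernoff's bound with \<open>\<sigma> = 1 / m\<close>, which makes all \<open>\<sigma> * c i\<close> at most 1.\<close>
  have tails: "(\<Sum>A\<in>patterns. of_bool (cost A > B - m) * (\<Prod>s\<in>S. w s (A s))) \<le> Z * \<epsilon>"
  proof -
    have "(\<Sum>A\<in>patterns. of_bool (cost A > B - m) * (\<Prod>s\<in>S. w s (A s)))
        \<le> Z * exp (2 * (1 / m) * D - (1 / m) * (B - m))"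
      unfolding D_def using m0 cost_le by (intro large_cost_bound) (auto simp: c_def field_simps)
    also have "\<dots> \<le> Z * \<epsilon>"
    proof -
      have "2 * (1 / m) * D - (1 / m) * (B - m) = (2 * D - B) / m + 1" using m0 by (simp add: field_simps)
      also have "\<dots> \<le> (2 * (B / 20) - B) / m + 1"
        using D m0 by (intro add_right_mono divide_right_mono) auto
      also have "\<dots> = 1 - 9 / 10 * (B / m)" by (simp add: field_simps)
      finally show ?thesis unfolding \<epsilon>_def using Z_ge_1 by (intro mult_left_mono) auto
    qed
    finally show ?thesis .
  qed
  have nonneg_w: "0 \<le> (\<Prod>s\<in>S. w s (A s))" for A by (intro prod_nonneg) (auto simp: w_nonneg)
  have cm: "c i \<le> m" if "i \<in> I" for i using cost_le[OF that] by (simp add: c_def)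
  have EQ: "bern_exp q U (\<lambda>x. (Q B x)\<^sup>2) \<ge> Z - Z * \<epsilon>"
  proof -
    have "(\<Sum>A\<in>patterns. of_bool (cost A > B) * (\<Prod>s\<in>S. w s (A s)))
       \<le> (\<Sum>A\<in>patterns. of_bool (cost A > B - m) * (\<Prod>s\<in>S. w s (A s)))"
      using m0 nonneg_w by (intro sum_mono mult_right_mono) auto
    then show ?thesis using tails unfolding Q_second_moment by linarith
  qed
  have Et: "bern_exp q U (\<lambda>x. (tail B s x)\<^sup>2) \<le> Z * \<epsilon>" for s
    using tail_second_moment_le[OF cm, of B s] tails by linarith
  have qU: "\<And>a. a \<in> U \<Longrightarrow> 0 \<le> q a \<and> q a \<le> 1"
    using prob by (auto simp: U_def)
  define G where "G = 64 * exp (12 * real (card I))"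
  \<comment> \<open>The test function is computed under independence, where a prime may hit two shifts \<open>j\<close> and \<open>j'\<close>.\<close>
  have pair: "bern_exp q U (\<lambda>x. (Q B x)\<^sup>2 * (of_bool ((p, j) \<in> x) * of_bool ((p, j') \<in> x)))
      \<le> real (card I + 1) ^ 6 * (r p * G)\<^sup>2 * Z"
    if "p \<in> P" "j \<in> S" "j' \<in> S" "j \<noteq> j'" for p j j'
  proof -
    have mem: "(p, s) \<in> K s" for s using that by (simp add: K_def)
    have "bern_exp q (K s) (\<lambda>x. (\<Psi> s a x)\<^sup>2 * of_bool ((p, s) \<in> x)) \<le> r p * G"
      if a: "a \<in> choices" for s a
    proof -
      have "(p, s) \<in> bin_blocks.bin (C s) I" using \<open>p \<in> P\<close> by (simp add: bin K_def)
      moreover have "\<bar>\<Psi> s a x\<bar> \<le> 4 * 2 ^ card x" if "x \<subseteq> bin_blocks.bin (C s) I" for x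
      proof (cases a)
        case None
        have "(1::real) \<le> 2 ^ card x" by simp
        then have "(1::real) \<le> 4 * 2 ^ card x" by linarith
        then show ?thesis using None by (simp add: \<Psi>_def)
      next
        case (Some i)
        have "finite x" using that bin_blocks.finite_bin[OF blocks] finite_subset by blast
        moreover have "i \<in> I" using Some a by (auto simp: choices_def)
        ultimately have "\<bar>\<psi> s i x\<bar> \<le> 4 * 2 ^ card x"
          using bin_blocks.abs_scale_weight_le[OF blocks, of i x s] by (simp add: \<psi>_def)
        moreover have "\<Psi> s a x = \<psi> s i x" unfolding \<Psi>_def Some by simp
        ultimately show ?thesis by simp
      qed
      ultimately show ?thesis
        using bin_blocks.weighted_scale_weight_le[OF blocks, of "(p, s)" s "\<Psi> s a"]
        by (simp add: bin q_r G_def)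
    qed
    then show ?thesis
      using weighted_second_moment_le[OF that(2,3,4), of "\<lambda>s x. of_bool ((p, s) \<in> x)" "r p * G" B]
      by (simp add: mem card_choices)
  qed
  have double: "bern_exp q U (\<lambda>x. of_bool (\<not> single_hits P S x) * (Q B x)\<^sup>2) \<le> Z / 8"
  proof -
    let ?N = "{(j, j') \<in> S \<times> S. j \<noteq> j'}"
    have finN: "finite ?N" by (rule finite_subset[of _ "S \<times> S"]) (use S in auto)
    have cardN: "real (card ?N) \<le> J\<^sup>2"
    proof -
      have "card ?N \<le> card (S \<times> S)" using S by (intro card_mono) auto
      then have "real (card ?N) \<le> real (card (S \<times> S))" by (simp only: of_nat_le_iff)
      then show ?thesis by (simp add: J_def card_cartesian_product power2_eq_square)
    qed
    have "bern_exp q U (\<lambda>x. of_bool (\<not> single_hits P S x) * (Q B x)\<^sup>2)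
       \<le> bern_exp q U (\<lambda>x. \<Sum>p\<in>P. \<Sum>a\<in>?N. (Q B x)\<^sup>2 * (of_bool ((p, fst a) \<in> x) * of_bool ((p, snd a) \<in> x)))"
    proof (rule bern_exp_mono[OF qU])
      fix x assume x: "x \<subseteq> U"
      let ?f = "\<lambda>p a. (Q B x)\<^sup>2 * (of_bool ((p, fst a) \<in> x) * of_bool ((p, snd a) \<in> x)) :: real"
      have nn: "0 \<le> (\<Sum>p\<in>P. \<Sum>a\<in>?N. ?f p a)" by (intro sum_nonneg) auto
      show "of_bool (\<not> single_hits P S x) * (Q B x)\<^sup>2 \<le> (\<Sum>p\<in>P. \<Sum>a\<in>?N. ?f p a)"
      proof (cases "single_hits P S x")
        case False
        then obtain p where p: "p \<in> P" "\<not> card (x \<inter> {p} \<times> S) \<le> 1" by (auto simp: single_hits_def)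
        moreover have "finite (x \<inter> {p} \<times> S)" using S by auto
        ultimately obtain a b where ab: "a \<in> x \<inter> {p} \<times> S" "b \<in> x \<inter> {p} \<times> S" "a \<noteq> b"
          by (metis card_le_Suc0_iff_eq One_nat_def)
        then have N: "(snd a, snd b) \<in> ?N" by auto
        have "(Q B x)\<^sup>2 = ?f p (snd a, snd b)" using ab by auto
        also have "\<dots> \<le> (\<Sum>a\<in>?N. ?f p a)" by (rule member_le_sum[OF N]) (use finN in auto)
        also have "\<dots> \<le> (\<Sum>p\<in>P. \<Sum>a\<in>?N. ?f p a)"
          by (rule member_le_sum[OF p(1)]) (use finP in \<open>auto intro!: sum_nonneg\<close>)
        finally show ?thesis using False by simp
      qed (use nn in simp)
    qed
    also have "\<dots> = (\<Sum>p\<in>P. \<Sum>a\<in>?N. bern_exp q U (\<lambda>x. (Q B x)\<^sup>2 * (of_bool ((p, fst a) \<in> x) * of_bool ((p, snd a) \<in> x))))"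
      by (simp only: bern_exp_sum)
    also have "\<dots> \<le> (\<Sum>p\<in>P. \<Sum>a\<in>?N. real (card I + 1) ^ 6 * (r p * G)\<^sup>2 * Z)"
      using pair by (intro sum_mono) auto
    also have "\<dots> = real (card ?N) * (real (card I + 1) ^ 6 * G\<^sup>2 * (\<Sum>p\<in>P. (r p)\<^sup>2) * Z)"
      by (simp add: sum_distrib_left sum_distrib_right power_mult_distrib mult_ac)
    also have "\<dots> \<le> J\<^sup>2 * (real (card I + 1) ^ 6 * G\<^sup>2 * (\<Sum>p\<in>P. (r p)\<^sup>2) * Z)"
      using cardN Z_ge_1 by (intro mult_right_mono) (auto intro!: mult_nonneg_nonneg sum_nonneg)
    also have "\<dots> = (real (card I + 1) ^ 6 * G\<^sup>2 * J\<^sup>2 * (\<Sum>p\<in>P. (r p)\<^sup>2)) * Z" by (simp add: mult_ac)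
    also have "\<dots> \<le> 1 / 8 * Z"
      using double_small Z_ge_1 unfolding G_def P_def by (intro mult_right_mono) auto
    finally show ?thesis by simp
  qed
  define F where "F = (\<lambda>x. (Q B x)\<^sup>2 - (\<Sum>s\<in>S. (tail B s x)\<^sup>2))"
  have EF: "1 / 2 \<le> bern_exp q U (\<lambda>x. of_bool (single_hits P S x) * F x)"
  proof -
    have "bern_exp q U (\<lambda>x. ((Q B x)\<^sup>2 - of_bool (\<not> single_hits P S x) * (Q B x)\<^sup>2) - (\<Sum>s\<in>S. (tail B s x)\<^sup>2))
        \<le> bern_exp q U (\<lambda>x. of_bool (single_hits P S x) * F x)"
    proof (rule bern_exp_mono[OF qU])
      fix x
      have "0 \<le> (\<Sum>s\<in>S. (tail B s x)\<^sup>2)" by (intro sum_nonneg) auto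
      then show "(Q B x)\<^sup>2 - of_bool (\<not> single_hits P S x) * (Q B x)\<^sup>2 - (\<Sum>s\<in>S. (tail B s x)\<^sup>2)
          \<le> of_bool (single_hits P S x) * F x"
        by (simp add: F_def)
    qed
    moreover have "bern_exp q U (\<lambda>x. ((Q B x)\<^sup>2 - of_bool (\<not> single_hits P S x) * (Q B x)\<^sup>2) - (\<Sum>s\<in>S. (tail B s x)\<^sup>2))
       = bern_exp q U (\<lambda>x. (Q B x)\<^sup>2) - bern_exp q U (\<lambda>x. of_bool (\<not> single_hits P S x) * (Q B x)\<^sup>2)
         - (\<Sum>s\<in>S. bern_exp q U (\<lambda>x. (tail B s x)\<^sup>2))"
      by (simp only: bern_exp_diff bern_exp_sum)
    moreover have "(\<Sum>s\<in>S. bern_exp q U (\<lambda>x. (tail B s x)\<^sup>2)) \<le> J * (Z * \<epsilon>)"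
      using sum_mono[of S "\<lambda>s. bern_exp q U (\<lambda>x. (tail B s x)\<^sup>2)" "\<lambda>_. Z * \<epsilon>"] Et by (simp add: J_def)
    moreover have "(1 + J) * \<epsilon> * Z \<le> 1 / 4 * Z"
      using tail_small Z_ge_1 unfolding \<epsilon>_def by (intro mult_right_mono) auto
    ultimately show ?thesis using EQ double Z_ge_1 by (simp add: algebra_simps)
  qed
  have cb: "coeff_bound U F ((1 + J) * exp (4 * B + 2))"
  proof -
    have W: "coeff_bound U (\<lambda>x. \<psi> s i (x \<inter> K s)) (exp (c i))" if "s \<in> S" "i \<in> I" for s i
    proof -
      have "C s b \<subseteq> K s" if "b \<in> I" for b using that by (auto simp: C_def K_def P_def)
      then have "\<psi> s i (x \<inter> K s) = \<psi> s i x" for x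
        unfolding \<psi>_def scale_weight_def by (intro prod.cong) (auto simp: Int_assoc Int_absorb1)
      moreover have "coeff_bound U (\<psi> s i) (exp (c i))"
        unfolding \<psi>_def c_def
      proof (rule bin_blocks.coeff_bound_scale_weight[OF blocks that(2) _ M4])
        show "bin_blocks.bin (C s) I \<subseteq> U" using that by (auto simp: bin U_def)
        show "card (C s b) + 1 \<le> 2 ^ 2 ^ (b + 1)" if "b \<in> I" for b
          using size[OF that] by (simp add: C_def card_cartesian_product)
      qed
      ultimately show ?thesis by simp
    qed
    have small: "real (card S) * (\<Sum>i\<in>I. exp (- c i)) \<le> 1" using cost_ge by (simp add: J_def c_def)
    have Qb: "coeff_bound U (Q B) (exp (2 * B + 1))"
      unfolding Q_def[abs_def] by (rule coeff_bound_terms[OF W small]) auto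
    have tb: "coeff_bound U (tail B s) (exp (2 * B + 1))" for s
      unfolding tail_def[abs_def]
    proof (rule coeff_bound_terms[OF W small])
      fix A assume "A \<in> {A\<in>patterns. A s = None}"
      then show "\<bar>\<tau> B A\<bar> \<le> of_bool (cost A \<le> B)" using \<tau>_bounds(1,2)[OF _ cm, of A B] by simp
    qed auto
    have "coeff_bound U F (exp (2 * B + 1) * exp (2 * B + 1) + (\<Sum>s\<in>S. exp (2 * B + 1) * exp (2 * B + 1)))"
      unfolding F_def power2_eq_square using S Qb tb
      by (intro coeff_bound_diff coeff_bound_sum coeff_bound_mult)
    then show ?thesis by (simp add: J_def algebra_simps flip: exp_add)
  qed
  show ?thesis
  proof (rule ccontr)
    assume no: "\<not> ?thesis"
    \<comment> \<open>If \<open>s\<close> is missed, then \<open>Q = tail s\<close>, so the sum subtracted in \<open>F\<close> is at least \<open>Q\<^sup>2\<close>.\<close>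
    have neg: "F (hits P S (n + d * int t)) \<le> 0" if "t < T" for t
    proof -
      have "\<exists>s\<in>S. \<forall>p\<in>P. \<not> int p dvd n + d * int t - s"
        using no that unfolding P_def by blast
      then obtain s where s: "s \<in> S" "\<And>p. p \<in> P \<Longrightarrow> \<not> int p dvd n + d * int t - s" by blast
      let ?x = "hits P S (n + d * int t)"
      have "?x \<inter> K s = {}" using s by (auto simp: hits_def K_def)
      then have "Q B ?x = tail B s ?x" by (rule Q_eq_tail[OF s(1)])
      moreover have "(tail B s ?x)\<^sup>2 \<le> (\<Sum>s\<in>S. (tail B s ?x)\<^sup>2)"
        by (rule member_le_sum[OF s(1)]) (use S in auto)
      ultimately show ?thesis by (simp add: F_def)
    qed
    have kappa: "0 \<le> single_prob P S"
      unfolding single_prob_def U[symmetric] q_def[symmetric]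
      using bern_exp_mono[of U q "\<lambda>_. 0"] qU by simp
    have "\<bar>single_prob P S * (\<Sum>t<T. F (hits P S (n + d * int t)))
     - real T * bern_exp (hit_prob S) (P \<times> S) (\<lambda>x. of_bool (single_hits P S x) * F x)\<bar>
       \<le> (1 + J) * exp (4 * B + 2)"
    proof (rule transfer_to_integers)
      show "card S < p" if "p \<in> P" for p using that large by (fastforce simp: P_def)
      show "coeff_bound (P \<times> S) F ((1 + J) * exp (4 * B + 2))" using cb by (simp add: U)
    qed (use S finP prime cop distinct in \<open>auto simp: P_def\<close>)
    moreover have "single_prob P S * (\<Sum>t<T. F (hits P S (n + d * int t))) \<le> 0"
      using kappa neg by (intro mult_nonneg_nonpos sum_nonpos) auto
    moreover have "real T * (1 / 2) \<le> real T * bern_exp (hit_prob S) (P \<times> S) (\<lambda>x. of_bool (single_hits P S x) * F x)"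
      using EF by (intro mult_left_mono) (auto simp: U q_def)
    ultimately show False using long by linarith
  qed
qed

section \<open>Sifting by prime blocks\<close>

lemma primes_upto_Suc: "primes_upto (2 ^ 2 ^ Suc b) = primes_upto (2 ^ 2 ^ b) \<union> prime_block b"
proof -
  have "(2::nat) ^ 2 ^ b \<le> 2 ^ 2 ^ Suc b" by (intro power_increasing) auto
  from order_trans[OF _ this] show ?thesis
    by (auto simp: primes_upto_def prime_block_def primes_between_def simp del: power_Suc)
qed

lemma finite_prime_block [simp]: "finite (prime_block b)"
  by (simp add: prime_block_def)

lemma prime_blockD:
  assumes "p \<in> prime_block b"
  shows "prime p" "2 ^ 2 ^ b < p" "p \<le> 2 ^ 2 ^ (b + 1)"
  using assms by (auto simp: prime_block_def primes_between_def)

lemma prime_inverse_le_half: "prime p \<Longrightarrow> 0 \<le> 1 / real p \<and> 1 / real p \<le> 1 / 2"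
  using prime_ge_2_nat[of p] by (auto simp: field_simps)

lemma prod_prime_inverse_pos:
  "finite P \<Longrightarrow> (\<And>p. p \<in> P \<Longrightarrow> prime p) \<Longrightarrow> 0 < (\<Prod>p\<in>P. 1 - 1 / real p)"
  by (intro prod_pos) (fastforce dest: prime_gt_1_nat)

lemma prod_primes_upto_le: "(\<Prod>p\<in>primes_upto (2 ^ 2 ^ i). 1 - 1 / real p) \<le> 2 / 2 ^ i"
proof -
  have "ln (2::real) \<ge> 1 / 2"
    using ln_one_minus_pos_upper_bound[of "1/2::real"] by (simp add: ln_div)
  then have "2 ^ i * (1 / 2) \<le> 2 ^ i * ln (2::real)" by (intro mult_left_mono) auto
  also have "\<dots> = ln ((2::real) ^ 2 ^ i)" by (simp add: ln_realpow)
  also have "\<dots> \<le> ln (real (2 ^ 2 ^ i + 1))" by (subst ln_le_cancel_iff) (auto intro: add_pos_pos)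
  finally have l: "2 ^ i / 2 \<le> ln (real (2 ^ 2 ^ i + 1))" by simp
  have "(\<Prod>p\<in>primes_upto (2 ^ 2 ^ i). 1 - 1 / real p) \<le> 1 / ln (real (2 ^ 2 ^ i + 1))"
    by (rule mertens_product_le) simp
  also have "\<dots> \<le> 1 / (2 ^ i / 2)"
  proof (rule divide_left_mono[OF l])
    have "(0::real) < 2 ^ i / 2" by simp
    then show "0 < ln (real (2 ^ 2 ^ i + 1)) * (2 ^ i / 2)" using l by (intro mult_pos_pos) linarith+
  qed simp
  finally show ?thesis by simp
qed

text \<open>Together with \<open>prod_primes_upto_le\<close> this replaces Mertens' theorem: a lower bound per block allows blocks to be dropped
  from the upper bound for the product over all primes at the price of a constant each.\<close>

lemma prod_prime_block_ge: "exp (-4) \<le> (\<Prod>p\<in>prime_block b. 1 - 1 / real p)"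
proof -
  have "exp (-4) \<le> exp (- 2 * (\<Sum>p\<in>prime_block b. 1 / real p))" using prime_block_mass_le[of b] by simp
  also have "\<dots> \<le> (\<Prod>p\<in>prime_block b. 1 - 1 / real p)"
    using prime_inverse_le_half prime_blockD by (intro prod_one_minus_ge_exp) auto
  finally show ?thesis .
qed

lemma prod_primes_upto_split:
  assumes "i \<le> j"
  shows "(\<Prod>p\<in>primes_upto (2 ^ 2 ^ j). 1 - 1 / real p)
    = (\<Prod>p\<in>primes_upto (2 ^ 2 ^ i). 1 - 1 / real p) * (\<Prod>b\<in>{i..<j}. \<Prod>p\<in>prime_block b. 1 - 1 / real p)"
  using assms
proof (induction j rule: dec_induct)
  case (step j)
  have "primes_upto (2 ^ 2 ^ j) \<inter> prime_block j = {}"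
    by (auto simp: primes_upto_def dest: prime_blockD)
  then show ?case using step by (simp add: primes_upto_Suc prod.union_disjoint mult_ac del: power_Suc)
qed simp

lemma prod_primes_upto_ge: "exp (- 4 * real b) / 2 \<le> (\<Prod>p\<in>primes_upto (2 ^ 2 ^ b). 1 - 1 / real p)"
proof -
  have two: "primes_upto 2 = {2}"
    using prime_ge_2_nat by (auto simp: primes_upto_def intro: antisym)
  have "exp (- 4 * real b) = (\<Prod>b\<in>{0..<b}. exp (-4))"
    by (simp add: exp_of_nat_mult[symmetric] mult.commute)
  also have "\<dots> \<le> (\<Prod>b\<in>{0..<b}. \<Prod>p\<in>prime_block b. 1 - 1 / real p)"
    using prod_prime_block_ge by (intro prod_mono) auto
  finally show ?thesis
    using prod_primes_upto_split[of 0 b] by (simp add: two)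
qed

text \<open>Removing the blocks between \<open>a\<close> and \<open>b0\<close> loses a factor \<open>exp 4\<close> each, and removing the primes outside \<open>Pb\<close>, which have small
  total mass, loses at most a factor \<open>exp 1\<close>.\<close>

lemma sifted_product_le:
  assumes ab: "a \<le> b0" "b0 \<le> i" and sub: "\<And>b. Pb b \<subseteq> prime_block b"
    and few: "(\<Sum>b\<in>{b0..<i}. \<Sum>p\<in>prime_block b - Pb b. 1 / real p) \<le> 1 / 2"
  shows "(\<Prod>p\<in>primes_upto (2 ^ 2 ^ a). 1 - 1 / real p) * (\<Prod>b\<in>{b0..<i}. \<Prod>p\<in>Pb b. 1 - 1 / real p)
    \<le> 2 / 2 ^ i * exp (4 * real (b0 - a) + 1)"
proof -
  let ?f = "\<lambda>p. 1 - 1 / real p"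
  let ?X = "(\<Prod>p\<in>primes_upto (2 ^ 2 ^ a). ?f p) * (\<Prod>b\<in>{b0..<i}. \<Prod>p\<in>Pb b. ?f p)"
  let ?Y = "\<Prod>b\<in>{a..<b0}. \<Prod>p\<in>prime_block b. ?f p"
  let ?E = "\<Prod>b\<in>{b0..<i}. \<Prod>p\<in>prime_block b - Pb b. ?f p"
  have pr: "\<And>b p. p \<in> Pb b \<Longrightarrow> prime p" using sub prime_blockD by blast
  have finPb: "\<And>b. finite (Pb b)" using sub finite_subset[OF _ finite_prime_block] by blast
  have split: "(\<Prod>p\<in>prime_block b. ?f p) = (\<Prod>p\<in>Pb b. ?f p) * (\<Prod>p\<in>prime_block b - Pb b. ?f p)" for b
    using prod.subset_diff[OF sub[of b] finite_prime_block, of ?f] by (simp add: mult.commute)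
  have "(\<Prod>p\<in>primes_upto (2 ^ 2 ^ i). ?f p)
      = (\<Prod>p\<in>primes_upto (2 ^ 2 ^ a). ?f p) * (?Y * (\<Prod>b\<in>{b0..<i}. \<Prod>p\<in>prime_block b. ?f p))"
    using prod_primes_upto_split[of a i] ab
    by (simp add: prod.atLeastLessThan_concat)
  also have "\<dots> = ?X * (?Y * ?E)" by (simp add: split prod.distrib mult_ac)
  finally have eq: "?X * (?Y * ?E) \<le> 2 / 2 ^ i" using prod_primes_upto_le[of i] by simp
  have X0: "0 \<le> ?X"
    using pr finPb by (intro mult_nonneg_nonneg prod_nonneg less_imp_le[OF prod_prime_inverse_pos])
      (auto simp: primes_upto_def less_imp_le[OF prod_prime_inverse_pos] field_simps dest: prime_gt_0_nat)
  have Y: "exp (- 4 * real (b0 - a)) \<le> ?Y"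
  proof -
    have "exp (- 4 * real (b0 - a)) = (\<Prod>b\<in>{a..<b0}. exp (-4))"
      by (simp add: exp_of_nat_mult[symmetric] mult.commute)
    also have "\<dots> \<le> ?Y" using prod_prime_block_ge by (intro prod_mono) auto
    finally show ?thesis .
  qed
  have E: "exp (-1) \<le> ?E"
  proof -
    have "exp (-1) \<le> exp (- 2 * (\<Sum>b\<in>{b0..<i}. \<Sum>p\<in>prime_block b - Pb b. 1 / real p))"
      using few by simp
    also have "\<dots> = (\<Prod>b\<in>{b0..<i}. exp (- 2 * (\<Sum>p\<in>prime_block b - Pb b. 1 / real p)))"
      by (simp add: exp_sum[symmetric] sum_distrib_left)
    also have "\<dots> \<le> ?E"
      using prime_inverse_le_half prime_blockD by (intro prod_mono conjI prod_one_minus_ge_exp) auto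
    finally show ?thesis .
  qed
  have "?X * (exp (- 4 * real (b0 - a)) * exp (-1)) \<le> ?X * (?Y * ?E)"
    using X0 Y E by (intro mult_left_mono mult_mono) (auto intro: order_trans[OF exp_ge_zero])
  also have "\<dots> \<le> 2 / 2 ^ i" by (rule eq)
  finally have "?X * exp (- (4 * real (b0 - a) + 1)) \<le> 2 / 2 ^ i" by (simp add: exp_add[symmetric])
  then have "?X * exp (- (4 * real (b0 - a) + 1)) * exp (4 * real (b0 - a) + 1)
      \<le> 2 / 2 ^ i * exp (4 * real (b0 - a) + 1)" by (rule mult_right_mono) simp
  then show ?thesis unfolding mult.assoc[of ?X] exp_add[symmetric] by simp
qed

text \<open>A nonzero difference of two shifts has at most \<open>l + 1\<close> prime factors, since each is at least 2. So few primes are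
  bad, and all of them are large.\<close>

lemma sum_inverse_shared_primes_le:
  fixes S :: "int set"
  assumes S: "finite S" and bound: "\<And>s. s \<in> S \<Longrightarrow> \<bar>s\<bar> \<le> 2 ^ l"
    and E: "finite E" "\<And>p. p \<in> E \<Longrightarrow> prime p" "\<And>p. p \<in> E \<Longrightarrow> 2 ^ y \<le> p"
    and shared: "\<And>p. p \<in> E \<Longrightarrow> \<exists>s\<in>S. \<exists>s'\<in>S. s \<noteq> s' \<and> int p dvd s - s'"
  shows "(\<Sum>p\<in>E. 1 / real p) \<le> (real (card S))\<^sup>2 * real (l + 1) / 2 ^ y"
proof -
  let ?D = "\<lambda>a. {p\<in>E. int p dvd fst a - snd a}"
  let ?N = "{a\<in>S \<times> S. fst a \<noteq> snd a}"
  have finN: "finite ?N" using S by simp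
  have cardD: "card (?D a) \<le> l + 1" if a: "a \<in> ?N" for a
  proof -
    define k where "k = nat \<bar>fst a - snd a\<bar>"
    have "k > 0" using a by (simp add: k_def)
    moreover have "prime p \<and> p dvd k" if "p \<in> ?D a" for p
      using that E by (simp add: k_def nat_dvd_iff flip: int_dvd_int_iff)
    ultimately have "2 ^ card (?D a) \<le> k" using E(1) by (intro card_prime_divisors_le) auto
    also have "k \<le> 2 ^ (l + 1)"
    proof -
      have "\<bar>fst a - snd a\<bar> \<le> 2 ^ l + 2 ^ l" using bound[of "fst a"] bound[of "snd a"] a by auto
      then show ?thesis by (simp add: k_def nat_le_iff)
    qed
    finally show ?thesis by (rule power_le_imp_le_exp[rotated]) simp
  qed
  have "E \<subseteq> (\<Union>a\<in>?N. ?D a)" using shared by fastforce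
  then have "card E \<le> card (\<Union>a\<in>?N. ?D a)" using E finN by (intro card_mono) auto
  also have "\<dots> \<le> (\<Sum>a\<in>?N. card (?D a))" using finN by (rule card_UN_le)
  also have "\<dots> \<le> (\<Sum>a\<in>?N. l + 1)" using cardD by (intro sum_mono)
  also have "\<dots> = card ?N * (l + 1)" by simp
  also have "\<dots> \<le> card (S \<times> S) * (l + 1)" using S by (intro mult_right_mono card_mono) auto
  finally have "card E \<le> card S * card S * (l + 1)" by (simp add: card_cartesian_product)
  then have cE: "real (card E) \<le> real (card S * card S * (l + 1))" by (simp only: of_nat_le_iff)
  have "(\<Sum>p\<in>E. 1 / real p) \<le> (\<Sum>p\<in>E. 1 / 2 ^ y)"
  proof (intro sum_mono divide_left_mono)
    fix p assume "p \<in> E"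
    then have "real (2 ^ y) \<le> real p" using E(3) by (simp only: of_nat_le_iff)
    then show "2 ^ y \<le> real p" by simp
    then show "0 < real p * 2 ^ y" by (smt (verit) zero_less_power mult_pos_pos)
  qed simp
  also have "\<dots> = real (card E) / 2 ^ y" by simp
  also have "\<dots> \<le> real (card S * card S * (l + 1)) / 2 ^ y" using cE by (intro divide_right_mono) auto
  finally show ?thesis by (simp add: power2_eq_square algebra_simps)
qed

section \<open>Choice of the parameters\<close>

lemma prime_block_disjoint: "disjoint_family_on prime_block I"
proof -
  have "prime_block b \<inter> prime_block b' = {}" if "b < b'" for b b'
  proof -
    have "(2::nat) ^ 2 ^ (b + 1) \<le> 2 ^ 2 ^ b'" using that by (intro power_increasing) auto
    then have "\<not> (p \<in> prime_block b \<and> p \<in> prime_block b')" for p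
      using prime_blockD(3)[of p b] prime_blockD(2)[of p b'] by linarith
    then show ?thesis by blast
  qed
  then show ?thesis unfolding disjoint_family_on_def by (metis Int_commute nat_neq_iff)
qed

lemma exp_half_le_two: "exp (1 / 2 :: real) \<le> 2"
  using exp_bound[of "1/2::real"] by (simp add: power2_eq_square)

lemma exp_half_le_power: "exp (real k / 2) \<le> 2 ^ k"
proof -
  have "exp (real k / 2) = exp (1 / 2) ^ k" by (simp add: exp_of_nat_mult[symmetric])
  also have "\<dots> \<le> 2 ^ k" using exp_half_le_two by (intro power_mono) auto
  finally show ?thesis .
qed

lemma two_power_le_exp: "(2::real) ^ k \<le> exp (real k)"
proof -
  have "(2::real) ^ k \<le> exp 1 ^ k" using exp_ge_add_one_self[of "1::real"] by (intro power_mono) auto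
  then show ?thesis by (simp add: exp_of_nat_mult[symmetric])
qed

lemma linear_le_power: "18 * a + 300 \<le> (m::nat)" if "2 ^ a \<le> m" "1000 \<le> m"
proof (cases "a \<le> 10")
  case False
  have "18 * (k + 10) + 300 \<le> (2::nat) ^ (k + 10)" for k
  proof (induction k)
    case (Suc k)
    have "(2::nat) ^ (Suc k + 10) = 2 * 2 ^ (k + 10)" by (simp only: add_Suc power_Suc)
    moreover have "(2::nat) ^ 10 \<le> 2 ^ (k + 10)" by (intro power_increasing) auto
    ultimately show ?case using Suc by simp
  qed simp
  from this[of "a - 10"] False that show ?thesis by simp
qed (use that in linarith)

text \<open>The sieve of small primes goes up to \<open>y = 2 ^ 2 ^ a\<close>, where \<open>2 ^ a\<close> is between \<open>(m - 4) / 2\<close> and \<open>m - 4\<close>: then the primorial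
  \<open>d\<close> of \<open>y\<close> has at most an eighth of the \<open>2 ^ m\<close> available bits. The blocks start at \<open>b0 = a + 8\<close>, so that
  \<open>2 ^ b0 \<ge> 120 * m\<close> and their primes exceed \<open>2 ^ (120 * m)\<close>; the number of shifts and all other losses are only
  exponential in \<open>m\<close> with smaller constants. They stop at \<open>b1 = m - a - 18\<close>, so that the budget
  \<open>B = 2 ^ (m - 6)\<close> exceeds the largest cost \<open>2 ^ (b1 + 6)\<close> by the factor \<open>2 ^ (a + 6) \<ge> 30 * m\<close>, which makes the Chernoff
  bound \<open>exp (1 - 27 * m)\<close> small against \<open>4 ^ m\<close>, a bound for the number of shifts. As \<open>a\<close> is of order \<open>log m\<close>, there remain
  almost \<open>m\<close> blocks.\<close>

lemma shifts_have_small_factors: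
  fixes S :: "int set" and m :: nat
  assumes m: "1000 \<le> m" and S: "finite S" "2 ^ 80 * card S \<le> m * 2 ^ m"
    and bound: "\<And>s. s \<in> S \<Longrightarrow> \<bar>s\<bar> \<le> 2 ^ 2 ^ m"
  shows "\<exists>N. 3 * 2 ^ (2 ^ m - 2) \<le> N \<and> N + 2 ^ m \<le> 2 ^ 2 ^ m
    \<and> (\<forall>s\<in>S. \<exists>p. prime p \<and> p \<le> 2 ^ 2 ^ (m - 4) \<and> int p dvd N - s)"
proof -
  obtain a where a: "2 ^ a \<le> m - 4" "m - 4 < 2 ^ (a + 1)"
  proof -
    have "1 \<le> m - 4" using m by linarith
    then show ?thesis using ex_power_ivl1[of 2 "m - 4"] that by auto
  qed
  have am: "18 * a + 300 \<le> m" using a m by (intro linear_le_power) auto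
  define b0 b1 I where "b0 = a + 8" and "b1 = m - a - 18" and "I = {b0..<b1}"
  have b0_pow: "120 * m \<le> 2 ^ b0"
  proof -
    have "2 ^ b0 = 128 * (2::nat) ^ (a + 1)" by (simp add: b0_def power_add)
    then show ?thesis using a m by linarith
  qed
  define y where "y = (2::nat) ^ 2 ^ a"
  define d where "d = \<Prod>(primes_upto y)"
  have d_le: "d \<le> 2 ^ 2 ^ (m - 3)"
  proof -
    have "4 * d \<le> 2 ^ 2 ^ (2 ^ a + 1)" unfolding d_def y_def by (rule primorial_le)
    also have "\<dots> \<le> 2 ^ 2 ^ (m - 3)" using a m by (intro power_increasing) auto
    finally show ?thesis by simp
  qed
  have small_prime: "\<And>p. p \<in> primes_upto y \<Longrightarrow> prime p" by (simp add: primes_upto_def)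
  have d0: "d > 0" unfolding d_def using small_prime prime_gt_0_nat by (intro prod_pos) auto
  obtain n0 where n0: "real (card {s\<in>S. \<forall>p\<in>primes_upto y. \<not> int p dvd n0 - s})
      \<le> real (card S) * (\<Prod>p\<in>primes_upto y. 1 - 1 / real p)"
    using greedy_sieve[OF finite_primes_upto small_prime S(1)] by blast
  define S0 where "S0 = {s\<in>S. \<forall>p\<in>primes_upto y. \<not> int p dvd n0 - s}"
  define A where "A = (3 * 2 ^ (2 ^ m - 2) :: int)"
  \<comment> \<open>The least integer from \<open>A\<close> on in the residue class chosen by the greedy sieve.\<close>
  define n where "n = A + (n0 - A) mod int d"
  define T where "T = (2::nat) ^ 2 ^ (m - 1)"
  have finS0: "finite S0" using S by (simp add: S0_def)
  have cS: "card S \<le> 2 ^ (2 * m)"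
  proof -
    have "m < 2 ^ m" by (rule less_exp)
    then have "m * 2 ^ m \<le> 2 ^ m * (2::nat) ^ m" by (intro mult_right_mono) auto
    also have "\<dots> = 2 ^ (2 * m)" by (simp add: mult_2 power_add)
    finally have "2 ^ 80 * card S \<le> 2 ^ (2 * m)" using S(2) by (rule order_trans[rotated])
    moreover have "1 * card S \<le> 2 ^ 80 * card S" by (intro mult_right_mono) auto
    ultimately show ?thesis by (simp only: mult_1)
  qed
  have "card S0 \<le> card S" using S by (intro card_mono) (auto simp: S0_def)
  then have cS0: "card S0 \<le> 2 ^ (2 * m)" using cS by linarith
  define J where "J = real (card S0)"
  have J_le: "J \<le> 2 ^ (2 * m)"
    using cS0 unfolding J_def by (metis of_nat_le_iff of_nat_numeral of_nat_power)
  have J_exp1: "1 + J \<le> exp (2 * real m + 1)"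
  proof -
    have "J \<le> exp (2 * real m)" using J_le two_power_le_exp[of "2 * m"] by simp
    moreover have "1 \<le> exp (2 * real m)" by simp
    ultimately have "1 + J \<le> 2 * exp (2 * real m)" by linarith
    also have "\<dots> \<le> exp 1 * exp (2 * real m)"
      using exp_ge_add_one_self[of "1::real"] by (intro mult_right_mono) auto
    finally show ?thesis by (simp add: exp_add mult.commute)
  qed
  have J_exp: "J \<le> exp (2 * real m)" using J_le two_power_le_exp[of "2 * m"] by simp
  have "\<exists>t<T. \<forall>s\<in>S0. \<exists>p. prime p \<and> p \<le> 2 ^ 2 ^ (m - 4) \<and> int p dvd n + int d * int t - s"
  proof (cases "S0 = {}")
    case True
    then show ?thesis by (intro exI[of _ 0]) (simp add: T_def)
  next
    case False
    \<comment> \<open>Primes that divide a difference of two shifts are discarded, so that no prime can hit twice.\<close>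
    define Pb where "Pb = (\<lambda>b. {p\<in>prime_block b. \<forall>s\<in>S0. \<forall>s'\<in>S0. s \<noteq> s' \<longrightarrow> \<not> int p dvd s - s'})"
    have Pb_sub: "Pb b \<subseteq> prime_block b" for b by (auto simp: Pb_def)
    have finPb [simp]: "finite (Pb b)" for b using finite_subset[OF Pb_sub] by simp
    define r where "r = (\<lambda>p. 1 / (real p - J + 1))"
    have J1: "1 \<le> J" using False finS0 by (simp add: J_def Suc_leI card_gt_0_iff)
    have block_large: "2 ^ (120 * m) < p" if "b \<ge> b0" "p \<in> prime_block b" for b p
    proof -
      have "(2::nat) ^ (120 * m) \<le> 2 ^ 2 ^ b0" using b0_pow by (intro power_increasing) auto
      also have "\<dots> \<le> 2 ^ 2 ^ b" using that by (intro power_increasing) auto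
      finally show ?thesis using prime_blockD(2)[OF that(2)] by linarith
    qed
    have p_large: "2 * 2 ^ (2 * m) < p" if "b \<ge> b0" "p \<in> prime_block b" for b p
    proof -
      have "2 * (2::nat) ^ (2 * m) = 2 ^ (2 * m + 1)" by simp
      also have "\<dots> \<le> 2 ^ (120 * m)" using m by (intro power_increasing) auto
      finally show ?thesis using block_large[OF that] by linarith
    qed
    have rp: "1 / real p \<le> r p" "r p \<le> 2 * (1 / real p)" "0 \<le> r p" "r p \<le> 1 / 2"
      if "b \<ge> b0" "p \<in> prime_block b" for b p
    proof -
      have "real (2 * 2 ^ (2 * m)) \<le> real p" using less_imp_le[OF p_large[OF that]] by (simp only: of_nat_le_iff)
      then have "2 * J \<le> real p" using J_le by simp
      then show "1 / real p \<le> r p" "r p \<le> 2 * (1 / real p)" "0 \<le> r p" "r p \<le> 1 / 2"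
        using J1 unfolding r_def by (auto simp: field_simps)
    qed
    \<comment> \<open>The discarded primes exceed \<open>2 ^ (120 * m)\<close>, and there are at most \<open>2 ^ (5 * m + 1)\<close> of them.\<close>
    have few: "(\<Sum>b\<in>{b0..<i}. \<Sum>p\<in>prime_block b - Pb b. 1 / real p) \<le> 1 / 2" for i
    proof -
      let ?E = "\<Union>b\<in>{b0..<i}. prime_block b - Pb b"
      have "(\<Sum>b\<in>{b0..<i}. \<Sum>p\<in>prime_block b - Pb b. 1 / real p) = (\<Sum>p\<in>?E. 1 / real p)"
        using prime_block_disjoint[of UNIV]
        by (intro sum.UNION_disjoint[symmetric]) (auto simp: disjoint_family_on_def)
      also have "\<dots> \<le> (real (card S0))\<^sup>2 * real (2 ^ m + 1) / 2 ^ (120 * m)"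
      proof (rule sum_inverse_shared_primes_le[OF finS0])
        show "\<bar>s\<bar> \<le> 2 ^ 2 ^ m" if "s \<in> S0" for s using bound that by (simp add: S0_def)
        show "2 ^ (120 * m) \<le> p" if "p \<in> ?E" for p using that block_large less_imp_le by fastforce
        show "\<exists>s\<in>S0. \<exists>s'\<in>S0. s \<noteq> s' \<and> int p dvd s - s'" if "p \<in> ?E" for p
          using that by (auto simp: Pb_def)
      qed (auto dest: prime_blockD)
      also have "\<dots> \<le> 2 ^ (5 * m + 1) / 2 ^ (120 * m)"
      proof (intro divide_right_mono)
        have "(real (card S0))\<^sup>2 \<le> (2 ^ (2 * m))\<^sup>2" using J_le J1 unfolding J_def by (intro power_mono) auto
        then have "(real (card S0))\<^sup>2 * real (2 ^ m + 1) \<le> (2 ^ (2 * m))\<^sup>2 * (2 * 2 ^ m)"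
          by (intro mult_mono) auto
        also have "\<dots> = 2 ^ (5 * m + 1)" by (simp add: power2_eq_square flip: power_add)
        finally show "(real (card S0))\<^sup>2 * real (2 ^ m + 1) \<le> 2 ^ (5 * m + 1)" .
      qed simp
      also have "\<dots> \<le> 1 / 2"
      proof -
        have "(2::real) ^ (5 * m + 1) * 2 = 2 ^ (5 * m + 2)" by simp
        also have "\<dots> \<le> 2 ^ (120 * m)" using m by (intro power_increasing) auto
        finally show ?thesis by (simp add: field_simps)
      qed
      finally show ?thesis .
    qed
    have I_b0: "b0 \<le> b" if "b \<in> I" for b using that by (simp add: I_def)
    have PbD: "p \<in> prime_block b" if "p \<in> Pb b" for p b using that Pb_sub by blast
    have mass: "sum r (Pb b) \<le> 4" if "b \<in> I" for b
    proof -
      have "sum r (Pb b) \<le> (\<Sum>p\<in>Pb b. 2 * (1 / real p))"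
        using rp(2)[OF I_b0[OF that] PbD] by (intro sum_mono)
      also have "\<dots> \<le> (\<Sum>p\<in>prime_block b. 2 * (1 / real p))"
        using Pb_sub by (intro sum_mono2) auto
      also have "\<dots> \<le> 2 * 2" using prime_block_mass_le[of b] unfolding sum_distrib_left[symmetric] by simp
      finally show ?thesis by simp
    qed
    define M where "M = (\<Sum>b\<in>I. sum r (Pb b))"
    have prods_le: "(\<Prod>b\<in>{b0..<i}. \<Prod>p\<in>Pb b. 1 - r p) \<le> (\<Prod>b\<in>{b0..<i}. \<Prod>p\<in>Pb b. 1 - 1 / real p)" for i
    proof -
      have "0 \<le> 1 - r p" "1 - r p \<le> 1 - 1 / real p" if "b \<in> {b0..<i}" "p \<in> Pb b" for b p
        using rp(1,4)[of b p] PbD[OF that(2)] that(1) by auto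
      then show ?thesis by (intro prod_mono conjI prod_nonneg) blast+
    qed
    \<comment> \<open>The product of \<open>1 - r p\<close> over the blocks is at least \<open>exp (- 2 * M)\<close>. But together with the primes
      below the blocks it is at most of order \<open>2 ^ - b1\<close>, where \<open>b1\<close> is almost \<open>m\<close>.\<close>
    have M_ge: "real m / 8 \<le> M"
    proof -
      let ?X = "\<Prod>p\<in>primes_upto (2 ^ 2 ^ b0). 1 - 1 / real p"
      let ?Y = "\<Prod>b\<in>{b0..<b1}. \<Prod>p\<in>Pb b. 1 - 1 / real p"
      have b01: "b0 \<le> b1" using am by (simp add: b0_def b1_def)
      have "exp (- 2 * M) = (\<Prod>b\<in>I. exp (- 2 * sum r (Pb b)))"
        by (simp add: M_def I_def exp_sum[symmetric] sum_distrib_left)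
      also have "\<dots> \<le> (\<Prod>b\<in>I. \<Prod>p\<in>Pb b. 1 - r p)"
        using rp(3,4)[OF I_b0 PbD] by (intro prod_mono conjI prod_one_minus_ge_exp) auto
      also have "\<dots> \<le> ?Y" unfolding I_def by (rule prods_le)
      finally have Y: "exp (- 2 * M) \<le> ?Y" .
      have "exp (- 4 * real b0) / 2 * exp (- 2 * M) \<le> ?X * ?Y"
      proof (rule mult_mono[OF prod_primes_upto_ge Y])
        have "0 < ?X" by (rule prod_prime_inverse_pos) (auto simp: primes_upto_def)
        then show "0 \<le> ?X" by simp
      qed simp
      also have "\<dots> \<le> 2 / 2 ^ b1 * exp (4 * real (b0 - b0) + 1)"
        by (rule sifted_product_le[OF order_refl b01 Pb_sub few])
      also have "\<dots> \<le> 2 / exp (real b1 / 2) * exp 1"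
        using exp_half_le_power[of b1] by (intro mult_mono divide_left_mono) auto
      finally have "exp (- 4 * real b0) * exp (- 2 * M) \<le> 4 * exp (1 - real b1 / 2)"
        by (simp add: exp_diff)
      also have "4 \<le> exp (2::real)" using two_power_le_exp[of 2] by simp
      then have "4 * exp (1 - real b1 / 2) \<le> exp 2 * exp (1 - real b1 / 2)" by (intro mult_right_mono) auto
      finally have "exp (- 4 * real b0 - 2 * M) \<le> exp (3 - real b1 / 2)"
        by (simp flip: exp_add)
      then have "- 4 * real b0 - 2 * M \<le> 3 - real b1 / 2" by simp
      moreover have "real b0 = real a + 8" "real b1 = real m - real a - 18"
        using am by (auto simp: b0_def b1_def of_nat_diff)
      moreover have "18 * real a + 300 \<le> real m"
      proof -
        have "real (18 * a + 300) \<le> real m" using am by (simp only: of_nat_le_iff)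
        then show ?thesis by simp
      qed
      ultimately show ?thesis by linarith
    qed
    define X where "X = real (card S)"
    have X: "2 ^ 80 * X \<le> real m * 2 ^ m"
    proof -
      have "real (2 ^ 80 * card S) \<le> real (m * 2 ^ m)" using S(2) by (simp only: of_nat_le_iff)
      then show ?thesis by (simp add: X_def)
    qed
    have two_m: "(2::real) ^ m = 64 * 2 ^ (m - 6)"
    proof -
      have "(2::real) ^ m = 2 ^ (6 + (m - 6))" using m by simp
      then show ?thesis by (simp only: power_add) simp
    qed
    have card_I: "real (card I + 1) \<le> real m" using am by (simp add: I_def b0_def b1_def)
    have "\<exists>t<T. \<forall>s\<in>S0. \<exists>p\<in>(\<Union>b\<in>I. Pb b). int p dvd n + int d * int t - s"
    \<comment> \<open>\<open>\<Lambda> = 2 ^ 54 * X\<close> comes from \<open>sifted_product_le\<close> with \<open>b0 - a = 8\<close>, as \<open>2 * exp 33 \<le> 2 ^ 54\<close>.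
      The factor \<open>2 ^ 80\<close> in the hypothesis on \<open>card S\<close> then leaves room for \<open>5120 * \<Lambda> \<le> B * m / 8\<close>.\<close>
    proof (rule block_sieve[where m = "2 ^ (b1 + 6)" and B = "2 ^ (m - 6)" and \<Lambda> = "2 ^ 54 * X",
          OF J_def r_def])
      show "disjoint_family_on Pb I"
        using prime_block_disjoint[of I] Pb_sub unfolding disjoint_family_on_def by blast
      show "2 * card S0 < p" if b: "b \<in> I" "p \<in> Pb b" for b p
      proof -
        have "2 * card S0 \<le> 2 * 2 ^ (2 * m)" using cS0 by simp
        then show ?thesis using p_large[OF I_b0[OF b(1)] PbD[OF b(2)]] by linarith
      qed
      show "coprime (int d) (int p)" if b: "b \<in> I" "p \<in> Pb b" for b p
      proof -
        have "(2::nat) ^ 2 ^ a \<le> 2 ^ 2 ^ b"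
          using I_b0[OF b(1)] by (intro power_increasing) (auto simp: b0_def)
        then have "y < p" unfolding y_def
          by (rule le_less_trans) (rule prime_blockD(2)[OF PbD[OF b(2)]])
        then have "p \<notin> primes_upto y" by (simp add: primes_upto_def)
        then have "coprime (int p) (int (\<Prod>(primes_upto y)))"
          using prime_blockD(1)[OF PbD[OF b(2)]] small_prime by (intro coprime_prime_prod) auto
        then show ?thesis by (simp add: d_def coprime_commute)
      qed
      show "card (Pb b) + 1 \<le> 2 ^ 2 ^ (b + 1)" if "b \<in> I" for b
      proof -
        have "Pb b \<subseteq> {2..2 ^ 2 ^ (b + 1)}"
          using PbD prime_blockD prime_ge_2_nat by fastforce
        then have "card (Pb b) \<le> card {2..(2::nat) ^ 2 ^ (b + 1)}" by (intro card_mono) auto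
        moreover have "(1::nat) \<le> 2 ^ 2 ^ (b + 1)" by simp
        ultimately show ?thesis unfolding card_atLeastAtMost by linarith
      qed
      show "4 \<le> (\<Sum>b\<in>I. sum r (Pb b))" using M_ge m by (simp add: M_def)
      show "2 ^ (i + 7) \<le> (2::real) ^ (b1 + 6)" if "i \<in> I" for i
        using that by (intro power_increasing) (auto simp: I_def)
      show "J * (\<Prod>b\<in>{b\<in>I. b < i}. \<Prod>p\<in>Pb b. 1 - r p) * 2 ^ i \<le> 2 ^ 54 * X" if i: "i \<in> I" for i
      proof -
        let ?s = "\<Prod>p\<in>primes_upto y. 1 - 1 / real p"
        let ?W = "\<Prod>b\<in>{b0..<i}. \<Prod>p\<in>Pb b. 1 - r p"
        let ?W' = "\<Prod>b\<in>{b0..<i}. \<Prod>p\<in>Pb b. 1 - 1 / real p"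
        have eq: "{b\<in>I. b < i} = {b0..<i}" using i by (auto simp: I_def)
        have X0: "0 \<le> X" by (simp add: X_def)
        have "J \<le> X * ?s" using n0 by (simp add: J_def X_def S0_def)
        moreover have "?W \<le> ?W'" by (rule prods_le)
        moreover have "0 \<le> ?W"
        proof (intro prod_nonneg)
          fix b p assume "b \<in> {b0..<i}" "p \<in> Pb b"
          then show "0 \<le> 1 - r p" using rp(4)[of b p] PbD by fastforce
        qed
        ultimately have "J * ?W \<le> (X * ?s) * ?W'"
          using J1 by (intro mult_mono) auto
        also have "\<dots> = X * (?s * ?W')" by simp
        also have "\<dots> \<le> X * (2 / 2 ^ i * exp (4 * real (b0 - a) + 1))"
          unfolding y_def using i X0
          by (intro mult_left_mono sifted_product_le Pb_sub few) (auto simp: b0_def I_def)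
        also have "\<dots> \<le> X * (2 / 2 ^ i * 2 ^ 53)"
        proof (intro mult_left_mono)
          have "exp (33::real) = exp 1 ^ 33" by (simp flip: exp_of_nat_mult)
          also have "\<dots> \<le> 3 ^ 33" using exp_le by (intro power_mono) auto
          also have "\<dots> \<le> (2::real) ^ 53" by simp
          finally show "exp (4 * real (b0 - a) + 1) \<le> (2::real) ^ 53" by (simp add: b0_def)
        qed (use X0 in auto)
        finally have "J * ?W * 2 ^ i \<le> X * (2 / 2 ^ i * 2 ^ 53) * 2 ^ i"
          by (intro mult_right_mono) auto
        then show ?thesis unfolding eq by simp
      qed
      show "5120 * (2 ^ 54 * X) \<le> 2 ^ (m - 6) * (\<Sum>b\<in>I. sum r (Pb b))"
      proof -
        define v where "v = real m * 2 ^ (m - 6)"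
        have "2 ^ 80 * X \<le> 64 * v" using X unfolding two_m v_def by simp
        moreover have "v / 8 \<le> 2 ^ (m - 6) * M"
        proof -
          have "2 ^ (m - 6) * (real m / 8) \<le> 2 ^ (m - 6) * M" using M_ge by (intro mult_left_mono) auto
          then show ?thesis by (simp add: v_def mult.commute)
        qed
        moreover have "0 \<le> v" by (simp add: v_def)
        ultimately have "5120 * (2 ^ 54 * X) \<le> 2 ^ (m - 6) * M" by simp
        then show ?thesis by (simp only: M_def)
      qed
      show "(1 + J) * exp (1 - 9 / 10 * (2 ^ (m - 6) / 2 ^ (b1 + 6))) \<le> 1 / 4"
      proof -
        have "(2::real) ^ (m - 6) = 2 ^ ((b1 + 6) + (a + 6))"
          using am by (intro arg_cong[of _ _ "\<lambda>k. 2 ^ k"]) (simp add: b1_def)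
        then have ratio: "2 ^ (m - 6) / 2 ^ (b1 + 6) = (2::real) ^ (a + 6)"
          by (simp only: power_add) simp
        have "30 * m \<le> 2 ^ (a + 6)"
        proof -
          have "(2::nat) ^ (a + 6) = 32 * 2 ^ (a + 1)" by (simp add: power_add)
          then show ?thesis using a(2) m by linarith
        qed
        then have "real (30 * m) \<le> real (2 ^ (a + 6))" by (simp only: of_nat_le_iff)
        then have "exp (1 - 9 / 10 * 2 ^ (a + 6)) \<le> exp (1 - 27 * real m)" by simp
        then have "(1 + J) * exp (1 - 9 / 10 * 2 ^ (a + 6)) \<le> exp (2 * real m + 1) * exp (1 - 27 * real m)"
          using J_exp1 J1 by (intro mult_mono) auto
        also have "\<dots> = exp (2 - 25 * real m)" by (simp flip: exp_add)
        also have "\<dots> \<le> exp (- 2)" using m by simp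
        also have "\<dots> \<le> 1 / 4" using two_power_le_exp[of 2] by (simp add: exp_minus field_simps)
        finally show ?thesis unfolding ratio .
      qed
      show "real (card I + 1) ^ 6 * (64 * exp (12 * real (card I)))\<^sup>2 * J\<^sup>2 * (\<Sum>p\<in>(\<Union>b\<in>I. Pb b). (r p)\<^sup>2) \<le> 1 / 8"
      proof -
        have "real (card I + 1) \<le> exp (real m)" using card_I exp_ge_add_one_self[of "real m"] by linarith
        then have "real (card I + 1) ^ 6 \<le> exp (real m) ^ 6" by (intro power_mono) auto
        then have c1: "real (card I + 1) ^ 6 \<le> exp (6 * real m)" by (simp add: exp_of_nat_mult[symmetric])
        have "64 * exp (12 * real (card I)) \<le> exp 6 * exp (12 * real m)"
          using card_I two_power_le_exp[of 6] by (intro mult_mono) auto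
        then have "(64 * exp (12 * real (card I)))\<^sup>2 \<le> (exp 6 * exp (12 * real m))\<^sup>2" by (intro power_mono) auto
        then have c2: "(64 * exp (12 * real (card I)))\<^sup>2 \<le> exp (12 + 24 * real m)"
          by (simp add: power2_eq_square flip: exp_add)
        have "J\<^sup>2 \<le> (exp (2 * real m))\<^sup>2" using J_exp J1 by (intro power_mono) auto
        then have c3: "J\<^sup>2 \<le> exp (4 * real m)" by (simp add: power2_eq_square flip: exp_add)
        have "(\<Sum>p\<in>(\<Union>b\<in>I. Pb b). (r p)\<^sup>2) \<le> (\<Sum>p\<in>(\<Union>b\<in>I. Pb b). 4 * (1 / (real p)\<^sup>2))"
        proof (rule sum_mono)
          fix p assume "p \<in> (\<Union>b\<in>I. Pb b)"
          then obtain b where b: "b0 \<le> b" "p \<in> prime_block b" using I_b0 PbD by blast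
          have "(r p)\<^sup>2 \<le> (2 * (1 / real p))\<^sup>2" using rp[OF b] by (intro power_mono) auto
          then show "(r p)\<^sup>2 \<le> 4 * (1 / (real p)\<^sup>2)" by (simp add: power2_eq_square)
        qed
        also have "\<dots> = 4 * (\<Sum>p\<in>(\<Union>b\<in>I. Pb b). 1 / (real p)\<^sup>2)" by (simp add: sum_distrib_left)
        also have "\<dots> \<le> 4 * (1 / real (2 ^ (120 * m)))"
        proof (intro mult_left_mono sum_inverse_squares_le)
          show "2 ^ (120 * m) < p" if "p \<in> (\<Union>b\<in>I. Pb b)" for p
            using that block_large I_b0 PbD by blast
        qed (auto simp: I_def)
        also have "\<dots> \<le> exp 2 * (1 / exp (60 * real m))"
          using two_power_le_exp[of 2] exp_half_le_power[of "120 * m"]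
          by (intro mult_mono divide_left_mono) auto
        finally have c4: "(\<Sum>p\<in>(\<Union>b\<in>I. Pb b). (r p)\<^sup>2) \<le> exp (2 - 60 * real m)" by (simp add: exp_diff)
        have "real (card I + 1) ^ 6 * (64 * exp (12 * real (card I)))\<^sup>2 * J\<^sup>2 * (\<Sum>p\<in>(\<Union>b\<in>I. Pb b). (r p)\<^sup>2)
          \<le> exp (6 * real m) * exp (12 + 24 * real m) * exp (4 * real m) * exp (2 - 60 * real m)"
          by (intro mult_mono c1 c2 c3 c4) (auto intro!: mult_nonneg_nonneg sum_nonneg)
        also have "\<dots> = exp (14 - 26 * real m)" by (simp flip: exp_add)
        also have "\<dots> \<le> exp (- 3)" using m by simp
        also have "\<dots> \<le> 1 / 8" using two_power_le_exp[of 3] by (simp add: exp_minus field_simps)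
        finally show ?thesis .
      qed
      show "J * (\<Sum>i\<in>I. exp (- (2 ^ (i + 7)))) \<le> 1"
      proof -
        have each: "exp (- (2 ^ (i + 7))) \<le> exp (- (120 * real m))" if "i \<in> I" for i
        proof -
          have "(2::nat) ^ b0 \<le> 2 ^ (i + 7)" using I_b0[OF that] by (intro power_increasing) auto
          then have "120 * m \<le> 2 ^ (i + 7)" using b0_pow by linarith
          then have "real (120 * m) \<le> real (2 ^ (i + 7))" by (simp only: of_nat_le_iff)
          then show ?thesis by simp
        qed
        have "J * (\<Sum>i\<in>I. exp (- (2 ^ (i + 7)))) \<le> exp (2 * real m) * (\<Sum>i\<in>I. exp (- (120 * real m)))"
          using each J_exp J1 by (intro mult_mono sum_mono) (auto intro!: sum_nonneg)
        also have "\<dots> \<le> exp (2 * real m) * (exp (real m) * exp (- (120 * real m)))"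
        proof -
          have "real (card I) \<le> exp (real m)" using card_I exp_ge_add_one_self[of "real m"] by linarith
          then show ?thesis by (simp add: mult_right_mono)
        qed
        also have "\<dots> = exp (- 117 * real m)" by (simp flip: exp_add)
        also have "\<dots> \<le> 1" by simp
        finally show ?thesis .
      qed
      show "(1 + J) * exp (4 * 2 ^ (m - 6) + 2) < real T / 2"
      proof -
        define u where "u = (2::real) ^ (m - 6)"
        have um: "real m \<le> u + 6"
        proof -
          have "m - 6 < 2 ^ (m - 6)" by (rule less_exp)
          then have "m \<le> 2 ^ (m - 6) + 6" by linarith
          then have "real m \<le> real (2 ^ (m - 6) + 6)" by (simp only: of_nat_le_iff)
          then show ?thesis by (simp add: u_def)
        qed
        have "real (2 ^ (m - 1)) = 32 * u"
        proof -
          have "(2::real) ^ (m - 1) = 2 ^ (5 + (m - 6))" using m by (intro arg_cong[of _ _ "\<lambda>k. 2 ^ k"]) simp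
          then show ?thesis unfolding u_def by (simp only: power_add) simp
        qed
        then have T: "exp (16 * u) \<le> real T" using exp_half_le_power[of "2 ^ (m - 1)"] by (simp add: T_def)
        have "(1 + J) * exp (4 * 2 ^ (m - 6) + 2) \<le> exp (2 * real m + 1) * exp (4 * u + 2)"
          unfolding u_def using J_exp1 by (intro mult_right_mono) auto
        also have "\<dots> = exp (2 * real m + 4 * u + 3)" by (simp flip: exp_add)
        also have "\<dots> < exp (16 * u - 1)" using um m by simp
        also have "\<dots> = exp (16 * u) / exp 1" by (simp add: exp_diff)
        also have "\<dots> \<le> real T / 2"
          using T exp_ge_add_one_self[of "1::real"] by (intro frac_le) auto
        finally show ?thesis .
      qed
    qed (use finS0 False mass in \<open>auto simp: I_def Pb_def dest: prime_blockD\<close>)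
    then obtain t where t: "t < T" "\<And>s. s \<in> S0 \<Longrightarrow> \<exists>p\<in>(\<Union>b\<in>I. Pb b). int p dvd n + int d * int t - s"
      by blast
    have "\<exists>p. prime p \<and> p \<le> 2 ^ 2 ^ (m - 4) \<and> int p dvd n + int d * int t - s" if s: "s \<in> S0" for s
    proof -
      obtain b p where p: "b \<in> I" "p \<in> prime_block b" "int p dvd n + int d * int t - s"
        using t(2)[OF s] PbD by blast
      have "(2::nat) ^ 2 ^ (b + 1) \<le> 2 ^ 2 ^ (m - 4)"
        using p(1) am by (intro power_increasing) (auto simp: I_def b1_def)
      with prime_blockD(3)[OF p(2)] have "p \<le> 2 ^ 2 ^ (m - 4)" by (rule order_trans)
      then show ?thesis using p(3) prime_blockD(1)[OF p(2)] by blast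
    qed
    then show ?thesis using t(1) by blast
  qed
  then obtain t where t: "t < T"
    "\<And>s. s \<in> S0 \<Longrightarrow> \<exists>p. prime p \<and> p \<le> 2 ^ 2 ^ (m - 4) \<and> int p dvd n + int d * int t - s" by blast
  let ?N = "n + int d * int t"
  have "\<exists>p. prime p \<and> p \<le> 2 ^ 2 ^ (m - 4) \<and> int p dvd ?N - s" if s: "s \<in> S" for s
  proof (cases "s \<in> S0")
    case False
    then obtain p where p: "p \<in> primes_upto y" "int p dvd n0 - s" using s by (auto simp: S0_def)
    have pd: "int p dvd int d" unfolding d_def
      using dvd_prodI[OF finite_primes_upto p(1), of "\<lambda>x. x"] by (simp only: int_dvd_int_iff)
    have "int d dvd n - n0"
      unfolding n_def by (metis (no_types, lifting) add_diff_eq diff_diff_eq2 dvd_minus_mod dvd_diff_commute add.commute diff_add_eq)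
    then have "int p dvd (n - n0) + int d * int t" using pd by (meson dvd_add dvd_mult2 dvd_trans)
    then have "int p dvd ((n - n0) + int d * int t) + (n0 - s)" using p(2) by (rule dvd_add)
    moreover have "p \<le> 2 ^ 2 ^ (m - 4)"
    proof -
      have "p \<le> y" using p by (simp add: primes_upto_def)
      also have "y \<le> 2 ^ 2 ^ (m - 4)" unfolding y_def using am by (intro power_increasing) auto
      finally show ?thesis .
    qed
    ultimately show ?thesis using p small_prime by (intro exI[of _ p]) (auto simp: algebra_simps)
  qed (use t in blast)
  moreover have "A \<le> ?N"
  proof -
    have "0 \<le> (n0 - A) mod int d" using d0 by (intro pos_mod_sign) simp
    then show ?thesis using d0 by (simp add: n_def)
  qed
  moreover have "?N + 2 ^ m \<le> 2 ^ 2 ^ m"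
  proof -
    define u where "u = (2::nat) ^ (m - 3)"
    have L: "(2::nat) ^ m = 8 * u"
    proof -
      have "(2::nat) ^ m = 2 ^ (3 + (m - 3))" using m by simp
      then show ?thesis unfolding u_def by (simp only: power_add) simp
    qed
    have um: "m < u + 3" using less_exp[of "m - 3"] unfolding u_def by linarith
    have T: "T = 2 ^ (4 * u)"
    proof -
      have "(2::nat) ^ (m - 1) = 2 ^ (2 + (m - 3))" using m by (intro arg_cong[of _ _ "\<lambda>k. 2 ^ k"]) simp
      then show ?thesis unfolding T_def u_def by (simp only: power_add) simp
    qed
    have "(n0 - A) mod int d < int d" using d0 by simp
    moreover have "int d * int t \<le> int d * (int T - 1)" using t(1) d0 by (intro mult_left_mono) auto
    ultimately have "?N \<le> A + int d * int T" by (simp add: n_def algebra_simps)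
    also have "int d * int T \<le> 2 ^ (8 * u - 3)"
    proof -
      have "d * T \<le> 2 ^ u * 2 ^ (4 * u)" using d_le unfolding T u_def[symmetric] by (intro mult_right_mono) auto
      also have "\<dots> = 2 ^ (5 * u)" by (simp flip: power_add)
      also have "\<dots> \<le> 2 ^ (8 * u - 3)" using um m by (intro power_increasing) auto
      finally have "int (d * T) \<le> int (2 ^ (8 * u - 3))" by (simp only: of_nat_le_iff)
      then show ?thesis by simp
    qed
    finally have "?N \<le> A + 2 ^ (8 * u - 3)" by simp
    moreover have "(2::int) ^ m \<le> 2 ^ (8 * u - 3)" using um m by (intro power_increasing) auto
    moreover have "A = 6 * 2 ^ (8 * u - 3)"
    proof -
      have "8 * u - 2 = Suc (8 * u - 3)" using um m by simp
      then show ?thesis unfolding A_def L by simp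
    qed
    moreover have "(2::int) ^ (8 * u) = 8 * 2 ^ (8 * u - 3)"
    proof -
      have "(2::int) ^ (8 * u) = 2 ^ (3 + (8 * u - 3))" using um m by simp
      then show ?thesis by (simp only: power_add) simp
    qed
    ultimately show ?thesis unfolding L by linarith
  qed
  ultimately show ?thesis unfolding A_def by blast
qed

section \<open>Long gaps\<close>

text \<open>A representation \<open>N + i = p + 2 ^ n\<close> inside the gap would make the prime \<open>p = N - (2 ^ n - i)\<close> have a prime factor
  \<open>l \<le> 2 ^ 2 ^ (m - 4)\<close>. So \<open>p = l\<close>, which contradicts \<open>p > 2 ^ (2 ^ m - 2)\<close>; the latter holds since \<open>N\<close> is at least
  three quarters of \<open>2 ^ 2 ^ m\<close> and \<open>2 ^ n\<close> at most half of it.\<close>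

lemma long_gap_exists:
  "\<exists>X0>0::real. \<forall>X\<ge>X0. \<exists>N H. real (N + H) \<le> X \<and> {N + 1..N + H} \<inter> prime_plus_pow2 = {}
     \<and> ln (ln X) \<le> 2 ^ 80 * (real H + 1)"
proof -
  define m0 where "m0 = (1000::nat)"
  have "\<exists>N H. real (N + H) \<le> X \<and> {N + 1..N + H} \<inter> prime_plus_pow2 = {}
     \<and> ln (ln X) \<le> 2 ^ 80 * (real H + 1)" if X: "X \<ge> 2 ^ 2 ^ m0" for X :: real
  proof -
    obtain j :: nat where "X < 2 ^ j" using real_arch_pow[of 2 X] by auto
    moreover have "(2::real) ^ j \<le> 2 ^ 2 ^ j" using less_exp[of j] by (intro power_increasing) auto
    ultimately have ex: "X < 2 ^ 2 ^ j" by linarith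
    \<comment> \<open>\<open>m = k - 1\<close> is the largest exponent with \<open>2 ^ 2 ^ m \<le> X\<close>.\<close>
    define k where "k = (LEAST j. X < 2 ^ 2 ^ j)"
    have k: "X < 2 ^ 2 ^ k" unfolding k_def by (rule LeastI, rule ex)
    have "m0 < k"
    proof (rule ccontr)
      assume "\<not> m0 < k"
      then have "(2::real) ^ 2 ^ k \<le> 2 ^ 2 ^ m0" by (intro power_increasing) auto
      then show False using k X by linarith
    qed
    then obtain m where m: "k = Suc m" "m0 \<le> m" by (cases k) auto
    have "\<not> X < 2 ^ 2 ^ m" using not_less_Least[of m "\<lambda>j. X < 2 ^ 2 ^ j"] m(1) by (simp add: k_def)
    then have Xm: "2 ^ 2 ^ m \<le> X" by simp
    have m1000: "1000 \<le> m" using m(2) by (simp add: m0_def)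
    define H where "H = m div 2 ^ 80"
    define S where "S = (\<lambda>(i, n). 2 ^ n - int i) ` ({1..H} \<times> {1..<2 ^ m})"
    have H_le: "H \<le> m" by (simp add: H_def)
    have m_lt: "m < 2 ^ m" by (rule less_exp)
    have "\<exists>N. 3 * 2 ^ (2 ^ m - 2) \<le> N \<and> N + 2 ^ m \<le> 2 ^ 2 ^ m
      \<and> (\<forall>s\<in>S. \<exists>p. prime p \<and> p \<le> 2 ^ 2 ^ (m - 4) \<and> int p dvd N - s)"
    proof (rule shifts_have_small_factors[OF m1000])
      show "finite S" by (simp add: S_def)
      have "card S \<le> card ({1..H} \<times> {1..<(2::nat) ^ m})" unfolding S_def by (rule card_image_le) simp
      also have "\<dots> \<le> H * 2 ^ m" by (simp add: card_cartesian_product)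
      finally have "2 ^ 80 * card S \<le> 2 ^ 80 * (H * 2 ^ m)" by (rule mult_left_mono) simp
      also have "\<dots> = (2 ^ 80 * H) * 2 ^ m" by (rule mult.assoc[symmetric])
      also have "\<dots> \<le> m * 2 ^ m" unfolding H_def by (intro mult_right_mono) (rule times_div_less_eq_dividend, simp)
      finally show "2 ^ 80 * card S \<le> m * 2 ^ m" .
      show "\<bar>s\<bar> \<le> 2 ^ 2 ^ m" if "s \<in> S" for s
      proof -
        obtain v where "v \<in> {1..H} \<times> {1..<2 ^ m}" "s = (\<lambda>(i, n). 2 ^ n - int i) v"
          using \<open>s \<in> S\<close> unfolding S_def by blast
        then obtain i n where s: "s = 2 ^ n - int i" "i \<le> H" "n \<le> 2 ^ m" by (cases v) simp
        have "(2::int) ^ n \<le> 2 ^ 2 ^ m" using s by (intro power_increasing) auto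
        moreover have "i < 2 ^ 2 ^ m" using less_exp[of "2 ^ m"] m_lt H_le s(2) by linarith
        then have "int i < int (2 ^ 2 ^ m)" by (simp only: of_nat_less_iff)
        then have "int i < 2 ^ 2 ^ m" by simp
        moreover have "(0::int) \<le> 2 ^ n" by simp
        ultimately show ?thesis unfolding s(1) by linarith
      qed
    qed
    then obtain N where N: "3 * 2 ^ (2 ^ m - 2) \<le> N" "N + 2 ^ m \<le> 2 ^ 2 ^ m"
      "\<And>s. s \<in> S \<Longrightarrow> \<exists>p. prime p \<and> p \<le> 2 ^ 2 ^ (m - 4) \<and> int p dvd N - s" by blast
    have N0: "0 \<le> N" using N(1) by (smt (verit) zero_le_power)
    have H_lt: "int H < 2 ^ m"
    proof -
      have "H < 2 ^ m" using H_le m_lt by linarith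
      then have "int H < int (2 ^ m)" by (simp only: of_nat_less_iff)
      then show ?thesis by simp
    qed
    have top: "N + int H \<le> 2 ^ 2 ^ m" using N(2) H_lt by linarith
    have "real (nat N + H) \<le> X"
    proof -
      have "real (nat N + H) = real_of_int (N + int H)" using N0 by simp
      also have "\<dots> \<le> real_of_int (2 ^ 2 ^ m)" using top by (simp only: of_int_le_iff)
      also have "\<dots> \<le> X" using Xm by simp
      finally show ?thesis .
    qed
    moreover have "{nat N + 1..nat N + H} \<inter> prime_plus_pow2 = {}"
    proof (rule ccontr)
      assume "\<not> ?thesis"
      then obtain x where "x \<in> {nat N + 1..nat N + H}" "x \<in> prime_plus_pow2" by blast
      then obtain p n where x: "nat N + 1 \<le> x" "x \<le> nat N + H" "x = p + 2 ^ n" "prime p" "1 \<le> n"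
        unfolding prime_plus_pow2_def atLeastAtMost_iff by blast
      define i where "i = x - nat N"
      have i: "1 \<le> i" "i \<le> H" "int x = N + int i" using x N0 by (auto simp: i_def)
      have p0: "0 < p" using x(4) by (rule prime_gt_0_nat)
      have sum: "N + int i = int p + 2 ^ n" using x(3) i(3) by simp
      have "(2::int) ^ n < 2 ^ 2 ^ m" using sum top i(2) p0 by linarith
      then have n: "n < 2 ^ m" by (rule power_less_imp_less_exp[rotated]) simp
      then have "2 ^ n - int i \<in> S" using i x(5) by (auto simp: S_def)
      then obtain l where l: "prime l" "l \<le> 2 ^ 2 ^ (m - 4)" "int l dvd N - (2 ^ n - int i)" using N(3) by blast
      have "N - (2 ^ n - int i) = int p" using sum by simp
      then have "l dvd p" using l(3) by simp
      then have lp: "l = p" using l(1) x(4) by (simp add: primes_dvd_imp_eq)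
      have four: "4 \<le> (2::nat) ^ m"
      proof -
        have "(2::nat) ^ 2 \<le> 2 ^ m" using m1000 by (intro power_increasing) auto
        then show ?thesis by simp
      qed
      have "(2::int) ^ n \<le> 2 ^ (2 ^ m - 1)" using n by (intro power_increasing) auto
      also have "2 ^ m - 1 = Suc (2 ^ m - 2)" using four by simp
      finally have "(2::int) ^ n \<le> 2 * 2 ^ (2 ^ m - 2)" by simp
      then have "2 ^ (2 ^ m - 2) < int p" using sum N(1) i(1) by linarith
      moreover have "(2::int) ^ 2 ^ (m - 4) \<le> 2 ^ (2 ^ m - 2)"
      proof -
        have "(2::nat) ^ m = 2 ^ (4 + (m - 4))" using m1000 by simp
        then have "(2::nat) ^ m = 16 * 2 ^ (m - 4)" by (simp only: power_add) simp
        moreover have "(1::nat) \<le> 2 ^ (m - 4)" by simp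
        ultimately show ?thesis by (intro power_increasing) linarith+
      qed
      moreover have "int p \<le> 2 ^ 2 ^ (m - 4)"
      proof -
        have "int p \<le> int (2 ^ 2 ^ (m - 4))" using l(2) unfolding lp by (simp only: of_nat_le_iff)
        then show ?thesis by simp
      qed
      ultimately show False by linarith
    qed
    moreover have "ln (ln X) \<le> 2 ^ 80 * (real H + 1)"
    proof -
      have X2: "2 \<le> X"
      proof -
        have "(2::real) ^ 1 \<le> 2 ^ 2 ^ m" by (intro power_increasing) auto
        then show ?thesis using Xm by simp
      qed
      have lnX: "0 < ln X" using X2 by simp
      have "ln X \<le> ln (2 ^ 2 ^ k)" using k X2 by (subst ln_le_cancel_iff) auto
      also have "\<dots> = 2 ^ k * ln 2" by (simp add: ln_realpow)
      also have "\<dots> \<le> 2 ^ k * 1" using ln_le_minus_one[of "2::real"] by (intro mult_left_mono) auto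
      finally have "ln (ln X) \<le> ln (2 ^ k)" using lnX by (subst ln_le_cancel_iff) auto
      also have "\<dots> = real k * ln 2" by (simp add: ln_realpow)
      also have "\<dots> \<le> real k * 1" using ln_le_minus_one[of "2::real"] by (intro mult_left_mono) auto
      finally have "ln (ln X) \<le> real (m + 1)" using m(1) by simp
      also have "m + 1 \<le> 2 ^ 80 * (H + 1)"
        unfolding H_def using dividend_less_times_div[of "2 ^ 80" m] by simp
      then have "real (m + 1) \<le> real (2 ^ 80 * (H + 1))" by (simp only: of_nat_le_iff)
      finally show ?thesis by simp
    qed
    ultimately show ?thesis by blast
  qed
  then show ?thesis by (intro exI[of _ "2 ^ 2 ^ m0"]) auto
qed

theorem theorem1p1:
  shows "(\<exists>c>0::real. \<exists>X0>0::real. \<forall>X\<ge>X0. \<exists>N H::nat.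
            int H \<ge> \<lfloor>c * ln (ln X)\<rfloor> \<and>
            real ` {N + 1..N + H} \<subseteq> {1..X} \<and>
            {N + 1..N + H} \<inter> prime_plus_pow2 = {}) \<and>
         (\<exists>c'>0::real. \<forall>\<^sub>F X in at_top.
            real (longest_gap prime_plus_pow2 X) \<ge> c' * ln (ln X))"
proof -
  obtain X0 :: real where X0: "X0 > 0"
    and gap: "\<And>X. X \<ge> X0 \<Longrightarrow> \<exists>N H. real (N + H) \<le> X \<and> {N + 1..N + H} \<inter> prime_plus_pow2 = {}
      \<and> ln (ln X) \<le> 2 ^ 80 * (real H + 1)"
    using long_gap_exists by blast
  \<comment> \<open>The factor 2 absorbs the summand 1 in \<open>real H + 1\<close> as soon as \<open>H \<ge> 1\<close>.\<close>
  define c where "c = 1 / (2 * 2 ^ 80 :: real)"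
  have c: "c > 0" by (simp add: c_def)
  have c_ln: "c * ln (ln X) \<le> (real H + 1) / 2" if "ln (ln X) \<le> 2 ^ 80 * (real H + 1)" for X H
    using that by (simp add: c_def)
  have "\<exists>N H::nat. int H \<ge> \<lfloor>c * ln (ln X)\<rfloor> \<and> real ` {N + 1..N + H} \<subseteq> {1..X} \<and>
      {N + 1..N + H} \<inter> prime_plus_pow2 = {}" if X: "X \<ge> X0" for X
  proof -
    obtain N H where NH: "real (N + H) \<le> X" "{N + 1..N + H} \<inter> prime_plus_pow2 = {}"
      "ln (ln X) \<le> 2 ^ 80 * (real H + 1)" using gap[OF X] by blast
    have "c * ln (ln X) < real H + 1" using c_ln[OF NH(3)] by simp
    then have "\<lfloor>c * ln (ln X)\<rfloor> \<le> int H" by linarith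
    moreover have "real ` {N + 1..N + H} \<subseteq> {1..X}" using NH(1) by auto
    ultimately show ?thesis using NH(2) by blast
  qed
  moreover have "\<forall>\<^sub>F X in at_top. real (longest_gap prime_plus_pow2 X) \<ge> c * ln (ln X)"
    using eventually_ge_at_top[of X0] eventually_ge_at_top[of "exp (exp (2 * 2 ^ 80)) :: real"]
  proof eventually_elim
    case (elim X)
    obtain N H where NH: "real (N + H) \<le> X" "{N + 1..N + H} \<inter> prime_plus_pow2 = {}"
      "ln (ln X) \<le> 2 ^ 80 * (real H + 1)" using gap[OF elim(1)] by blast
    have "exp (2 * 2 ^ 80) \<le> ln X" using elim(2) by (subst ln_ge_iff) (auto intro: less_le_trans[OF exp_gt_zero])
    then have "2 * 2 ^ 80 \<le> ln (ln X)" by (subst ln_ge_iff) (auto intro: less_le_trans[OF exp_gt_zero])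
    then have H1: "1 \<le> H" using NH(3) by simp
    then have "H \<in> gap_lengths prime_plus_pow2 X" using NH by (auto simp: gap_lengths_def)
    then have "H \<le> longest_gap prime_plus_pow2 X"
      unfolding longest_gap_def using finite_gap_lengths by (intro Max_ge) auto
    moreover have "c * ln (ln X) \<le> real H" using c_ln[OF NH(3)] H1 by simp
    ultimately show ?case by linarith
  qed
  ultimately show ?thesis using c X0 by blast
qed

end
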